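(* There exists a unique morphism of $A$-corings $$\operatorname{can}:\ \mathcal{G}=M^\dagger\otimes_{T^\dagger}M\to\mathcal{C}$$ such that $$\operatorname{can}\big((\varphi_i\circ\nu_i)\otimes_{T^\dagger}\mu_i(m_i)\big)=\varphi_i(m_{i[0]})m_{i[1]}$$ for all $i\in I$, $m_i\in M_i$ and $\varphi_i\in M_i^*$.
   Context: $k$ is a commutative ring, $A$ a $k$-algebra with unit, $\mathcal{C}$ an $A$-coring. $\mathcal{M}^{\mathcal{C}}$ is the category of right $\mathcal{C}$-comodules, with coactions written $m\mapsto m_{[0]}\otimes_Am_{[1]}$, and $\mathcal{M}^{\mathcal{C}}_{\rm fgp}$ is its full subcategory of comodules that are finitely generated projective as right $A$-modules. Let $(I,\le)$ be a directed partially ordered set and $\mathcal{Z}$ the associated category (objects: elements of $I$; one morphism $a_{ji}:i\to j$ if $i\le j$, none otherwise). A split direct system $\underline{M}^s$ with values in $\mathcal{M}^{\mathcal{C}}_{\rm fgp}$ consists of objects $M_i$ ($i\in I$) and, for $i\le j$, $\mathcal{C}$-colinear maps $\mu_{ji}:M_i\to M_j$, $\nu_{ij}:M_j\to M_i$ with $\nu_{ij}\circ\mu_{ji}=\mathrm{id}_{M_i}$, functorial in the sense that $\mu_{ii}=\nu_{ii}=\mathrm{id}$, $\mu_{kj}\circ\mu_{ji}=\mu_{ki}$, $\nu_{ij}\circ\nu_{jk}=\nu_{ik}$ for $i\le j\le k$. Fix such a system. Let $(M,\mu)$ be the colimit in $\mathcal{M}^{\mathcal{C}}$ of the direct system $(M_i,\mu_{ji})$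 (it exists), with cocone maps $\mu_i:M_i\to M$, and let $\nu_i:M\to M_i$ be the unique $\mathcal{C}$-colinear maps with $\nu_i\circ\mu_i=\mathrm{id}_{M_i}$ and $\nu_i=\nu_{ij}\circ\nu_j$ for $i\le j$. $M_i^*=\operatorname{Hom}_A(M_i,A)$ and $M^*=\operatorname{Hom}_A(M,A)$ (right $A$-linear maps). $T_i=\operatorname{End}^{\mathcal{C}}(M_i)$, $T=\operatorname{End}^{\mathcal{C}}(M)$, $e_i=\mu_i\circ\nu_i\in T$, $T^\dagger=\{t\in T\mid\exists i:\ t=e_i\circ t\circ e_i\}$ (a $k$-algebra with idempotent local units $e_i$, which is the colimit of the $T_i$ along $t_i\mapsto\mu_{ji}\circ t_i\circ\nu_{ij}$). $M^\dagger=\{\varphi\in M^*\mid\exists i\in I:\ \varphi=\varphi\circ\mu_i\circ\nu_i\}$, an $(A,T^\dagger)$-bimodule with right action by composition; $M$ is a left $T^\dagger$-module by evaluation. $\mathcal{G}=M^\dagger\otimes_{T^\dagger}M$ is the associated comatrix $A$-coring, with $$\Delta\big((\varphi_i\circ\nu_i)\otimes\mu_i(m_i)\big)=\sum\big((\varphi_i\circ\nu_i)\otimes\mu_i(z_i)\big)\otimes_A\big((z_i^*\circ\nu_i)\otimes\mu_i(m_i)\big),\quad \varepsilon\big((\varphi_i\circ\nu_i)\otimes\mu_i(m_i)\big)=\varphi_i(m_i),$$ where $\sum z_i\otimes_Az_i^*\in M_i\otimes_AM_i^*$ is the finite dual basis of $M_i$ over $A$ (summation index omitted). A morphism of $A$-corings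 is an $A$-bimodule map compatible with comultiplications and counits. *)

theory Defs
  imports "HOL-Algebra.Algebra"
begin

section \<open>Algebras, modules and bimodules\<close>

text \<open>The \<^locale>\<open>algebra\<close> locale of the library only covers commutative algebras.\<close>

locale k_algebra = alg: module K A + scal: ring A
  for K :: "('k, 'v) ring_scheme" (structure) and A :: "('k, 'a, 'w) module_scheme" (structure) +
  assumes smult_mult_left:
      "\<lbrakk>l \<in> carrier K; a \<in> carrier A; b \<in> carrier A\<rbrakk>
        \<Longrightarrow> (l \<odot>\<^bsub>A\<^esub> a) \<otimes>\<^bsub>A\<^esub> b = l \<odot>\<^bsub>A\<^esub> (a \<otimes>\<^bsub>A\<^esub> b)"
    and smult_mult_right:
      "\<lbrakk>l \<in> carrier K; a \<in> carrier A; b \<in> carrier A\<rbrakk>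
        \<Longrightarrow> a \<otimes>\<^bsub>A\<^esub> (l \<odot>\<^bsub>A\<^esub> b) = l \<odot>\<^bsub>A\<^esub> (a \<otimes>\<^bsub>A\<^esub> b)"

text \<open>As for the library's record \<^typ>\<open>('a, 'b) module\<close>, only the additive part of the
  underlying ring record of a module is meaningful.\<close>

record ('m, 'r) rmod = "'m ring" +
  rsmult :: "'m \<Rightarrow> 'r \<Rightarrow> 'm" (infixl \<open>\<triangleleft>\<index>\<close> 70)

record ('m, 'r, 'l) bimod = "('m, 'r) rmod" +
  lsmult :: "'l \<Rightarrow> 'm \<Rightarrow> 'm" (infixr \<open>\<triangleright>\<index>\<close> 70)

locale right_module = scal: ring A + ab: abelian_group M
  for A :: "('a, 'w) ring_scheme" (structure) and M :: "('m, 'a, 'x) rmod_scheme" (structure) +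
  assumes ract_closed: "\<lbrakk>m \<in> carrier M; a \<in> carrier A\<rbrakk> \<Longrightarrow> m \<triangleleft>\<^bsub>M\<^esub> a \<in> carrier M"
    and ract_add_left: "\<lbrakk>m \<in> carrier M; n \<in> carrier M; a \<in> carrier A\<rbrakk>
      \<Longrightarrow> (m \<oplus>\<^bsub>M\<^esub> n) \<triangleleft>\<^bsub>M\<^esub> a = m \<triangleleft>\<^bsub>M\<^esub> a \<oplus>\<^bsub>M\<^esub> n \<triangleleft>\<^bsub>M\<^esub> a"
    and ract_add_right: "\<lbrakk>m \<in> carrier M; a \<in> carrier A; b \<in> carrier A\<rbrakk>
      \<Longrightarrow> m \<triangleleft>\<^bsub>M\<^esub> (a \<oplus>\<^bsub>A\<^esub> b) = m \<triangleleft>\<^bsub>M\<^esub> a \<oplus>\<^bsub>M\<^esub> m \<triangleleft>\<^bsub>M\<^esub> b"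
    and ract_mult: "\<lbrakk>m \<in> carrier M; a \<in> carrier A; b \<in> carrier A\<rbrakk>
      \<Longrightarrow> m \<triangleleft>\<^bsub>M\<^esub> (a \<otimes>\<^bsub>A\<^esub> b) = (m \<triangleleft>\<^bsub>M\<^esub> a) \<triangleleft>\<^bsub>M\<^esub> b"
    and ract_one: "m \<in> carrier M \<Longrightarrow> m \<triangleleft>\<^bsub>M\<^esub> \<one>\<^bsub>A\<^esub> = m"

text \<open>Bimodules over a \<open>K\<close>-algebra are \<open>K\<close>-symmetric.\<close>

locale k_bimodule = k_algebra K A + right_module A M
  for K :: "('k, 'v) ring_scheme" (structure) and A :: "('k, 'a, 'w) module_scheme" (structure)
    and M :: "('m, 'a, 'a, 'x) bimod_scheme" (structure) +
  assumes lact_closed: "\<lbrakk>a \<in> carrier A; m \<in> carrier M\<rbrakk> \<Longrightarrow> a \<triangleright>\<^bsub>M\<^esub> m \<in> carrier M"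
    and lact_add_right: "\<lbrakk>a \<in> carrier A; m \<in> carrier M; n \<in> carrier M\<rbrakk>
      \<Longrightarrow> a \<triangleright>\<^bsub>M\<^esub> (m \<oplus>\<^bsub>M\<^esub> n) = (a \<triangleright>\<^bsub>M\<^esub> m) \<oplus>\<^bsub>M\<^esub> (a \<triangleright>\<^bsub>M\<^esub> n)"
    and lact_add_left: "\<lbrakk>a \<in> carrier A; b \<in> carrier A; m \<in> carrier M\<rbrakk>
      \<Longrightarrow> (a \<oplus>\<^bsub>A\<^esub> b) \<triangleright>\<^bsub>M\<^esub> m = (a \<triangleright>\<^bsub>M\<^esub> m) \<oplus>\<^bsub>M\<^esub> (b \<triangleright>\<^bsub>M\<^esub> m)"
    and lact_mult: "\<lbrakk>a \<in> carrier A; b \<in> carrier A; m \<in> carrier M\<rbrakk>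
      \<Longrightarrow> (a \<otimes>\<^bsub>A\<^esub> b) \<triangleright>\<^bsub>M\<^esub> m = a \<triangleright>\<^bsub>M\<^esub> (b \<triangleright>\<^bsub>M\<^esub> m)"
    and lact_one: "m \<in> carrier M \<Longrightarrow> \<one>\<^bsub>A\<^esub> \<triangleright>\<^bsub>M\<^esub> m = m"
    and lact_ract: "\<lbrakk>a \<in> carrier A; m \<in> carrier M; b \<in> carrier A\<rbrakk>
      \<Longrightarrow> (a \<triangleright>\<^bsub>M\<^esub> m) \<triangleleft>\<^bsub>M\<^esub> b = a \<triangleright>\<^bsub>M\<^esub> (m \<triangleleft>\<^bsub>M\<^esub> b)"
    and k_symmetric: "\<lbrakk>l \<in> carrier K; m \<in> carrier M\<rbrakk>
      \<Longrightarrow> (l \<odot>\<^bsub>A\<^esub> \<one>\<^bsub>A\<^esub>) \<triangleright>\<^bsub>M\<^esub> m = m \<triangleleft>\<^bsub>M\<^esub> (l \<odot>\<^bsub>A\<^esub> \<one>\<^bsub>A\<^esub>)"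

definition regular_bimod :: "('a, 'x) ring_scheme \<Rightarrow> ('a, 'a, 'a) bimod" where
  "regular_bimod A = \<lparr>carrier = carrier A, monoid.mult = monoid.mult A, one = \<one>\<^bsub>A\<^esub>,
     ring.zero = \<zero>\<^bsub>A\<^esub>,
     ring.add = ring.add A, rsmult = monoid.mult A, lsmult = monoid.mult A\<rparr>"

text \<open>The predicates \<open>is_\<dots>_hom\<close> only look at the values on the carrier; the sets \<open>\<dots>_hom\<close>
  consist of the extensional representatives, so that equality in them is equality of maps.\<close>

definition is_rmod_hom ::
  "('a, 'x) ring_scheme \<Rightarrow> ('m, 'a, 'y) rmod_scheme \<Rightarrow> ('n, 'a, 'z) rmod_scheme \<Rightarrow> ('m \<Rightarrow> 'n) \<Rightarrow> bool"
  where
  "is_rmod_hom A M N f \<longleftrightarrow> f \<in> carrier M \<rightarrow> carrier N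
     \<and> (\<forall>x\<in>carrier M. \<forall>y\<in>carrier M. f (x \<oplus>\<^bsub>M\<^esub> y) = f x \<oplus>\<^bsub>N\<^esub> f y)
     \<and> (\<forall>x\<in>carrier M. \<forall>a\<in>carrier A. f (x \<triangleleft>\<^bsub>M\<^esub> a) = f x \<triangleleft>\<^bsub>N\<^esub> a)"

definition is_bimod_hom ::
  "('a, 'x) ring_scheme \<Rightarrow> ('m, 'a, 'a, 'y) bimod_scheme \<Rightarrow> ('n, 'a, 'a, 'z) bimod_scheme
    \<Rightarrow> ('m \<Rightarrow> 'n) \<Rightarrow> bool" where
  "is_bimod_hom A M N f \<longleftrightarrow> is_rmod_hom A M N f
     \<and> (\<forall>a\<in>carrier A. \<forall>x\<in>carrier M. f (a \<triangleright>\<^bsub>M\<^esub> x) = a \<triangleright>\<^bsub>N\<^esub> f x)"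

definition rmod_hom where
  "rmod_hom A M N = {f \<in> extensional (carrier M). is_rmod_hom A M N f}"

definition bimod_hom where
  "bimod_hom A M N = {f \<in> extensional (carrier M). is_bimod_hom A M N f}"

definition dual ::
  "('a, 'x) ring_scheme \<Rightarrow> ('m, 'a, 'y) rmod_scheme \<Rightarrow> ('m \<Rightarrow> 'a) set" where
  "dual A M = rmod_hom A M (regular_bimod A)"

definition free_rmod :: "('a, 'x) ring_scheme \<Rightarrow> nat \<Rightarrow> (nat \<Rightarrow> 'a, 'a) rmod" where
  "free_rmod A n = \<lparr>carrier = {..<n} \<rightarrow>\<^sub>E carrier A,
     monoid.mult = undefined, one = undefined,
     ring.zero = (\<lambda>s\<in>{..<n}. \<zero>\<^bsub>A\<^esub>), ring.add = (\<lambda>v w. \<lambda>s\<in>{..<n}. v s \<oplus>\<^bsub>A\<^esub> w s),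
     rsmult = (\<lambda>v a. \<lambda>s\<in>{..<n}. v s \<otimes>\<^bsub>A\<^esub> a)\<rparr>"

text \<open>Finitely generated projective: a direct summand of some \<open>A\<^sup>n\<close>.\<close>

definition fgp :: "('a, 'x) ring_scheme \<Rightarrow> ('m, 'a, 'y) rmod_scheme \<Rightarrow> bool" where
  "fgp A P \<longleftrightarrow> right_module A P
     \<and> (\<exists>n f g. is_rmod_hom A P (free_rmod A n) f \<and> is_rmod_hom A (free_rmod A n) P g
          \<and> (\<forall>x\<in>carrier P. g (f x) = x))"

definition dual_basis ::
  "('a, 'x) ring_scheme \<Rightarrow> ('m, 'a, 'y) rmod_scheme \<Rightarrow> nat \<Rightarrow> (nat \<Rightarrow> 'm) \<Rightarrow> (nat \<Rightarrow> 'm \<Rightarrow> 'a) \<Rightarrow> bool"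
  where
  "dual_basis A P n z zs \<longleftrightarrow> z \<in> {..<n} \<rightarrow> carrier P \<and> zs \<in> {..<n} \<rightarrow> dual A P
     \<and> (\<forall>x\<in>carrier P. x = (\<Oplus>\<^bsub>P\<^esub>s\<in>{..<n}. z s \<triangleleft>\<^bsub>P\<^esub> zs s x))"


section \<open>Tensor products over a possibly noncommutative, possibly nonunital ring\<close>

text \<open>The tensor product of a right and a left module is the free abelian group on pairs modulo
  the usual relations. Only the set \<open>S\<close> of scalars over which one balances enters, not its ring
  structure, hence it need not have a unit.\<close>

type_synonym ('m, 'n) tens = "(('m \<times> 'n) \<Rightarrow>\<^sub>0 int) set"

definition tensor_relations ::
  "'s set \<Rightarrow> ('m, 's, 'x) rmod_scheme \<Rightarrow> ('n, 'r, 's, 'y) bimod_scheme \<Rightarrow> ('m, 'n) tens" where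
  "tensor_relations S M N =
     {frag_of (m \<oplus>\<^bsub>M\<^esub> m', n) - frag_of (m, n) - frag_of (m', n) | m m' n.
        m \<in> carrier M \<and> m' \<in> carrier M \<and> n \<in> carrier N}
   \<union> {frag_of (m, n \<oplus>\<^bsub>N\<^esub> n') - frag_of (m, n) - frag_of (m, n') | m n n'.
        m \<in> carrier M \<and> n \<in> carrier N \<and> n' \<in> carrier N}
   \<union> {frag_of (m \<triangleleft>\<^bsub>M\<^esub> s, n) - frag_of (m, s \<triangleright>\<^bsub>N\<^esub> n) | m s n.
        m \<in> carrier M \<and> s \<in> S \<and> n \<in> carrier N}"

definition tensor_null ::
  "'s set \<Rightarrow> ('m, 's, 'x) rmod_scheme \<Rightarrow> ('n, 'r, 's, 'y) bimod_scheme \<Rightarrow> ('m, 'n) tens" where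
  "tensor_null S M N =
     generate (free_Abelian_group (carrier M \<times> carrier N)) (tensor_relations S M N)"

definition tensor_group ::
  "'s set \<Rightarrow> ('m, 's, 'x) rmod_scheme \<Rightarrow> ('n, 'r, 's, 'y) bimod_scheme \<Rightarrow> ('m, 'n) tens monoid" where
  "tensor_group S M N = free_Abelian_group (carrier M \<times> carrier N) Mod tensor_null S M N"

definition tens ::
  "'s set \<Rightarrow> ('m, 's, 'x) rmod_scheme \<Rightarrow> ('n, 'r, 's, 'y) bimod_scheme \<Rightarrow> 'm \<Rightarrow> 'n \<Rightarrow> ('m, 'n) tens"
  where
  "tens S M N m n =
     tensor_null S M N #>\<^bsub>free_Abelian_group (carrier M \<times> carrier N)\<^esub> frag_of (m, n)"

text \<open>\<open>tlift P \<beta>\<close> is the additive map into \<open>P\<close> induced by a balanced biadditive map \<open>\<beta>\<close>, sending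
  \<open>\<Sum> k\<^sub>j (m\<^sub>j \<otimes> n\<^sub>j)\<close> to \<open>\<Sum> k\<^sub>j \<beta> m\<^sub>j n\<^sub>j\<close>; it is meaningful only for such \<open>\<beta>\<close>,
  the image of a coset then being a singleton.\<close>

definition tlift :: "('p, 'x) ring_scheme \<Rightarrow> ('m \<Rightarrow> 'n \<Rightarrow> 'p) \<Rightarrow> ('m, 'n) tens \<Rightarrow> 'p" where
  "tlift P \<beta> t = the_elem ((\<lambda>x. \<Oplus>\<^bsub>P\<^esub>p\<in>Poly_Mapping.keys x.
      [Poly_Mapping.lookup x p] \<cdot>\<^bsub>P\<^esub> \<beta> (fst p) (snd p)) ` t)"

definition tensor_ab ::
  "'s set \<Rightarrow> ('m, 's, 'x) rmod_scheme \<Rightarrow> ('n, 'r, 's, 'y) bimod_scheme \<Rightarrow> ('m, 'n) tens ring" where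
  "tensor_ab S M N = \<lparr>carrier = carrier (tensor_group S M N), monoid.mult = undefined, one = undefined,
     ring.zero = \<one>\<^bsub>tensor_group S M N\<^esub>, ring.add = monoid.mult (tensor_group S M N)\<rparr>"

definition tensor ::
  "'s set \<Rightarrow> ('m, 's, 'x) rmod_scheme \<Rightarrow> ('n, 'r, 's, 'y) bimod_scheme \<Rightarrow> (('m, 'n) tens, 'r) rmod"
  where
  "tensor S M N = ring.extend (tensor_ab S M N)
     (rmod.fields (\<lambda>t r. tlift (tensor_ab S M N) (\<lambda>m n. tens S M N m (n \<triangleleft>\<^bsub>N\<^esub> r)) t))"

definition bitensor ::
  "'s set \<Rightarrow> ('m, 's, 'l, 'x) bimod_scheme \<Rightarrow> ('n, 'r, 's, 'y) bimod_scheme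
    \<Rightarrow> (('m, 'n) tens, 'r, 'l) bimod" where
  "bitensor S M N = rmod.extend (tensor S M N)
     (bimod.fields (\<lambda>l t. tlift (tensor_ab S M N) (\<lambda>m n. tens S M N (l \<triangleright>\<^bsub>M\<^esub> m) n) t))"

definition tensor_map ::
  "'s set \<Rightarrow> ('m, 's, 'x) rmod_scheme \<Rightarrow> ('n, 'r, 's, 'y) bimod_scheme
    \<Rightarrow> ('m' \<Rightarrow> 'm) \<Rightarrow> ('n' \<Rightarrow> 'n) \<Rightarrow> ('m', 'n') tens \<Rightarrow> ('m, 'n) tens" where
  "tensor_map S M N f g = tlift (tensor_ab S M N) (\<lambda>m' n'. tens S M N (f m') (g n'))"

definition tensor_assoc ::
  "'s set \<Rightarrow> 'r set \<Rightarrow> ('m, 's, 'x) rmod_scheme \<Rightarrow> ('n, 'r, 's, 'y) bimod_scheme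
    \<Rightarrow> ('p, 'q, 'r, 'z) bimod_scheme \<Rightarrow> (('m, 'n) tens, 'p) tens \<Rightarrow> ('m, ('n, 'p) tens) tens" where
  "tensor_assoc S R M N P =
     tlift (tensor_ab S M (bitensor R N P))
       (\<lambda>t p. tlift (tensor_ab S M (bitensor R N P))
         (\<lambda>m n. tens S M (bitensor R N P) m (tens R N P n p)) t)"


section \<open>Corings and comodules\<close>

record ('c, 'a) coring = "('c, 'a, 'a) bimod" +
  comult :: "'c \<Rightarrow> ('c, 'c) tens"
  counit :: "'c \<Rightarrow> 'a"

record ('m, 'a, 'c) comod = "('m, 'a) rmod" +
  coact :: "'m \<Rightarrow> ('m, 'c) tens"

locale coring = k_bimodule K A C
  for K :: "('k, 'v) ring_scheme" (structure) and A :: "('k, 'a, 'w) module_scheme" (structure)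
    and C :: "('c, 'a, 'x) coring_scheme" (structure) +
  assumes comult_hom: "is_bimod_hom A C (bitensor (carrier A) C C) (comult C)"
    and counit_hom: "is_bimod_hom A C (regular_bimod A) (counit C)"
    and coassoc: "c \<in> carrier C \<Longrightarrow>
      tensor_assoc (carrier A) (carrier A) C C C
        (tensor_map (carrier A) (tensor (carrier A) C C) C (comult C) id (comult C c))
      = tensor_map (carrier A) C (bitensor (carrier A) C C) id (comult C) (comult C c)"
    and counit_left: "c \<in> carrier C \<Longrightarrow>
      tlift C (\<lambda>x y. counit C x \<triangleright>\<^bsub>C\<^esub> y) (comult C c) = c"
    and counit_right: "c \<in> carrier C \<Longrightarrow>
      tlift C (\<lambda>x y. x \<triangleleft>\<^bsub>C\<^esub> counit C y) (comult C c) = c"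

definition coring_hom ::
  "('a, 'x) ring_scheme \<Rightarrow> ('c, 'a, 'y) coring_scheme \<Rightarrow> ('d, 'a, 'z) coring_scheme
    \<Rightarrow> ('c \<Rightarrow> 'd) set" where
  "coring_hom A C D = {f \<in> bimod_hom A C D.
     (\<forall>c\<in>carrier C. comult D (f c) = tensor_map (carrier A) D D f f (comult C c))
   \<and> (\<forall>c\<in>carrier C. counit D (f c) = counit C c)}"

locale comodule = right_module A M
  for A :: "('a, 'w) ring_scheme" (structure) and C :: "('c, 'a, 'x) coring_scheme" (structure)
    and M :: "('m, 'a, 'c, 'y) comod_scheme" (structure) +
  assumes coact_hom: "is_rmod_hom A M (tensor (carrier A) M C) (coact M)"
    and coact_coassoc: "m \<in> carrier M \<Longrightarrow>
      tensor_assoc (carrier A) (carrier A) M C C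
        (tensor_map (carrier A) (tensor (carrier A) M C) C (coact M) id (coact M m))
      = tensor_map (carrier A) M (bitensor (carrier A) C C) id (comult C) (coact M m)"
    and coact_counit: "m \<in> carrier M \<Longrightarrow>
      tlift M (\<lambda>x c. x \<triangleleft>\<^bsub>M\<^esub> counit C c) (coact M m) = m"

definition is_comod_hom ::
  "('a, 'x) ring_scheme \<Rightarrow> ('c, 'a, 'y) coring_scheme \<Rightarrow> ('m, 'a, 'c, 'z) comod_scheme
    \<Rightarrow> ('n, 'a, 'c, 'w) comod_scheme \<Rightarrow> ('m \<Rightarrow> 'n) \<Rightarrow> bool" where
  "is_comod_hom A C M N f \<longleftrightarrow> is_rmod_hom A M N f
     \<and> (\<forall>m\<in>carrier M. coact N (f m) = tensor_map (carrier A) N C f id (coact M m))"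

definition comod_hom where
  "comod_hom A C M N = {f \<in> extensional (carrier M). is_comod_hom A C M N f}"


section \<open>Split direct systems and their colimits\<close>

text \<open>A directed partially ordered set is a type of class \<^class>\<open>order\<close> in which
  \<open>\<forall>i j. \<exists>k. i \<le> k \<and> j \<le> k\<close>.\<close>

definition split_direct_system ::
  "('a, 'x) ring_scheme \<Rightarrow> ('c, 'a, 'y) coring_scheme \<Rightarrow> ('i::order \<Rightarrow> ('m, 'a, 'c) comod)
    \<Rightarrow> ('i \<Rightarrow> 'i \<Rightarrow> 'm \<Rightarrow> 'm) \<Rightarrow> ('i \<Rightarrow> 'i \<Rightarrow> 'm \<Rightarrow> 'm) \<Rightarrow> bool" where
  "split_direct_system A C Ms \<mu> \<nu> \<longleftrightarrow>
     (\<forall>i j :: 'i. \<exists>k. i \<le> k \<and> j \<le> k)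
   \<and> (\<forall>i. comodule A C (Ms i) \<and> fgp A (Ms i))
   \<and> (\<forall>i j. i \<le> j \<longrightarrow> is_comod_hom A C (Ms i) (Ms j) (\<mu> j i))
   \<and> (\<forall>i j. i \<le> j \<longrightarrow> is_comod_hom A C (Ms j) (Ms i) (\<nu> i j))
   \<and> (\<forall>i j. i \<le> j \<longrightarrow> (\<forall>m\<in>carrier (Ms i). \<nu> i j (\<mu> j i m) = m))
   \<and> (\<forall>i. \<forall>m\<in>carrier (Ms i). \<mu> i i m = m \<and> \<nu> i i m = m)
   \<and> (\<forall>i j k. i \<le> j \<longrightarrow> j \<le> k \<longrightarrow> (\<forall>m\<in>carrier (Ms i). \<mu> k j (\<mu> j i m) = \<mu> k i m))
   \<and> (\<forall>i j k. i \<le> j \<longrightarrow> j \<le> k \<longrightarrow> (\<forall>m\<in>carrier (Ms k). \<nu> i j (\<nu> j k m) = \<nu> i k m))"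

definition is_cocone ::
  "('a, 'x) ring_scheme \<Rightarrow> ('c, 'a, 'y) coring_scheme \<Rightarrow> ('i::order \<Rightarrow> ('m, 'a, 'c) comod)
    \<Rightarrow> ('i \<Rightarrow> 'i \<Rightarrow> 'm \<Rightarrow> 'm) \<Rightarrow> ('m, 'a, 'c) comod \<Rightarrow> ('i \<Rightarrow> 'm \<Rightarrow> 'm) \<Rightarrow> bool" where
  "is_cocone A C Ms \<mu> N f \<longleftrightarrow> comodule A C N
     \<and> (\<forall>i. is_comod_hom A C (Ms i) N (f i))
     \<and> (\<forall>i j. i \<le> j \<longrightarrow> (\<forall>m\<in>carrier (Ms i). f j (\<mu> j i m) = f i m))"

text \<open>The type \<open>'m\<close> plays the role of a universe: \<open>(M, \<mu>M)\<close> is a colimit in the category of all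
  \<open>C\<close>-comodules carried by subsets of \<open>'m\<close>. For a split system over a directed set such a
  colimit is also one in the category of all comodules. Indeed, testing against the \<open>Ms i\<close>
  themselves shows that the cocone maps are injective, and testing against the subcomodule
  given by the union of their images shows that this union is all of \<open>M\<close>.\<close>

definition is_colimit ::
  "('a, 'x) ring_scheme \<Rightarrow> ('c, 'a, 'y) coring_scheme \<Rightarrow> ('i::order \<Rightarrow> ('m, 'a, 'c) comod)
    \<Rightarrow> ('i \<Rightarrow> 'i \<Rightarrow> 'm \<Rightarrow> 'm) \<Rightarrow> ('m, 'a, 'c) comod \<Rightarrow> ('i \<Rightarrow> 'm \<Rightarrow> 'm) \<Rightarrow> bool" where
  "is_colimit A C Ms \<mu> M \<mu>M \<longleftrightarrow> is_cocone A C Ms \<mu> M \<mu>M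
     \<and> (\<forall>N f. is_cocone A C Ms \<mu> N f \<longrightarrow>
          (\<exists>!h. h \<in> comod_hom A C M N \<and> (\<forall>i. \<forall>m\<in>carrier (Ms i). h (\<mu>M i m) = f i m)))"


section \<open>The comatrix coring of a split direct system\<close>

text \<open>Below, \<open>\<mu>M i : Ms i \<rightarrow> M\<close> and \<open>\<nu>M i : M \<rightarrow> Ms i\<close> are the structure maps of the colimit.\<close>

definition idem :: "('m, 'y) ring_scheme \<Rightarrow> ('i \<Rightarrow> 'm \<Rightarrow> 'm) \<Rightarrow> ('i \<Rightarrow> 'm \<Rightarrow> 'm) \<Rightarrow> 'i \<Rightarrow> 'm \<Rightarrow> 'm" where
  "idem M \<mu>M \<nu>M i = compose (carrier M) (\<mu>M i) (\<nu>M i)"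

definition T_dag ::
  "('a, 'x) ring_scheme \<Rightarrow> ('c, 'a, 'y) coring_scheme \<Rightarrow> ('m, 'a, 'c) comod
    \<Rightarrow> ('i \<Rightarrow> 'm \<Rightarrow> 'm) \<Rightarrow> ('i \<Rightarrow> 'm \<Rightarrow> 'm) \<Rightarrow> ('m \<Rightarrow> 'm) set" where
  "T_dag A C M \<mu>M \<nu>M = {t \<in> comod_hom A C M M. \<exists>i.
     t = compose (carrier M) (idem M \<mu>M \<nu>M i) (compose (carrier M) t (idem M \<mu>M \<nu>M i))}"

definition M_dag ::
  "('a, 'x) ring_scheme \<Rightarrow> ('m, 'a, 'c) comod
    \<Rightarrow> ('i \<Rightarrow> 'm \<Rightarrow> 'm) \<Rightarrow> ('i \<Rightarrow> 'm \<Rightarrow> 'm) \<Rightarrow> ('m \<Rightarrow> 'a, 'm \<Rightarrow> 'm, 'a) bimod" where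
  "M_dag A M \<mu>M \<nu>M = \<lparr>
     carrier = {\<phi> \<in> dual A M. \<exists>i. \<phi> = compose (carrier M) \<phi> (idem M \<mu>M \<nu>M i)},
     monoid.mult = undefined, one = undefined,
     ring.zero = (\<lambda>m\<in>carrier M. \<zero>\<^bsub>A\<^esub>),
     ring.add = (\<lambda>\<phi> \<psi>. \<lambda>m\<in>carrier M. \<phi> m \<oplus>\<^bsub>A\<^esub> \<psi> m),
     rsmult = compose (carrier M),
     lsmult = (\<lambda>a \<phi>. \<lambda>m\<in>carrier M. a \<otimes>\<^bsub>A\<^esub> \<phi> m)\<rparr>"

text \<open>\<open>M\<close> as a left module over its endomorphisms, which act by evaluation.\<close>

definition eval_bimod :: "('m, 'a, 'c) comod \<Rightarrow> ('m, 'a, 'm \<Rightarrow> 'm) bimod" where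
  "eval_bimod M = rmod.extend (rmod.truncate M) (bimod.fields (\<lambda>t m. t m))"

type_synonym ('m, 'a) comatrix = "('m \<Rightarrow> 'a, 'm) tens"

definition comatrix_bimod ::
  "('a, 'x) ring_scheme \<Rightarrow> ('c, 'a, 'y) coring_scheme \<Rightarrow> ('m, 'a, 'c) comod
    \<Rightarrow> ('i \<Rightarrow> 'm \<Rightarrow> 'm) \<Rightarrow> ('i \<Rightarrow> 'm \<Rightarrow> 'm) \<Rightarrow> (('m, 'a) comatrix, 'a, 'a) bimod" where
  "comatrix_bimod A C M \<mu>M \<nu>M =
     bitensor (T_dag A C M \<mu>M \<nu>M) (M_dag A M \<mu>M \<nu>M) (eval_bimod M)"

definition comatrix_elem ::
  "('a, 'x) ring_scheme \<Rightarrow> ('c, 'a, 'y) coring_scheme \<Rightarrow> ('m, 'a, 'c) comod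
    \<Rightarrow> ('i \<Rightarrow> 'm \<Rightarrow> 'm) \<Rightarrow> ('i \<Rightarrow> 'm \<Rightarrow> 'm) \<Rightarrow> ('m \<Rightarrow> 'a) \<Rightarrow> 'm \<Rightarrow> ('m, 'a) comatrix" where
  "comatrix_elem A C M \<mu>M \<nu>M =
     tens (T_dag A C M \<mu>M \<nu>M) (M_dag A M \<mu>M \<nu>M) (eval_bimod M)"

text \<open>The comultiplication and the counit are the bimodule maps with the prescribed values on the
  generators \<open>(\<phi> \<circ> \<nu>M i) \<otimes> \<mu>M i m\<close>; the former value is stated for every dual basis, as it does
  not depend on the choice.\<close>

definition comatrix_comult ::
  "('a, 'x) ring_scheme \<Rightarrow> ('c, 'a, 'y) coring_scheme \<Rightarrow> ('i \<Rightarrow> ('m, 'a, 'c) comod)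
    \<Rightarrow> ('m, 'a, 'c) comod \<Rightarrow> ('i \<Rightarrow> 'm \<Rightarrow> 'm) \<Rightarrow> ('i \<Rightarrow> 'm \<Rightarrow> 'm)
    \<Rightarrow> ('m, 'a) comatrix \<Rightarrow> (('m, 'a) comatrix, ('m, 'a) comatrix) tens" where
  "comatrix_comult A C Ms M \<mu>M \<nu>M =
    (let G = comatrix_bimod A C M \<mu>M \<nu>M;
         GG = bitensor (carrier A) G G;
         el = comatrix_elem A C M \<mu>M \<nu>M
     in THE D. D \<in> bimod_hom A G GG
       \<and> (\<forall>i. \<forall>\<phi>\<in>dual A (Ms i). \<forall>m\<in>carrier (Ms i). \<forall>n z zs. dual_basis A (Ms i) n z zs \<longrightarrow>
            D (el (compose (carrier M) \<phi> (\<nu>M i)) (\<mu>M i m))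
            = (\<Oplus>\<^bsub>GG\<^esub>s\<in>{..<n}. tens (carrier A) G G
                 (el (compose (carrier M) \<phi> (\<nu>M i)) (\<mu>M i (z s)))
                 (el (compose (carrier M) (zs s) (\<nu>M i)) (\<mu>M i m)))))"

definition comatrix_counit ::
  "('a, 'x) ring_scheme \<Rightarrow> ('c, 'a, 'y) coring_scheme \<Rightarrow> ('i \<Rightarrow> ('m, 'a, 'c) comod)
    \<Rightarrow> ('m, 'a, 'c) comod \<Rightarrow> ('i \<Rightarrow> 'm \<Rightarrow> 'm) \<Rightarrow> ('i \<Rightarrow> 'm \<Rightarrow> 'm) \<Rightarrow> ('m, 'a) comatrix \<Rightarrow> 'a" where
  "comatrix_counit A C Ms M \<mu>M \<nu>M =
    (THE e. e \<in> bimod_hom A (comatrix_bimod A C M \<mu>M \<nu>M) (regular_bimod A)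
       \<and> (\<forall>i. \<forall>\<phi>\<in>dual A (Ms i). \<forall>m\<in>carrier (Ms i).
            e (comatrix_elem A C M \<mu>M \<nu>M (compose (carrier M) \<phi> (\<nu>M i)) (\<mu>M i m)) = \<phi> m))"

definition comatrix_coring ::
  "('a, 'x) ring_scheme \<Rightarrow> ('c, 'a, 'y) coring_scheme \<Rightarrow> ('i \<Rightarrow> ('m, 'a, 'c) comod)
    \<Rightarrow> ('m, 'a, 'c) comod \<Rightarrow> ('i \<Rightarrow> 'm \<Rightarrow> 'm) \<Rightarrow> ('i \<Rightarrow> 'm \<Rightarrow> 'm) \<Rightarrow> (('m, 'a) comatrix, 'a) coring"
  where
  "comatrix_coring A C Ms M \<mu>M \<nu>M = bimod.extend (comatrix_bimod A C M \<mu>M \<nu>M)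
     (coring.fields (comatrix_comult A C Ms M \<mu>M \<nu>M) (comatrix_counit A C Ms M \<mu>M \<nu>M))"

end

theory Submission
  imports Defs
begin

text \<open>For \<open>\<phi> \<in> M\<^sup>\<dagger>\<close> and \<open>m \<in> M\<close> put \<open>can(\<phi> \<otimes> m) = \<phi>(m\<^sub>0) m\<^sub>1\<close>. This expression is biadditive, and it is
  balanced over \<open>T\<^sup>\<dagger>\<close> because the elements of \<open>T\<^sup>\<dagger>\<close> are colinear, so it defines an additive map on
  \<open>G\<close>, which is clearly a bimodule map. It has the prescribed values since \<open>\<mu>\<^sub>i\<close> is colinear and
  \<open>\<nu>\<^sub>i \<circ> \<mu>\<^sub>i = id\<close>. Uniqueness holds because the elements \<open>(\<phi> \<circ> \<nu>\<^sub>i) \<otimes> \<mu>\<^sub>i(m)\<close> span \<open>G\<close> additively: if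
  \<open>\<phi> = \<phi> \<circ> e\<^sub>i\<close>, then \<open>e\<^sub>i \<in> T\<^sup>\<dagger>\<close> may be moved across the tensor sign, so that
  \<open>\<phi> \<otimes> m = (\<phi> \<circ> \<mu>\<^sub>i \<circ> \<nu>\<^sub>i) \<otimes> \<mu>\<^sub>i(\<nu>\<^sub>i(m))\<close> (lemma \<open>el_is_generator\<close>).

  The structure maps of \<open>G\<close> are given by definite descriptions, through their values on these
  generators, so one first has to show that such maps exist. For the counit this is evaluation.
  For the comultiplication let \<open>u\<^sub>s \<in> M\<close> and \<open>u\<^sub>s\<^sup>* \<in> M\<^sup>\<dagger>\<close> come from a dual basis of \<open>M\<^sub>i\<close>, so that
  \<open>e\<^sub>i(x) = \<Sum> u\<^sub>s u\<^sub>s\<^sup>*(x)\<close> for all \<open>x \<in> M\<close>. If \<open>\<phi> = \<phi> \<circ> e\<^sub>i\<close>, then \<open>\<phi> \<otimes> m\<close> has to go to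
  \<open>\<Sum> (\<phi> \<otimes> u\<^sub>s) \<otimes> (u\<^sub>s\<^sup>* \<otimes> m)\<close>. Lemma \<open>local_dual_basis_natural\<close> is the identity
  \<open>\<Sum> t(u\<^sub>s) \<otimes> u\<^sub>s\<^sup>* = \<Sum> v\<^sub>r \<otimes> (v\<^sub>r\<^sup>* \<circ> t)\<close> for \<open>t \<in> T\<^sup>\<dagger>\<close>, in the form in which it is needed here; taking
  \<open>t = e\<^sub>i\<close> it shows that the sum depends neither on \<open>i\<close> nor on the dual basis, and for general \<open>t\<close>
  that the sum is balanced over \<open>T\<^sup>\<dagger>\<close>.

  Compatibility of \<open>can\<close> with the counits is the counit axiom,
  \<open>\<epsilon>(\<phi>(m\<^sub>0) m\<^sub>1) = \<phi>(m\<^sub>0 \<epsilon>(m\<^sub>1)) = \<phi>(m)\<close>. For the comultiplications, coassociativity gives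
  \<open>\<Delta>(can(\<phi> \<otimes> m)) = can(\<phi> \<otimes> m\<^sub>0) \<otimes> m\<^sub>1\<close> (lemma \<open>comult_can_form\<close>). Inserting
  \<open>e\<^sub>i(m\<^sub>0) = \<Sum> u\<^sub>s u\<^sub>s\<^sup>*(m\<^sub>0)\<close> and moving the scalars \<open>u\<^sub>s\<^sup>*(m\<^sub>0)\<close> across the tensor sign turns this into
  \<open>\<Sum> can(\<phi> \<otimes> u\<^sub>s) \<otimes> can(u\<^sub>s\<^sup>* \<otimes> m)\<close> (lemma \<open>can_form_expand\<close>).\<close>


section \<open>Additive maps\<close>

definition additive_map ::
  "('a, 'x) ring_scheme \<Rightarrow> ('b, 'y) ring_scheme \<Rightarrow> ('a \<Rightarrow> 'b) \<Rightarrow> bool" where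
  "additive_map U V f \<longleftrightarrow> f \<in> carrier U \<rightarrow> carrier V
     \<and> (\<forall>x\<in>carrier U. \<forall>y\<in>carrier U. f (x \<oplus>\<^bsub>U\<^esub> y) = f x \<oplus>\<^bsub>V\<^esub> f y)"

lemma additive_mapI:
  assumes "\<And>x. x \<in> carrier U \<Longrightarrow> f x \<in> carrier V"
    and "\<And>x y. \<lbrakk>x \<in> carrier U; y \<in> carrier U\<rbrakk> \<Longrightarrow> f (x \<oplus>\<^bsub>U\<^esub> y) = f x \<oplus>\<^bsub>V\<^esub> f y"
  shows "additive_map U V f"
  using assms by (auto simp: additive_map_def)

lemma additive_map_closed:
  "\<lbrakk>additive_map U V f; x \<in> carrier U\<rbrakk> \<Longrightarrow> f x \<in> carrier V"
  by (auto simp: additive_map_def)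

lemma additive_map_add:
  "\<lbrakk>additive_map U V f; x \<in> carrier U; y \<in> carrier U\<rbrakk> \<Longrightarrow> f (x \<oplus>\<^bsub>U\<^esub> y) = f x \<oplus>\<^bsub>V\<^esub> f y"
  by (auto simp: additive_map_def)

lemma additive_map_zero:
  assumes f: "additive_map U V f" and U: "abelian_group U" and V: "abelian_group V"
  shows "f \<zero>\<^bsub>U\<^esub> = \<zero>\<^bsub>V\<^esub>"
proof -
  interpret U: abelian_group U by (rule U)
  interpret V: abelian_group V by (rule V)
  have "f \<zero>\<^bsub>U\<^esub> \<oplus>\<^bsub>V\<^esub> f \<zero>\<^bsub>U\<^esub> = f \<zero>\<^bsub>U\<^esub>"
    using additive_map_add[OF f U.zero_closed U.zero_closed] by simp
  then show ?thesis
    using additive_map_closed[OF f U.zero_closed] by (metis V.add.l_cancel_one)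
qed

lemma additive_map_finsum:
  assumes f: "additive_map U V f" and U: "abelian_group U" and V: "abelian_group V"
    and "finite I" and "\<And>i. i \<in> I \<Longrightarrow> g i \<in> carrier U"
  shows "f (\<Oplus>\<^bsub>U\<^esub>i\<in>I. g i) = (\<Oplus>\<^bsub>V\<^esub>i\<in>I. f (g i))"
  using \<open>finite I\<close> assms(5)
proof (induction I)
  interpret U: abelian_group U by (rule U)
  interpret V: abelian_group V by (rule V)
  case empty
  then show ?case by (simp add: additive_map_zero[OF f U V])
next
  interpret U: abelian_group U by (rule U)
  interpret V: abelian_group V by (rule V)
  case (insert i I)
  then have "g \<in> I \<rightarrow> carrier U" "(\<lambda>i. f (g i)) \<in> I \<rightarrow> carrier V" "f (g i) \<in> carrier V"
    using additive_map_closed[OF f] by auto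
  with insert show ?case
    by (simp add: additive_map_add[OF f])
qed

lemma additive_map_comp:
  "\<lbrakk>additive_map U V f; additive_map V Z g\<rbrakk> \<Longrightarrow> additive_map U Z (\<lambda>x. g (f x))"
  by (auto simp: additive_map_def Pi_iff)

lemma additive_map_sum:
  assumes V: "abelian_group V" and U: "abelian_group U" and "finite I"
    and "\<And>i. i \<in> I \<Longrightarrow> additive_map U V (f i)"
  shows "additive_map U V (\<lambda>x. \<Oplus>\<^bsub>V\<^esub>i\<in>I. f i x)"
proof -
  interpret V: abelian_group V by (rule V)
  interpret U: abelian_group U by (rule U)
  have c: "f i x \<in> carrier V" if "i \<in> I" "x \<in> carrier U" for i x
    using assms(4) that by (blast intro: additive_map_closed)
  show ?thesis
  proof (rule additive_mapI)
    show "(\<Oplus>\<^bsub>V\<^esub>i\<in>I. f i x) \<in> carrier V" if "x \<in> carrier U" for x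
      using that c by (intro V.finsum_closed) auto
  next
    fix x y assume xy: "x \<in> carrier U" "y \<in> carrier U"
    have "(\<Oplus>\<^bsub>V\<^esub>i\<in>I. f i (x \<oplus>\<^bsub>U\<^esub> y)) = (\<Oplus>\<^bsub>V\<^esub>i\<in>I. f i x \<oplus>\<^bsub>V\<^esub> f i y)"
      using xy assms(4) c by (intro V.finsum_cong') (auto simp: additive_map_add)
    also have "\<dots> = (\<Oplus>\<^bsub>V\<^esub>i\<in>I. f i x) \<oplus>\<^bsub>V\<^esub> (\<Oplus>\<^bsub>V\<^esub>i\<in>I. f i y)"
      using xy c by (intro V.finsum_addf) auto
    finally show "(\<Oplus>\<^bsub>V\<^esub>i\<in>I. f i (x \<oplus>\<^bsub>U\<^esub> y))
      = (\<Oplus>\<^bsub>V\<^esub>i\<in>I. f i x) \<oplus>\<^bsub>V\<^esub> (\<Oplus>\<^bsub>V\<^esub>i\<in>I. f i y)" .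
  qed
qed

lemma finsum_swap:
  assumes V: "abelian_group V" and "finite I" and "finite J"
    and "\<And>i j. \<lbrakk>i \<in> I; j \<in> J\<rbrakk> \<Longrightarrow> g i j \<in> carrier V"
  shows "(\<Oplus>\<^bsub>V\<^esub>i\<in>I. \<Oplus>\<^bsub>V\<^esub>j\<in>J. g i j) = (\<Oplus>\<^bsub>V\<^esub>j\<in>J. \<Oplus>\<^bsub>V\<^esub>i\<in>I. g i j)"
  using \<open>finite I\<close> assms(4)
proof (induction I)
  interpret V: abelian_group V by (rule V)
  case empty
  then show ?case by simp
next
  interpret V: abelian_group V by (rule V)
  case (insert i I)
  then have c: "(\<lambda>i. \<Oplus>\<^bsub>V\<^esub>j\<in>J. g i j) \<in> I \<rightarrow> carrier V" "(\<Oplus>\<^bsub>V\<^esub>j\<in>J. g i j) \<in> carrier V"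
    by (auto intro!: V.finsum_closed)
  have "(\<Oplus>\<^bsub>V\<^esub>j\<in>J. \<Oplus>\<^bsub>V\<^esub>i\<in>insert i I. g i j) = (\<Oplus>\<^bsub>V\<^esub>j\<in>J. g i j \<oplus>\<^bsub>V\<^esub> (\<Oplus>\<^bsub>V\<^esub>i\<in>I. g i j))"
    using insert by (intro V.finsum_cong') (auto intro!: V.finsum_closed V.finsum_insert)
  also have "\<dots> = (\<Oplus>\<^bsub>V\<^esub>j\<in>J. g i j) \<oplus>\<^bsub>V\<^esub> (\<Oplus>\<^bsub>V\<^esub>j\<in>J. \<Oplus>\<^bsub>V\<^esub>i\<in>I. g i j)"
    using insert by (intro V.finsum_addf) (auto intro!: V.finsum_closed)
  finally show ?case
    using insert c by simp
qed

lemma finsum_eqI: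
  assumes "abelian_group V" "\<And>i. i \<in> I \<Longrightarrow> f i = g i" "\<And>i. i \<in> I \<Longrightarrow> g i \<in> carrier V"
  shows "(\<Oplus>\<^bsub>V\<^esub>i\<in>I. f i) = (\<Oplus>\<^bsub>V\<^esub>i\<in>I. g i)"
proof -
  interpret V: abelian_group V by (rule assms(1))
  show ?thesis using assms(2,3) by (intro V.finsum_cong') simp_all
qed

lemma abelian_group_cong:
  assumes U: "abelian_group U"
    and "carrier V = carrier U" "ring.add V = ring.add U" "\<zero>\<^bsub>V\<^esub> = \<zero>\<^bsub>U\<^esub>"
  shows "abelian_group V"
  using abelian_groupE[OF U] assms(2-) by (intro abelian_groupI) auto


section \<open>The universal property of the tensor product\<close>

definition balanced_map ::
  "'s set \<Rightarrow> ('m, 's, 'x) rmod_scheme \<Rightarrow> ('n, 'r, 's, 'y) bimod_scheme \<Rightarrow> ('p, 'z) ring_scheme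
    \<Rightarrow> ('m \<Rightarrow> 'n \<Rightarrow> 'p) \<Rightarrow> bool" where
  "balanced_map S M N P \<beta> \<longleftrightarrow> (\<forall>n\<in>carrier N. additive_map M P (\<lambda>m. \<beta> m n))
     \<and> (\<forall>m\<in>carrier M. additive_map N P (\<beta> m))
     \<and> (\<forall>m\<in>carrier M. \<forall>n\<in>carrier N. \<forall>s\<in>S. \<beta> (m \<triangleleft>\<^bsub>M\<^esub> s) n = \<beta> m (s \<triangleright>\<^bsub>N\<^esub> n))"

lemma balanced_mapI:
  assumes "\<And>m n. \<lbrakk>m \<in> carrier M; n \<in> carrier N\<rbrakk> \<Longrightarrow> \<beta> m n \<in> carrier P"
    and "\<And>m m' n. \<lbrakk>m \<in> carrier M; m' \<in> carrier M; n \<in> carrier N\<rbrakk>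
      \<Longrightarrow> \<beta> (m \<oplus>\<^bsub>M\<^esub> m') n = \<beta> m n \<oplus>\<^bsub>P\<^esub> \<beta> m' n"
    and "\<And>m n n'. \<lbrakk>m \<in> carrier M; n \<in> carrier N; n' \<in> carrier N\<rbrakk>
      \<Longrightarrow> \<beta> m (n \<oplus>\<^bsub>N\<^esub> n') = \<beta> m n \<oplus>\<^bsub>P\<^esub> \<beta> m n'"
    and "\<And>m n s. \<lbrakk>m \<in> carrier M; n \<in> carrier N; s \<in> S\<rbrakk> \<Longrightarrow> \<beta> (m \<triangleleft>\<^bsub>M\<^esub> s) n = \<beta> m (s \<triangleright>\<^bsub>N\<^esub> n)"
  shows "balanced_map S M N P \<beta>"
  using assms by (auto simp: balanced_map_def additive_map_def)

lemma carrier_tensor_ab: "carrier (tensor_ab S M N) = carrier (tensor_group S M N)"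
  and add_tensor_ab: "ring.add (tensor_ab S M N) = monoid.mult (tensor_group S M N)"
  and zero_tensor_ab: "\<zero>\<^bsub>tensor_ab S M N\<^esub> = \<one>\<^bsub>tensor_group S M N\<^esub>"
  by (simp_all add: tensor_ab_def)

lemma tensor_simps [simp]:
  "carrier (tensor S M N) = carrier (tensor_ab S M N)"
  "ring.add (tensor S M N) = ring.add (tensor_ab S M N)"
  "\<zero>\<^bsub>tensor S M N\<^esub> = \<zero>\<^bsub>tensor_ab S M N\<^esub>"
  by (simp_all add: tensor_def ring.defs rmod.defs)

lemma bitensor_simps [simp]:
  "carrier (bitensor S M N) = carrier (tensor_ab S M N)"
  "ring.add (bitensor S M N) = ring.add (tensor_ab S M N)"
  "\<zero>\<^bsub>bitensor S M N\<^esub> = \<zero>\<^bsub>tensor_ab S M N\<^esub>"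
  "rsmult (bitensor S M N) = rsmult (tensor S M N)"
  by (simp_all add: bitensor_def tensor_def ring.defs rmod.defs bimod.defs)

text \<open>The closure conditions place the defining relations of the tensor product in the free abelian
  group on \<open>carrier M \<times> carrier N\<close>. The scalars form a bare set, which will be the nonunital
  \<open>T\<^sup>\<dagger>\<close> as well as the carrier of \<open>A\<close>.\<close>

locale tensor_pair = M: abelian_group M + N: abelian_group N
  for S :: "'s set" and M :: "('m, 's, 'x) rmod_scheme" and N :: "('n, 'r, 's, 'y) bimod_scheme" +
  assumes right_scalar_closed: "\<lbrakk>m \<in> carrier M; s \<in> S\<rbrakk> \<Longrightarrow> m \<triangleleft>\<^bsub>M\<^esub> s \<in> carrier M"
    and left_scalar_closed: "\<lbrakk>s \<in> S; n \<in> carrier N\<rbrakk> \<Longrightarrow> s \<triangleright>\<^bsub>N\<^esub> n \<in> carrier N"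
begin

abbreviation "F \<equiv> free_Abelian_group (carrier M \<times> carrier N)"

interpretation F: comm_group F by (rule abelian_free_Abelian_group)

lemma tensor_relations_subset: "tensor_relations S M N \<subseteq> carrier F"
proof -
  have k: "frag_of (m, n) \<in> carrier F" if "m \<in> carrier M" "n \<in> carrier N" for m n
    using that by simp
  have d: "x - y \<in> carrier F" if "x \<in> carrier F" "y \<in> carrier F" for x y
    using F.m_closed[OF that(1) F.inv_closed[OF that(2)]] that by simp
  show ?thesis
    unfolding tensor_relations_def
    by (intro Un_least subsetI; elim CollectE exE conjE; simp only:)
       (intro d k; simp add: right_scalar_closed left_scalar_closed)+
qed

lemma tensor_null_subgroup: "subgroup (tensor_null S M N) F"
  unfolding tensor_null_def by (rule F.generate_is_subgroup[OF tensor_relations_subset])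

interpretation nul: normal "tensor_null S M N" F
  by (rule F.normal_iff_subgroup[THEN iffD2, OF tensor_null_subgroup])

lemma tensor_ab_abelian_group: "abelian_group (tensor_ab S M N)"
proof -
  have "comm_group (tensor_group S M N)"
    unfolding tensor_group_def by (rule F.abelian_FactGroup[OF tensor_null_subgroup])
  from comm_groupE[OF this] show ?thesis
    by (intro abelian_groupI) (auto simp: carrier_tensor_ab add_tensor_ab zero_tensor_ab)
qed

lemma tensor_abelian_group: "abelian_group (tensor S M N)"
  by (rule abelian_group_cong[OF tensor_ab_abelian_group]) simp_all

abbreviation "coset x \<equiv> tensor_null S M N #>\<^bsub>F\<^esub> x"

lemma coset_closed: "x \<in> carrier F \<Longrightarrow> coset x \<in> carrier (tensor_ab S M N)"
  by (auto simp: carrier_tensor_ab tensor_group_def carrier_FactGroup)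

lemma coset_add:
  assumes "x \<in> carrier F" "y \<in> carrier F"
  shows "coset (x + y) = coset x \<oplus>\<^bsub>tensor_ab S M N\<^esub> coset y"
  using nul.rcos_sum[OF assms] by (simp add: add_tensor_ab tensor_group_def)

lemma coset_eqI:
  assumes "x \<in> carrier F" "y \<in> carrier F" "x - y \<in> tensor_null S M N"
  shows "coset x = coset y"
proof -
  have "x - y + y \<in> coset y"
    using assms(3) by (auto simp: r_coset_def intro!: bexI[of _ "x - y"])
  then have "x \<in> coset y" by simp
  then show ?thesis
    using F.repr_independence[OF _ assms(2) tensor_null_subgroup] by simp
qed

lemma coset_relation: "r \<in> tensor_relations S M N \<Longrightarrow> r \<in> tensor_null S M N"
  unfolding tensor_null_def by (rule generate.incl)

lemma tens_closed:
  "\<lbrakk>m \<in> carrier M; n \<in> carrier N\<rbrakk> \<Longrightarrow> tens S M N m n \<in> carrier (tensor_ab S M N)"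
  unfolding tens_def by (rule coset_closed) simp

lemma tens_add_left:
  assumes "m \<in> carrier M" "m' \<in> carrier M" "n \<in> carrier N"
  shows "tens S M N (m \<oplus>\<^bsub>M\<^esub> m') n = tens S M N m n \<oplus>\<^bsub>tensor_ab S M N\<^esub> tens S M N m' n"
proof -
  have c: "frag_of (m, n) \<in> carrier F" "frag_of (m', n) \<in> carrier F" "frag_of (m \<oplus>\<^bsub>M\<^esub> m', n) \<in> carrier F"
    using assms by simp_all
  have "frag_of (m \<oplus>\<^bsub>M\<^esub> m', n) - (frag_of (m, n) + frag_of (m', n)) \<in> tensor_relations S M N"
    unfolding tensor_relations_def diff_diff_eq[symmetric] using assms by blast
  from coset_eqI[OF c(3) _ coset_relation[OF this]] F.m_closed[OF c(1,2)] coset_add[OF c(1,2)]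
  show ?thesis by (simp add: tens_def)
qed

lemma tens_add_right:
  assumes "m \<in> carrier M" "n \<in> carrier N" "n' \<in> carrier N"
  shows "tens S M N m (n \<oplus>\<^bsub>N\<^esub> n') = tens S M N m n \<oplus>\<^bsub>tensor_ab S M N\<^esub> tens S M N m n'"
proof -
  have c: "frag_of (m, n) \<in> carrier F" "frag_of (m, n') \<in> carrier F" "frag_of (m, n \<oplus>\<^bsub>N\<^esub> n') \<in> carrier F"
    using assms by simp_all
  have "frag_of (m, n \<oplus>\<^bsub>N\<^esub> n') - (frag_of (m, n) + frag_of (m, n')) \<in> tensor_relations S M N"
    unfolding tensor_relations_def diff_diff_eq[symmetric] using assms by blast
  from coset_eqI[OF c(3) _ coset_relation[OF this]] F.m_closed[OF c(1,2)] coset_add[OF c(1,2)]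
  show ?thesis by (simp add: tens_def)
qed

lemma tens_balanced:
  assumes "m \<in> carrier M" "s \<in> S" "n \<in> carrier N"
  shows "tens S M N (m \<triangleleft>\<^bsub>M\<^esub> s) n = tens S M N m (s \<triangleright>\<^bsub>N\<^esub> n)"
proof -
  have "frag_of (m \<triangleleft>\<^bsub>M\<^esub> s, n) - frag_of (m, s \<triangleright>\<^bsub>N\<^esub> n) \<in> tensor_relations S M N"
    unfolding tensor_relations_def using assms by blast
  from coset_eqI[OF _ _ coset_relation[OF this]] assms show ?thesis
    by (simp add: tens_def right_scalar_closed left_scalar_closed)
qed

lemma tens_balanced_map: "balanced_map S M N (tensor_ab S M N) (tens S M N)"
  by (intro balanced_mapI tens_closed tens_add_left tens_add_right tens_balanced)

lemma additive_tens_left: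
  "n \<in> carrier N \<Longrightarrow> additive_map M (tensor_ab S M N) (\<lambda>m. tens S M N m n)"
  and additive_tens_right:
  "m \<in> carrier M \<Longrightarrow> additive_map N (tensor_ab S M N) (tens S M N m)"
  using tens_balanced_map by (auto simp: balanced_map_def)

lemma coset_zero: "coset 0 = tens S M N \<zero>\<^bsub>M\<^esub> \<zero>\<^bsub>N\<^esub>"
proof -
  interpret T: abelian_group "tensor_ab S M N" by (rule tensor_ab_abelian_group)
  have "coset 0 = \<zero>\<^bsub>tensor_ab S M N\<^esub>"
    using coset_add[of 0 0] coset_closed[of 0] by (metis T.add.l_cancel_one F.one_closed
        one_free_Abelian_group add.right_neutral)
  then show ?thesis
    using additive_map_zero[OF additive_tens_left M.abelian_group_axioms T.abelian_group_axioms]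
    by simp
qed

lemma coset_uminus_frag_of:
  assumes m: "m \<in> carrier M" and n: "n \<in> carrier N"
  shows "coset (- frag_of (m, n)) = tens S M N (\<ominus>\<^bsub>M\<^esub> m) n"
proof -
  interpret T: abelian_group "tensor_ab S M N" by (rule tensor_ab_abelian_group)
  have c: "frag_of (m, n) \<in> carrier F" "- frag_of (m, n) \<in> carrier F"
    using m n by simp_all
  have z: "tens S M N \<zero>\<^bsub>M\<^esub> n = coset 0"
    using additive_map_zero[OF additive_tens_left M.abelian_group_axioms T.abelian_group_axioms] n
    by (simp add: coset_zero)
  have "coset (frag_of (m, n)) \<oplus>\<^bsub>tensor_ab S M N\<^esub> coset (- frag_of (m, n)) = coset 0"
    using coset_add[OF c] by simp
  also have "\<dots> = tens S M N m n \<oplus>\<^bsub>tensor_ab S M N\<^esub> tens S M N (\<ominus>\<^bsub>M\<^esub> m) n"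
    using tens_add_left[of m "\<ominus>\<^bsub>M\<^esub> m" n] m n z by (simp add: M.r_neg)
  finally have "tens S M N m n \<oplus>\<^bsub>tensor_ab S M N\<^esub> coset (- frag_of (m, n))
      = tens S M N m n \<oplus>\<^bsub>tensor_ab S M N\<^esub> tens S M N (\<ominus>\<^bsub>M\<^esub> m) n"
    by (simp add: tens_def)
  then show ?thesis
    using T.add.l_cancel tens_closed[OF m n] coset_closed[OF c(2)]
      tens_closed[OF M.a_inv_closed[OF m] n] by blast
qed

text \<open>Every tensor is a sum of pure tensors: the negative of a pure tensor is again pure, so closure
  under addition suffices. This is the main tool for checking identities between additive maps.\<close>

lemma tensor_induct [consumes 1, case_names tens add]:
  assumes t: "t \<in> carrier (tensor_ab S M N)"
    and tens: "\<And>m n. \<lbrakk>m \<in> carrier M; n \<in> carrier N\<rbrakk> \<Longrightarrow> P (tens S M N m n)"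
    and add: "\<And>x y. \<lbrakk>x \<in> carrier (tensor_ab S M N); y \<in> carrier (tensor_ab S M N); P x; P y\<rbrakk>
      \<Longrightarrow> P (x \<oplus>\<^bsub>tensor_ab S M N\<^esub> y)"
  shows "P t"
proof -
  from t obtain x where x: "x \<in> carrier F" "t = coset x"
    by (auto simp: carrier_tensor_ab tensor_group_def carrier_FactGroup)
  have "x \<in> carrier F \<and> - x \<in> carrier F \<and> P (coset x) \<and> P (coset (- x))"
    using x(1)[unfolded carrier_free_Abelian_group_iff]
  proof (induction x rule: frag_induction)
    case zero
    then show ?case
      using tens[of "\<zero>\<^bsub>M\<^esub>" "\<zero>\<^bsub>N\<^esub>"] by (simp add: coset_zero)
  next
    case (one p)
    then obtain m n where "p = (m, n)" "m \<in> carrier M" "n \<in> carrier N"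
      by blast
    then show ?case
      using tens[of m n] tens[of "\<ominus>\<^bsub>M\<^esub> m" n] by (simp add: coset_uminus_frag_of) (simp add: tens_def)
  next
    case (diff a b)
    then have c: "a \<in> carrier F" "- a \<in> carrier F" "b \<in> carrier F" "- b \<in> carrier F" by auto
    note coset_add[OF c(1,4)] coset_add[OF c(2,3)]
    moreover have "P (coset a \<oplus>\<^bsub>tensor_ab S M N\<^esub> coset (- b))"
      "P (coset (- a) \<oplus>\<^bsub>tensor_ab S M N\<^esub> coset b)"
      using diff c by (blast intro: add coset_closed)+
    ultimately show ?case
      using F.m_closed[OF c(1,4)] F.m_closed[OF c(2,3)] by simp
  qed
  then show ?thesis using x(2) by simp
qed

lemma additive_maps_eqI:
  assumes f: "additive_map (tensor_ab S M N) P f" and g: "additive_map (tensor_ab S M N) P g"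
    and "\<And>m n. \<lbrakk>m \<in> carrier M; n \<in> carrier N\<rbrakk> \<Longrightarrow> f (tens S M N m n) = g (tens S M N m n)"
    and t: "t \<in> carrier (tensor_ab S M N)"
  shows "f t = g t"
  using t
proof (induction t rule: tensor_induct)
  case (add x y)
  then show ?case by (simp add: additive_map_add[OF f] additive_map_add[OF g])
qed (rule assms(3))

context
  fixes P :: "('p, 'z) ring_scheme" and \<beta> :: "'m \<Rightarrow> 'n \<Rightarrow> 'p"
  assumes P: "abelian_group P" and \<beta>: "balanced_map S M N P \<beta>"
begin

interpretation P: abelian_group P by (rule P)

text \<open>The formula in \<^const>\<open>tlift\<close> as a homomorphism on the free abelian group. It remains to see that it
  is constant on the cosets of \<^const>\<open>tensor_null\<close>.\<close>

definition free_lift :: "('m \<times> 'n \<Rightarrow>\<^sub>0 int) \<Rightarrow> 'p" where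
  "free_lift x = (\<Oplus>\<^bsub>P\<^esub>p\<in>Poly_Mapping.keys x. [Poly_Mapping.lookup x p] \<cdot>\<^bsub>P\<^esub> \<beta> (fst p) (snd p))"

lemma \<beta>_closed: "p \<in> carrier M \<times> carrier N \<Longrightarrow> \<beta> (fst p) (snd p) \<in> carrier P"
  using \<beta> by (auto simp: balanced_map_def additive_map_def Pi_iff)

text \<open>The supports of \<open>x\<close>, \<open>y\<close> and \<open>x + y\<close> differ; over a common finite superset the sums can be compared
  term by term.\<close>

lemma free_lift_superset:
  assumes "finite U" "Poly_Mapping.keys x \<subseteq> U" "U \<subseteq> carrier M \<times> carrier N"
  shows "free_lift x = (\<Oplus>\<^bsub>P\<^esub>p\<in>U. [Poly_Mapping.lookup x p] \<cdot>\<^bsub>P\<^esub> \<beta> (fst p) (snd p))"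
  unfolding free_lift_def
proof (rule P.add.finprod_mono_neutral_cong_left)
  show "[poly_mapping.lookup x i] \<cdot>\<^bsub>P\<^esub> \<beta> (fst i) (snd i) = \<zero>\<^bsub>P\<^esub>" if "i \<in> U - Poly_Mapping.keys x" for i
    using that by (simp add: in_keys_iff add_pow_def)
qed (use assms \<beta>_closed in \<open>auto intro!: P.add.int_pow_closed\<close>)

lemma free_lift_hom: "free_lift \<in> hom F (add_monoid P)"
proof (rule homI)
  fix x y assume "x \<in> carrier F" "y \<in> carrier F"
  then have k: "Poly_Mapping.keys x \<subseteq> carrier M \<times> carrier N" "Poly_Mapping.keys y \<subseteq> carrier M \<times> carrier N"
    by simp_all
  let ?U = "Poly_Mapping.keys x \<union> Poly_Mapping.keys y"
  have U: "finite ?U" "?U \<subseteq> carrier M \<times> carrier N" "Poly_Mapping.keys (x + y) \<subseteq> ?U"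
    using k keys_add[of x y] by auto
  have "free_lift (x + y) = (\<Oplus>\<^bsub>P\<^esub>p\<in>?U. [Poly_Mapping.lookup (x + y) p] \<cdot>\<^bsub>P\<^esub> \<beta> (fst p) (snd p))"
    using U by (intro free_lift_superset)
  also have "\<dots> = (\<Oplus>\<^bsub>P\<^esub>p\<in>?U. [Poly_Mapping.lookup x p] \<cdot>\<^bsub>P\<^esub> \<beta> (fst p) (snd p)
      \<oplus>\<^bsub>P\<^esub> [Poly_Mapping.lookup y p] \<cdot>\<^bsub>P\<^esub> \<beta> (fst p) (snd p))"
  proof (rule P.finsum_cong'[OF refl])
    fix p assume "p \<in> ?U"
    with U(2) have "\<beta> (fst p) (snd p) \<in> carrier P" using \<beta>_closed by auto
    then show "[Poly_Mapping.lookup (x + y) p] \<cdot>\<^bsub>P\<^esub> \<beta> (fst p) (snd p)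
      = [Poly_Mapping.lookup x p] \<cdot>\<^bsub>P\<^esub> \<beta> (fst p) (snd p)
        \<oplus>\<^bsub>P\<^esub> [Poly_Mapping.lookup y p] \<cdot>\<^bsub>P\<^esub> \<beta> (fst p) (snd p)"
      by (simp add: lookup_add P.add.int_pow_mult)
  qed (use U(2) \<beta>_closed in \<open>auto intro!: P.add.int_pow_closed\<close>)
  also have "\<dots> = (\<Oplus>\<^bsub>P\<^esub>p\<in>?U. [Poly_Mapping.lookup x p] \<cdot>\<^bsub>P\<^esub> \<beta> (fst p) (snd p))
      \<oplus>\<^bsub>P\<^esub> (\<Oplus>\<^bsub>P\<^esub>p\<in>?U. [Poly_Mapping.lookup y p] \<cdot>\<^bsub>P\<^esub> \<beta> (fst p) (snd p))"
    using U(2) \<beta>_closed by (intro P.finsum_addf) (auto intro!: P.add.int_pow_closed)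
  also have "\<dots> = free_lift x \<oplus>\<^bsub>P\<^esub> free_lift y"
    using U free_lift_superset[of ?U x] free_lift_superset[of ?U y] by simp
  finally show "free_lift (x \<otimes>\<^bsub>F\<^esub> y) = free_lift x \<otimes>\<^bsub>add_monoid P\<^esub> free_lift y" by simp
next
  fix x assume "x \<in> carrier F"
  then show "free_lift x \<in> carrier (add_monoid P)"
    unfolding free_lift_def using \<beta>_closed by (auto intro!: P.finsum_closed P.add.int_pow_closed)
qed

lemma free_lift_frag_of: "\<lbrakk>m \<in> carrier M; n \<in> carrier N\<rbrakk> \<Longrightarrow> free_lift (frag_of (m, n)) = \<beta> m n"
  unfolding free_lift_def using \<beta>_closed[of "(m, n)"] by (simp add: P.finsum_insert[of "{}"])

interpretation h: group_hom F "add_monoid P" free_lift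
  using free_lift_hom F.group_axioms P.a_group by (simp add: group_hom_def group_hom_axioms_def)

lemma free_lift_add: "\<lbrakk>x \<in> carrier F; y \<in> carrier F\<rbrakk> \<Longrightarrow> free_lift (x + y) = free_lift x \<oplus>\<^bsub>P\<^esub> free_lift y"
  using h.hom_mult[of x y] by simp

lemma free_lift_closed: "x \<in> carrier F \<Longrightarrow> free_lift x \<in> carrier P"
  using h.hom_closed[of x] by simp

lemma free_lift_eq_iff:
  assumes "x \<in> carrier F" "y \<in> carrier F" 
  shows "free_lift (x - y) = \<zero>\<^bsub>P\<^esub> \<longleftrightarrow> free_lift x = free_lift y"
proof -
  have xy: "x - y \<in> carrier F"
    using F.m_closed[OF assms(1) F.inv_closed[OF assms(2)]] assms by simp
  have "free_lift x = free_lift (x - y) \<oplus>\<^bsub>P\<^esub> free_lift y"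
    using free_lift_add[OF xy assms(2)] by simp
  then show ?thesis
    using free_lift_closed xy assms by (metis P.add.l_cancel_one P.add.r_cancel_one P.l_zero)
qed

text \<open>Being balanced and biadditive means that the defining relations lie in the kernel, and the kernel
  is a subgroup.\<close>

lemma free_lift_null: "x \<in> tensor_null S M N \<Longrightarrow> free_lift x = \<zero>\<^bsub>P\<^esub>"
proof -
  assume x: "x \<in> tensor_null S M N"
  have add: "frag_of p + frag_of q \<in> carrier F"
    if "p \<in> carrier M \<times> carrier N" "q \<in> carrier M \<times> carrier N" for p q
    using F.m_closed[of "frag_of p" "frag_of q"] that by simp
  have "tensor_relations S M N \<subseteq> kernel F (add_monoid P) free_lift"
  proof
    fix r assume r: "r \<in> tensor_relations S M N"
    then have "free_lift r = \<zero>\<^bsub>P\<^esub>"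
      unfolding tensor_relations_def
    proof (elim UnE CollectE exE conjE)
      fix m m' n
      assume "r = frag_of (m \<oplus>\<^bsub>M\<^esub> m', n) - frag_of (m, n) - frag_of (m', n)"
        and c: "m \<in> carrier M" "m' \<in> carrier M" "n \<in> carrier N"
      then have "r = frag_of (m \<oplus>\<^bsub>M\<^esub> m', n) - (frag_of (m, n) + frag_of (m', n))" by simp
      then show ?thesis
        using \<beta> c add by (simp add: free_lift_eq_iff free_lift_add free_lift_frag_of balanced_map_def additive_map_def)
    next
      fix m n n'
      assume "r = frag_of (m, n \<oplus>\<^bsub>N\<^esub> n') - frag_of (m, n) - frag_of (m, n')"
        and c: "m \<in> carrier M" "n \<in> carrier N" "n' \<in> carrier N"
      then have "r = frag_of (m, n \<oplus>\<^bsub>N\<^esub> n') - (frag_of (m, n) + frag_of (m, n'))" by simp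
      then show ?thesis
        using \<beta> c add by (simp add: free_lift_eq_iff free_lift_add free_lift_frag_of balanced_map_def additive_map_def)
    next
      fix m s n
      assume "r = frag_of (m \<triangleleft>\<^bsub>M\<^esub> s, n) - frag_of (m, s \<triangleright>\<^bsub>N\<^esub> n)"
        and c: "m \<in> carrier M" "s \<in> S" "n \<in> carrier N"
      then show ?thesis
        using \<beta> by (simp add: free_lift_eq_iff free_lift_frag_of balanced_map_def
            right_scalar_closed left_scalar_closed)
    qed
    with r tensor_relations_subset show "r \<in> kernel F (add_monoid P) free_lift"
      by (auto simp: kernel_def simp del: carrier_free_Abelian_group_iff)
  qed
  then have "tensor_null S M N \<subseteq> kernel F (add_monoid P) free_lift"
    unfolding tensor_null_def by (rule F.generate_subgroup_incl[OF _ h.subgroup_kernel])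
  with x show ?thesis by (auto simp: kernel_def)
qed

lemma tlift_coset:
  assumes x: "x \<in> carrier F"
  shows "tlift P \<beta> (coset x) = free_lift x"
proof -
  have "free_lift y = free_lift x" if y: "y \<in> coset x" for y
  proof -
    from y obtain z where z: "z \<in> tensor_null S M N" "y = z + x"
      by (auto simp: r_coset_def)
    then have "free_lift y = free_lift z \<oplus>\<^bsub>P\<^esub> free_lift x"
      using free_lift_add subgroup.mem_carrier[OF tensor_null_subgroup] x by blast
    then show ?thesis
      using free_lift_null[OF z(1)] free_lift_closed[OF x] by simp
  qed
  moreover have "x \<in> coset x"
    using F.rcos_self[OF x tensor_null_subgroup] .
  ultimately have "free_lift ` coset x = {free_lift x}" by blast
  then show ?thesis
    unfolding tlift_def free_lift_def[symmetric] by simp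
qed

lemma tlift_tens: "\<lbrakk>m \<in> carrier M; n \<in> carrier N\<rbrakk> \<Longrightarrow> tlift P \<beta> (tens S M N m n) = \<beta> m n"
  unfolding tens_def by (subst tlift_coset) (simp_all add: free_lift_frag_of)

lemma tlift_additive: "additive_map (tensor_ab S M N) P (tlift P \<beta>)"
proof (rule additive_mapI)
  fix t assume "t \<in> carrier (tensor_ab S M N)"
  then obtain x where "x \<in> carrier F" "t = coset x"
    by (auto simp: carrier_tensor_ab tensor_group_def carrier_FactGroup)
  then show "tlift P \<beta> t \<in> carrier P"
    by (simp only: tlift_coset free_lift_closed)
next
  fix t u assume "t \<in> carrier (tensor_ab S M N)" "u \<in> carrier (tensor_ab S M N)"
  then obtain x y where x: "x \<in> carrier F" "t = coset x" and y: "y \<in> carrier F" "u = coset y"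
    by (auto simp: carrier_tensor_ab tensor_group_def carrier_FactGroup)
  then have "x + y \<in> carrier F" using F.m_closed[OF x(1) y(1)] by simp
  then show "tlift P \<beta> (t \<oplus>\<^bsub>tensor_ab S M N\<^esub> u) = tlift P \<beta> t \<oplus>\<^bsub>P\<^esub> tlift P \<beta> u"
    using x y coset_add[OF x(1) y(1)] by (metis tlift_coset free_lift_add)
qed

end

end

lemma bitensor_abelian_group:
  assumes "tensor_pair S M N"
  shows "abelian_group (bitensor S M N)"
  by (rule abelian_group_cong[OF tensor_pair.tensor_ab_abelian_group[OF assms]]) simp_all


section \<open>Linear maps and module structures on tensor products\<close>

definition right_linear ::
  "'s set \<Rightarrow> ('m, 's, 'x) rmod_scheme \<Rightarrow> ('n, 's, 'y) rmod_scheme \<Rightarrow> ('m \<Rightarrow> 'n) \<Rightarrow> bool" where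
  "right_linear S M N f \<longleftrightarrow> additive_map M N f
     \<and> (\<forall>x\<in>carrier M. \<forall>s\<in>S. f (x \<triangleleft>\<^bsub>M\<^esub> s) = f x \<triangleleft>\<^bsub>N\<^esub> s)"

definition left_linear ::
  "'s set \<Rightarrow> ('m, 'p, 's, 'x) bimod_scheme \<Rightarrow> ('n, 'q, 's, 'y) bimod_scheme \<Rightarrow> ('m \<Rightarrow> 'n) \<Rightarrow> bool" where
  "left_linear S M N f \<longleftrightarrow> additive_map M N f
     \<and> (\<forall>s\<in>S. \<forall>x\<in>carrier M. f (s \<triangleright>\<^bsub>M\<^esub> x) = s \<triangleright>\<^bsub>N\<^esub> f x)"

lemma is_rmod_hom_iff: "is_rmod_hom A M N f \<longleftrightarrow> right_linear (carrier A) M N f"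
  by (auto simp: is_rmod_hom_def right_linear_def additive_map_def)

lemma is_bimod_hom_iff:
  "is_bimod_hom A M N f \<longleftrightarrow> right_linear (carrier A) M N f \<and> left_linear (carrier A) M N f"
  by (auto simp: is_bimod_hom_def is_rmod_hom_iff right_linear_def left_linear_def)

lemma right_linear_id: "right_linear S M M id"
  and left_linear_id: "left_linear S N N id"
  by (simp_all add: right_linear_def left_linear_def additive_map_def)

text \<open>Unlike the bimodules over a \<open>K\<close>-algebra, the modules below are not tied to a ground ring, which keeps
  the commutation with scalars from \<open>K\<close> out of the constructions.\<close>

locale left_module = scal: ring A + ab: abelian_group M
  for A :: "('a, 'w) ring_scheme" and M :: "('m, 'r, 'a, 'x) bimod_scheme" +
  assumes lact_closed: "\<lbrakk>a \<in> carrier A; m \<in> carrier M\<rbrakk> \<Longrightarrow> a \<triangleright>\<^bsub>M\<^esub> m \<in> carrier M"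
    and lact_add_right: "\<lbrakk>a \<in> carrier A; m \<in> carrier M; n \<in> carrier M\<rbrakk>
      \<Longrightarrow> a \<triangleright>\<^bsub>M\<^esub> (m \<oplus>\<^bsub>M\<^esub> n) = (a \<triangleright>\<^bsub>M\<^esub> m) \<oplus>\<^bsub>M\<^esub> (a \<triangleright>\<^bsub>M\<^esub> n)"
    and lact_add_left: "\<lbrakk>a \<in> carrier A; b \<in> carrier A; m \<in> carrier M\<rbrakk>
      \<Longrightarrow> (a \<oplus>\<^bsub>A\<^esub> b) \<triangleright>\<^bsub>M\<^esub> m = (a \<triangleright>\<^bsub>M\<^esub> m) \<oplus>\<^bsub>M\<^esub> (b \<triangleright>\<^bsub>M\<^esub> m)"
    and lact_mult: "\<lbrakk>a \<in> carrier A; b \<in> carrier A; m \<in> carrier M\<rbrakk>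
      \<Longrightarrow> (a \<otimes>\<^bsub>A\<^esub> b) \<triangleright>\<^bsub>M\<^esub> m = a \<triangleright>\<^bsub>M\<^esub> (b \<triangleright>\<^bsub>M\<^esub> m)"
    and lact_one: "m \<in> carrier M \<Longrightarrow> \<one>\<^bsub>A\<^esub> \<triangleright>\<^bsub>M\<^esub> m = m"

locale bimodule = right_module A M + left_module A M
  for A :: "('a, 'w) ring_scheme" and M :: "('m, 'a, 'a, 'x) bimod_scheme" +
  assumes lact_ract: "\<lbrakk>a \<in> carrier A; m \<in> carrier M; b \<in> carrier A\<rbrakk>
      \<Longrightarrow> (a \<triangleright>\<^bsub>M\<^esub> m) \<triangleleft>\<^bsub>M\<^esub> b = a \<triangleright>\<^bsub>M\<^esub> (m \<triangleleft>\<^bsub>M\<^esub> b)"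

lemma k_bimodule_bimodule:
  assumes "k_bimodule K A M"
  shows "bimodule A M"
proof -
  interpret k_bimodule K A M by (rule assms)
  show ?thesis
    by unfold_locales
      (simp_all add: lact_closed lact_add_right lact_add_left lact_mult lact_one lact_ract)
qed

lemma (in left_module) lact_additive: "a \<in> carrier A \<Longrightarrow> additive_map M M (\<lambda>m. a \<triangleright>\<^bsub>M\<^esub> m)"
  by (intro additive_mapI lact_closed lact_add_right)

lemma (in right_module) ract_additive: "a \<in> carrier A \<Longrightarrow> additive_map M M (\<lambda>m. m \<triangleleft>\<^bsub>M\<^esub> a)"
  by (intro additive_mapI ract_closed ract_add_left)

lemma (in bimodule) lact_right_linear:
  "a \<in> carrier A \<Longrightarrow> right_linear (carrier A) M M (\<lambda>m. a \<triangleright>\<^bsub>M\<^esub> m)"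
  by (simp add: right_linear_def lact_additive lact_ract)

lemma (in bimodule) ract_left_linear:
  "a \<in> carrier A \<Longrightarrow> left_linear (carrier A) M M (\<lambda>m. m \<triangleleft>\<^bsub>M\<^esub> a)"
  by (simp add: left_linear_def ract_additive lact_ract)

lemma bimod_hom_eqI:
  assumes "f \<in> bimod_hom A N P" "g \<in> bimod_hom A N P" "\<And>x. x \<in> carrier N \<Longrightarrow> f x = g x"
  shows "f = g"
  using assms by (auto simp: bimod_hom_def intro: extensionalityI)

lemma bimod_hom_additive: "f \<in> bimod_hom A N P \<Longrightarrow> additive_map N P f"
  by (simp add: bimod_hom_def is_bimod_hom_iff right_linear_def)

lemma (in bimodule) restrict_bimod_hom:
  assumes f: "additive_map M P f"
    and "\<And>x a. \<lbrakk>x \<in> carrier M; a \<in> carrier A\<rbrakk> \<Longrightarrow> f (x \<triangleleft>\<^bsub>M\<^esub> a) = f x \<triangleleft>\<^bsub>P\<^esub> a"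
    and "\<And>x a. \<lbrakk>x \<in> carrier M; a \<in> carrier A\<rbrakk> \<Longrightarrow> f (a \<triangleright>\<^bsub>M\<^esub> x) = a \<triangleright>\<^bsub>P\<^esub> f x"
  shows "restrict f (carrier M) \<in> bimod_hom A M P"
  using assms
  by (simp add: bimod_hom_def is_bimod_hom_iff right_linear_def left_linear_def additive_map_def
      ract_closed lact_closed ab.a_closed Pi_iff)

lemma module_tensor_pair:
  assumes "right_module A M" "left_module A N"
  shows "tensor_pair (carrier A) M N"
proof -
  interpret M: right_module A M by (rule assms(1))
  interpret N: left_module A N by (rule assms(2))
  show ?thesis by unfold_locales (simp_all add: M.ract_closed N.lact_closed)
qed

context
  fixes S :: "'s set" and M :: "('m, 's, 'x) rmod_scheme" and N :: "('n, 'r, 's, 'y) bimod_scheme"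
    and M' :: "('m', 's, 'x') rmod_scheme" and N' :: "('n', 'r', 's, 'y') bimod_scheme"
    and f :: "'m \<Rightarrow> 'm'" and g :: "'n \<Rightarrow> 'n'"
  assumes source: "tensor_pair S M N" and target: "tensor_pair S M' N'"
    and f: "right_linear S M M' f" and g: "left_linear S N N' g"
begin

lemma tensor_map_balanced:
  "balanced_map S M N (tensor_ab S M' N') (\<lambda>m n. tens S M' N' (f m) (g n))"
proof -
  interpret target: tensor_pair S M' N' by (rule target)
  have "f m \<in> carrier M'" if "m \<in> carrier M" for m
    using f that by (auto simp: right_linear_def additive_map_def)
  moreover have "g n \<in> carrier N'" if "n \<in> carrier N" for n
    using g that by (auto simp: left_linear_def additive_map_def)
  ultimately show ?thesis
    using f g by (intro balanced_mapI)
      (simp_all add: target.tens_closed target.tens_add_left target.tens_add_right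
        target.tens_balanced right_linear_def left_linear_def additive_map_def)
qed

lemma tensor_map_additive:
  "additive_map (tensor_ab S M N) (tensor_ab S M' N') (tensor_map S M' N' f g)"
  unfolding tensor_map_def
  by (rule tensor_pair.tlift_additive[OF source tensor_pair.tensor_ab_abelian_group[OF target]
        tensor_map_balanced])

lemma tensor_map_tens:
  "\<lbrakk>m \<in> carrier M; n \<in> carrier N\<rbrakk>
    \<Longrightarrow> tensor_map S M' N' f g (tens S M N m n) = tens S M' N' (f m) (g n)"
  unfolding tensor_map_def
  by (rule tensor_pair.tlift_tens[OF source tensor_pair.tensor_ab_abelian_group[OF target]
        tensor_map_balanced])

end

lemma tensor_map_comp:
  assumes MN: "tensor_pair S M N" and MN': "tensor_pair S M' N'" and MN'': "tensor_pair S M'' N''"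
    and f: "right_linear S M M' f" and g: "left_linear S N N' g"
    and f': "right_linear S M' M'' f'" and g': "left_linear S N' N'' g'"
    and f'': "right_linear S M M'' f''" and g'': "left_linear S N N'' g''"
    and "\<And>m. m \<in> carrier M \<Longrightarrow> f'' m = f' (f m)" and "\<And>n. n \<in> carrier N \<Longrightarrow> g'' n = g' (g n)"
    and t: "t \<in> carrier (tensor_ab S M N)"
  shows "tensor_map S M'' N'' f' g' (tensor_map S M' N' f g t) = tensor_map S M'' N'' f'' g'' t"
proof -
  have "f m \<in> carrier M'" if "m \<in> carrier M" for m
    using f that by (auto simp: right_linear_def additive_map_def)
  moreover have "g n \<in> carrier N'" if "n \<in> carrier N" for n
    using g that by (auto simp: left_linear_def additive_map_def)
  ultimately show ?thesis
    by (intro tensor_pair.additive_maps_eqI[OF MN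
          additive_map_comp[OF tensor_map_additive[OF MN MN' f g] tensor_map_additive[OF MN' MN'' f' g']]
          tensor_map_additive[OF MN MN'' f'' g''] _ t])
      (simp add: tensor_map_tens[OF MN MN' f g] tensor_map_tens[OF MN' MN'' f' g']
        tensor_map_tens[OF MN MN'' f'' g''] assms(10,11))
qed

text \<open>Both actions on a tensor product are instances of \<^const>\<open>tensor_map\<close>, which gives their additivity and
  their values on pure tensors.\<close>

lemma tensor_rsmult: "t \<triangleleft>\<^bsub>tensor S M N\<^esub> r = tensor_map S M N id (\<lambda>n. n \<triangleleft>\<^bsub>N\<^esub> r) t"
  by (simp add: tensor_def ring.defs rmod.defs tensor_map_def)

lemma bitensor_lsmult: "l \<triangleright>\<^bsub>bitensor S M N\<^esub> t = tensor_map S M N (\<lambda>m. l \<triangleright>\<^bsub>M\<^esub> m) id t"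
  by (simp add: bitensor_def rmod.defs bimod.defs tensor_def ring.defs tensor_map_def)

text \<open>Left linearity over \<open>S\<close> of the right multiplications on \<open>N\<close> makes the action well defined. As each
  module axiom is additive in the tensor, it can be read off from pure tensors.\<close>

lemma (in tensor_pair) tensor_right_module:
  assumes N': "right_module R N" and lin: "\<And>r. r \<in> carrier R \<Longrightarrow> left_linear S N N (\<lambda>n. n \<triangleleft>\<^bsub>N\<^esub> r)"
  shows "right_module R (tensor S M N)"
    and "\<And>m n r. \<lbrakk>m \<in> carrier M; n \<in> carrier N; r \<in> carrier R\<rbrakk>
      \<Longrightarrow> tens S M N m n \<triangleleft>\<^bsub>tensor S M N\<^esub> r = tens S M N m (n \<triangleleft>\<^bsub>N\<^esub> r)"
proof -
  interpret N': right_module R N by (rule N')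
  interpret T: abelian_group "tensor_ab S M N" by (rule tensor_ab_abelian_group)
  interpret T': abelian_group "tensor S M N" by (rule tensor_abelian_group)
  show ract_tens: "tens S M N m n \<triangleleft>\<^bsub>tensor S M N\<^esub> r = tens S M N m (n \<triangleleft>\<^bsub>N\<^esub> r)"
    if "m \<in> carrier M" "n \<in> carrier N" "r \<in> carrier R" for m n r
    using tensor_map_tens[OF tensor_pair_axioms tensor_pair_axioms right_linear_id lin] that
    by (simp add: tensor_rsmult)
  have add: "additive_map (tensor_ab S M N) (tensor_ab S M N) (\<lambda>t. t \<triangleleft>\<^bsub>tensor S M N\<^esub> r)"
    if "r \<in> carrier R" for r
    using tensor_map_additive[OF tensor_pair_axioms tensor_pair_axioms right_linear_id lin[OF that]]
    by (simp add: tensor_rsmult)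
  note closed = additive_map_closed[OF add] and distrib = additive_map_add[OF add]
  show "right_module R (tensor S M N)"
  proof (unfold_locales, unfold tensor_simps)
    fix t a b assume t: "t \<in> carrier (tensor_ab S M N)" and ab: "a \<in> carrier R" "b \<in> carrier R"
    show "t \<triangleleft>\<^bsub>tensor S M N\<^esub> (a \<oplus>\<^bsub>R\<^esub> b)
      = t \<triangleleft>\<^bsub>tensor S M N\<^esub> a \<oplus>\<^bsub>tensor_ab S M N\<^esub> t \<triangleleft>\<^bsub>tensor S M N\<^esub> b"
      using t
    proof (induction t rule: tensor_induct)
      case (tens m n)
      with ab show ?case
        by (simp add: ract_tens N'.ract_add_right tens_add_right N'.ract_closed)
    next
      case (add x y)
      with ab show ?case
        by (simp add: distrib closed T.a_ac)
    qed
    show "t \<triangleleft>\<^bsub>tensor S M N\<^esub> (a \<otimes>\<^bsub>R\<^esub> b) = t \<triangleleft>\<^bsub>tensor S M N\<^esub> a \<triangleleft>\<^bsub>tensor S M N\<^esub> b"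
      using t
    proof (induction t rule: tensor_induct)
      case (tens m n)
      with ab show ?case
        by (simp add: ract_tens N'.ract_mult N'.ract_closed)
    next
      case (add x y)
      with ab show ?case
        by (simp add: distrib closed)
    qed
  next
    fix t assume "t \<in> carrier (tensor_ab S M N)"
    then show "t \<triangleleft>\<^bsub>tensor S M N\<^esub> \<one>\<^bsub>R\<^esub> = t"
      by (induction t rule: tensor_induct) (simp_all add: ract_tens N'.ract_one distrib)
  qed (simp_all add: distrib closed)
qed

lemma bitensor_left_module:
  assumes pair: "tensor_pair S M N"
    and M': "left_module R M" and lin: "\<And>r. r \<in> carrier R \<Longrightarrow> right_linear S M M (\<lambda>m. r \<triangleright>\<^bsub>M\<^esub> m)"
  shows "left_module R (bitensor S M N)"
    and "\<And>m n r. \<lbrakk>m \<in> carrier M; n \<in> carrier N; r \<in> carrier R\<rbrakk>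
      \<Longrightarrow> r \<triangleright>\<^bsub>bitensor S M N\<^esub> tens S M N m n = tens S M N (r \<triangleright>\<^bsub>M\<^esub> m) n"
proof -
  interpret tensor_pair S M N by (rule pair)
  interpret M': left_module R M by (rule M')
  interpret T: abelian_group "tensor_ab S M N" by (rule tensor_ab_abelian_group)
  interpret T': abelian_group "bitensor S M N" by (rule bitensor_abelian_group[OF pair])
  show lact_tens: "r \<triangleright>\<^bsub>bitensor S M N\<^esub> tens S M N m n = tens S M N (r \<triangleright>\<^bsub>M\<^esub> m) n"
    if "m \<in> carrier M" "n \<in> carrier N" "r \<in> carrier R" for m n r
    using tensor_map_tens[OF pair pair lin left_linear_id] that
    by (simp add: bitensor_lsmult)
  have add: "additive_map (tensor_ab S M N) (tensor_ab S M N) (\<lambda>t. r \<triangleright>\<^bsub>bitensor S M N\<^esub> t)"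
    if "r \<in> carrier R" for r
    using tensor_map_additive[OF pair pair lin[OF that] left_linear_id]
    by (simp add: bitensor_lsmult)
  note closed = additive_map_closed[OF add] and distrib = additive_map_add[OF add]
  show "left_module R (bitensor S M N)"
  proof (unfold_locales, unfold bitensor_simps)
    fix t a b assume t: "t \<in> carrier (tensor_ab S M N)" and ab: "a \<in> carrier R" "b \<in> carrier R"
    show "(a \<oplus>\<^bsub>R\<^esub> b) \<triangleright>\<^bsub>bitensor S M N\<^esub> t
      = (a \<triangleright>\<^bsub>bitensor S M N\<^esub> t) \<oplus>\<^bsub>tensor_ab S M N\<^esub> (b \<triangleright>\<^bsub>bitensor S M N\<^esub> t)"
      using t
    proof (induction t rule: tensor_induct)
      case (tens m n)
      with ab show ?case
        by (simp add: lact_tens M'.lact_add_left tens_add_left M'.lact_closed)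
    next
      case (add x y)
      with ab show ?case
        by (simp add: distrib closed T.a_ac)
    qed
    show "(a \<otimes>\<^bsub>R\<^esub> b) \<triangleright>\<^bsub>bitensor S M N\<^esub> t = a \<triangleright>\<^bsub>bitensor S M N\<^esub> b \<triangleright>\<^bsub>bitensor S M N\<^esub> t"
      using t
    proof (induction t rule: tensor_induct)
      case (tens m n)
      with ab show ?case
        by (simp add: lact_tens M'.lact_mult M'.lact_closed)
    next
      case (add x y)
      with ab show ?case
        by (simp add: distrib closed)
    qed
  next
    fix t assume "t \<in> carrier (tensor_ab S M N)"
    then show "\<one>\<^bsub>R\<^esub> \<triangleright>\<^bsub>bitensor S M N\<^esub> t = t"
      by (induction t rule: tensor_induct) (simp_all add: lact_tens M'.lact_one distrib)
  qed (simp_all add: distrib closed)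
qed

lemma bitensor_bimodule:
  assumes pair: "tensor_pair S M N" and "left_module R M" "right_module R N"
    and linM: "\<And>r. r \<in> carrier R \<Longrightarrow> right_linear S M M (\<lambda>m. r \<triangleright>\<^bsub>M\<^esub> m)"
    and linN: "\<And>r. r \<in> carrier R \<Longrightarrow> left_linear S N N (\<lambda>n. n \<triangleleft>\<^bsub>N\<^esub> r)"
  shows "bimodule R (bitensor S M N)"
proof -
  interpret tensor_pair S M N by (rule pair)
  interpret M: left_module R M by fact
  interpret N: right_module R N by fact
  interpret L: left_module R "bitensor S M N"
    by (rule bitensor_left_module(1)[OF pair]) (fact assms(2), rule linM)
  interpret R: right_module R "tensor S M N"
    by (rule tensor_right_module(1)[OF assms(3) linN])
  note L = bitensor_left_module(2)[OF pair assms(2) linM]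
  note R = tensor_right_module(2)[OF assms(3) linN]
  show ?thesis
  proof (unfold_locales, unfold bitensor_simps)
    fix a t b assume t: "t \<in> carrier (tensor_ab S M N)" and ab: "a \<in> carrier R" "b \<in> carrier R"
    show "(a \<triangleright>\<^bsub>bitensor S M N\<^esub> t) \<triangleleft>\<^bsub>tensor S M N\<^esub> b = a \<triangleright>\<^bsub>bitensor S M N\<^esub> (t \<triangleleft>\<^bsub>tensor S M N\<^esub> b)"
      using t
    proof (induction t rule: tensor_induct)
      case (tens m n)
      with ab show ?case
        by (simp add: L R M.lact_closed N.ract_closed)
    next
      case (add x y)
      with ab show ?case
        using R.ract_add_left[of "a \<triangleright>\<^bsub>bitensor S M N\<^esub> x" "a \<triangleright>\<^bsub>bitensor S M N\<^esub> y" b] R.ract_add_left[of x y b]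
          L.lact_add_right[of a x y] L.lact_add_right[of a "x \<triangleleft>\<^bsub>tensor S M N\<^esub> b" "y \<triangleleft>\<^bsub>tensor S M N\<^esub> b"]
          L.lact_closed[of a] R.ract_closed[of _ b]
        by simp
    qed
  qed (use R.ract_closed R.ract_add_left R.ract_add_right R.ract_mult R.ract_one in simp_all)
qed

context
  fixes A :: "('a, 'w) ring_scheme" and M :: "('m, 'a, 'x) rmod_scheme"
    and N :: "('n, 'a, 'a, 'y) bimod_scheme" and P :: "('p, 'q, 'a, 'z) bimod_scheme"
  assumes M: "right_module A M" and N: "bimodule A N" and P: "left_module A P"
begin

interpretation M: right_module A M by (rule M)
interpretation N: bimodule A N by (rule N)
interpretation P: left_module A P by (rule P)
interpretation MN: tensor_pair "carrier A" M N
  by (rule module_tensor_pair[OF M N.left_module_axioms])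
interpretation NP: tensor_pair "carrier A" N P
  by (rule module_tensor_pair[OF N.right_module_axioms P])

lemmas MN_right = MN.tensor_right_module[OF N.right_module_axioms N.ract_left_linear]
lemmas NP_left = bitensor_left_module[OF NP.tensor_pair_axioms N.left_module_axioms N.lact_right_linear]

interpretation MN_P: tensor_pair "carrier A" "tensor (carrier A) M N" P
  by (rule module_tensor_pair[OF MN_right(1) P])
interpretation M_NP: tensor_pair "carrier A" M "bitensor (carrier A) N P"
  by (rule module_tensor_pair[OF M NP_left(1)])

abbreviation "assoc_target \<equiv> tensor_ab (carrier A) M (bitensor (carrier A) N P)"
abbreviation "assoc_form t p \<equiv> tlift assoc_target
  (\<lambda>m n. tens (carrier A) M (bitensor (carrier A) N P) m (tens (carrier A) N P n p)) t"

lemma assoc_inner_balanced: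
  assumes "p \<in> carrier P"
  shows "balanced_map (carrier A) M N assoc_target
    (\<lambda>m n. tens (carrier A) M (bitensor (carrier A) N P) m (tens (carrier A) N P n p))"
proof (rule balanced_mapI)
  fix m n n' assume "m \<in> carrier M" "n \<in> carrier N" "n' \<in> carrier N"
  then show "tens (carrier A) M (bitensor (carrier A) N P) m (tens (carrier A) N P (n \<oplus>\<^bsub>N\<^esub> n') p)
    = tens (carrier A) M (bitensor (carrier A) N P) m (tens (carrier A) N P n p)
      \<oplus>\<^bsub>assoc_target\<^esub> tens (carrier A) M (bitensor (carrier A) N P) m (tens (carrier A) N P n' p)"
    using M_NP.tens_add_right[of m "tens (carrier A) N P n p" "tens (carrier A) N P n' p"]
    by (simp add: NP.tens_add_left NP.tens_closed assms)
next
  fix m n s assume "m \<in> carrier M" "n \<in> carrier N" "s \<in> carrier A"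
  then show "tens (carrier A) M (bitensor (carrier A) N P) (m \<triangleleft>\<^bsub>M\<^esub> s) (tens (carrier A) N P n p)
    = tens (carrier A) M (bitensor (carrier A) N P) m (tens (carrier A) N P (s \<triangleright>\<^bsub>N\<^esub> n) p)"
    by (simp add: M_NP.tens_balanced NP_left(2)[symmetric] NP.tens_closed assms)
qed (simp_all add: assms M_NP.tens_closed M_NP.tens_add_left NP.tens_closed)

lemmas assoc_form_additive =
  MN.tlift_additive[OF M_NP.tensor_ab_abelian_group assoc_inner_balanced]
lemmas assoc_form_tens =
  MN.tlift_tens[OF M_NP.tensor_ab_abelian_group assoc_inner_balanced]

text \<open>Rebracketing is obtained by lifting twice. For fixed \<open>p\<close> the inner lift is additive in \<open>t\<close>, so the
  remaining conditions, which involve \<open>p\<close>, may be tested on pure tensors \<open>t\<close>.\<close>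

lemma assoc_balanced: "balanced_map (carrier A) (tensor (carrier A) M N) P assoc_target assoc_form"
proof (rule balanced_mapI; (unfold tensor_simps)?)
  fix t p assume t: "t \<in> carrier (tensor_ab (carrier A) M N)" and p: "p \<in> carrier P"
  then show "assoc_form t p \<in> carrier assoc_target"
    using additive_map_closed[OF assoc_form_additive] by blast
next
  fix t t' p
  assume "t \<in> carrier (tensor_ab (carrier A) M N)" "t' \<in> carrier (tensor_ab (carrier A) M N)"
    and p: "p \<in> carrier P"
  then show "assoc_form (t \<oplus>\<^bsub>tensor_ab (carrier A) M N\<^esub> t') p = assoc_form t p \<oplus>\<^bsub>assoc_target\<^esub> assoc_form t' p"
    using additive_map_add[OF assoc_form_additive[OF p]] by blast
next
  fix t p p'
  assume t: "t \<in> carrier (tensor_ab (carrier A) M N)" and p: "p \<in> carrier P" "p' \<in> carrier P"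
  interpret Q: abelian_group assoc_target by (rule M_NP.tensor_ab_abelian_group)
  note pp' = P.ab.a_closed[OF p]
  show "assoc_form t (p \<oplus>\<^bsub>P\<^esub> p') = assoc_form t p \<oplus>\<^bsub>assoc_target\<^esub> assoc_form t p'"
    using t
  proof (induction t rule: MN.tensor_induct)
    case (tens m n)
    then show ?case
      using M_NP.tens_add_right[of m "tens (carrier A) N P n p" "tens (carrier A) N P n p'"] p
      by (simp add: assoc_form_tens pp' NP.tens_add_right NP.tens_closed)
  next
    case (add x y)
    note c = additive_map_closed[OF assoc_form_additive]
    show ?case
      using add.IH c[OF p(1) add.hyps(1)] c[OF p(2) add.hyps(1)] c[OF p(1) add.hyps(2)]
        c[OF p(2) add.hyps(2)]
      by (simp add: additive_map_add[OF assoc_form_additive[OF p(1)] add.hyps]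
          additive_map_add[OF assoc_form_additive[OF p(2)] add.hyps]
          additive_map_add[OF assoc_form_additive[OF pp'] add.hyps] Q.a_ac)
  qed
next
  fix t p a
  assume t: "t \<in> carrier (tensor_ab (carrier A) M N)" and p: "p \<in> carrier P" and a: "a \<in> carrier A"
  interpret R: right_module A "tensor (carrier A) M N" by (rule MN_right(1))
  note ap = P.lact_closed[OF a p]
  show "assoc_form (t \<triangleleft>\<^bsub>tensor (carrier A) M N\<^esub> a) p = assoc_form t (a \<triangleright>\<^bsub>P\<^esub> p)"
    using t
  proof (induction t rule: MN.tensor_induct)
    case (tens m n)
    then show ?case
      using a p by (simp add: MN_right(2) assoc_form_tens ap N.ract_closed NP.tens_balanced)
  next
    case (add x y)
    have "x \<triangleleft>\<^bsub>tensor (carrier A) M N\<^esub> a \<in> carrier (tensor_ab (carrier A) M N)"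
      "y \<triangleleft>\<^bsub>tensor (carrier A) M N\<^esub> a \<in> carrier (tensor_ab (carrier A) M N)"
      using R.ract_closed[OF _ a] add.hyps by simp_all
    with add.IH R.ract_add_left[of x y a] add.hyps a show ?case
      by (simp add: additive_map_add[OF assoc_form_additive[OF p]]
          additive_map_add[OF assoc_form_additive[OF ap]])
  qed
qed

lemma tensor_assoc_additive:
  "additive_map (tensor_ab (carrier A) (tensor (carrier A) M N) P) assoc_target
    (tensor_assoc (carrier A) (carrier A) M N P)"
  unfolding tensor_assoc_def by (rule MN_P.tlift_additive[OF M_NP.tensor_ab_abelian_group assoc_balanced])

lemma tensor_assoc_tens:
  assumes "t \<in> carrier (tensor_ab (carrier A) M N)" "p \<in> carrier P"
  shows "tensor_assoc (carrier A) (carrier A) M N P (tens (carrier A) (tensor (carrier A) M N) P t p)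
    = assoc_form t p"
  unfolding tensor_assoc_def
  by (rule MN_P.tlift_tens[OF M_NP.tensor_ab_abelian_group assoc_balanced]) (simp_all add: assms)

end


section \<open>Dual bases\<close>

lemma regular_bimod_simps [simp]:
  "carrier (regular_bimod A) = carrier A"
  "ring.add (regular_bimod A) = ring.add A"
  "\<zero>\<^bsub>regular_bimod A\<^esub> = \<zero>\<^bsub>A\<^esub>"
  "rsmult (regular_bimod A) = monoid.mult A"
  "lsmult (regular_bimod A) = monoid.mult A"
  by (simp_all add: regular_bimod_def)

lemma regular_bimod_abelian_group: "ring A \<Longrightarrow> abelian_group (regular_bimod A)"
  by (rule abelian_group_cong[of A]) (simp_all add: ring_def)

lemma dual_iff:
  "\<phi> \<in> dual A M \<longleftrightarrow> \<phi> \<in> extensional (carrier M) \<and> right_linear (carrier A) M (regular_bimod A) \<phi>"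
  by (simp add: dual_def rmod_hom_def is_rmod_hom_iff)

lemma dualI:
  assumes "\<phi> \<in> extensional (carrier M)"
    and "\<And>x. x \<in> carrier M \<Longrightarrow> \<phi> x \<in> carrier A"
    and "\<And>x y. \<lbrakk>x \<in> carrier M; y \<in> carrier M\<rbrakk> \<Longrightarrow> \<phi> (x \<oplus>\<^bsub>M\<^esub> y) = \<phi> x \<oplus>\<^bsub>A\<^esub> \<phi> y"
    and "\<And>x a. \<lbrakk>x \<in> carrier M; a \<in> carrier A\<rbrakk> \<Longrightarrow> \<phi> (x \<triangleleft>\<^bsub>M\<^esub> a) = \<phi> x \<otimes>\<^bsub>A\<^esub> a"
  shows "\<phi> \<in> dual A M"
  using assms by (auto simp: dual_iff right_linear_def additive_map_def)

lemma dualD: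
  assumes "\<phi> \<in> dual A M"
  shows "\<phi> \<in> extensional (carrier M)"
    and "x \<in> carrier M \<Longrightarrow> \<phi> x \<in> carrier A"
    and "\<lbrakk>x \<in> carrier M; y \<in> carrier M\<rbrakk> \<Longrightarrow> \<phi> (x \<oplus>\<^bsub>M\<^esub> y) = \<phi> x \<oplus>\<^bsub>A\<^esub> \<phi> y"
    and "\<lbrakk>x \<in> carrier M; a \<in> carrier A\<rbrakk> \<Longrightarrow> \<phi> (x \<triangleleft>\<^bsub>M\<^esub> a) = \<phi> x \<otimes>\<^bsub>A\<^esub> a"
  using assms by (auto simp: dual_iff right_linear_def additive_map_def)

lemma free_rmod_abelian_group:
  assumes "ring A"
  shows "abelian_group (free_rmod A n)"
proof -
  interpret ring A by (rule assms)
  show ?thesis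
  proof (rule abelian_groupI; (elim bexE)?)
    fix v assume "v \<in> carrier (free_rmod A n)"
    then show "\<exists>w\<in>carrier (free_rmod A n). w \<oplus>\<^bsub>free_rmod A n\<^esub> v = \<zero>\<^bsub>free_rmod A n\<^esub>"
      by (intro bexI[of _ "\<lambda>s\<in>{..<n}. \<ominus>\<^bsub>A\<^esub> v s"])
        (auto simp: free_rmod_def l_neg PiE_iff intro!: restrict_ext)
  qed (auto simp: free_rmod_def PiE_iff a_ac extensional_def fun_eq_iff)
qed

definition unit_vector :: "('a, 'x) ring_scheme \<Rightarrow> nat \<Rightarrow> nat \<Rightarrow> nat \<Rightarrow> 'a" where
  "unit_vector A n s = (\<lambda>r\<in>{..<n}. if r = s then \<one>\<^bsub>A\<^esub> else \<zero>\<^bsub>A\<^esub>)"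

lemma free_rmod_expand:
  assumes A: "ring A" and v: "v \<in> carrier (free_rmod A n)"
  shows "v = (\<Oplus>\<^bsub>free_rmod A n\<^esub>s\<in>{..<n}. unit_vector A n s \<triangleleft>\<^bsub>free_rmod A n\<^esub> v s)" (is "_ = ?w")
proof -
  interpret ring A by (rule A)
  interpret F: abelian_group "free_rmod A n" by (rule free_rmod_abelian_group[OF A])
  have vc: "v s \<in> carrier A" if "s < n" for s
    using v that by (auto simp: free_rmod_def)
  have c: "unit_vector A n s \<triangleleft>\<^bsub>free_rmod A n\<^esub> v s \<in> carrier (free_rmod A n)" if "s < n" for s
    using vc[OF that] by (auto simp: free_rmod_def unit_vector_def)
  have w: "?w \<in> carrier (free_rmod A n)"
    using c by (intro F.finsum_closed) auto
  have "?w r = v r" if r: "r < n" for r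
  proof -
    have "additive_map (free_rmod A n) A (\<lambda>v. v r)"
      using r by (intro additive_mapI) (auto simp: free_rmod_def)
    then have "?w r = (\<Oplus>\<^bsub>A\<^esub>s\<in>{..<n}. (unit_vector A n s \<triangleleft>\<^bsub>free_rmod A n\<^esub> v s) r)"
      using c by (intro additive_map_finsum[OF _ F.abelian_group_axioms abelian_group_axioms]) auto
    also have "\<dots> = (\<Oplus>\<^bsub>A\<^esub>s\<in>{..<n}. if r = s then v s else \<zero>\<^bsub>A\<^esub>)"
      using r vc by (intro finsum_cong') (auto simp: free_rmod_def unit_vector_def)
    also have "\<dots> = v r"
      using r vc by (intro finsum_singleton) auto
    finally show ?thesis .
  qed
  moreover have carrier: "carrier (free_rmod A n) = {..<n} \<rightarrow>\<^sub>E carrier A"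
    by (simp add: free_rmod_def)
  ultimately show ?thesis
    by (intro PiE_ext[OF v[unfolded carrier] w[unfolded carrier]]) auto
qed

text \<open>If \<open>P\<close> is a retract of \<open>A\<^sup>n\<close>, the images of the unit vectors under the retraction and the coordinates
  of the inclusion form a dual basis.\<close>

lemma fgp_dual_basis:
  assumes "fgp A P"
  shows "\<exists>n z zs. dual_basis A P n z zs"
proof -
  from assms obtain n f g where P: "right_module A P" and f: "is_rmod_hom A P (free_rmod A n) f"
    and g: "is_rmod_hom A (free_rmod A n) P g" and gf: "\<And>x. x \<in> carrier P \<Longrightarrow> g (f x) = x"
    by (auto simp: fgp_def)
  interpret P: right_module A P by (rule P)
  have F: "abelian_group (free_rmod A n)" by (rule free_rmod_abelian_group[OF P.scal.ring_axioms])
  have u: "unit_vector A n s \<in> carrier (free_rmod A n)" for s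
    by (auto simp: free_rmod_def unit_vector_def)
  have sm: "v \<triangleleft>\<^bsub>free_rmod A n\<^esub> a \<in> carrier (free_rmod A n)"
    if "v \<in> carrier (free_rmod A n)" "a \<in> carrier A" for v a
    using that by (auto simp: free_rmod_def)
  have fx: "f x s \<in> carrier A" if "x \<in> carrier P" "s < n" for x s
  proof -
    have "f x \<in> carrier (free_rmod A n)" using f that by (auto simp: is_rmod_hom_def)
    with that show ?thesis by (auto simp: free_rmod_def)
  qed
  have "dual_basis A P n (\<lambda>s. g (unit_vector A n s)) (\<lambda>s. \<lambda>x\<in>carrier P. f x s)"
    unfolding dual_basis_def
  proof (intro conjI ballI)
    show "(\<lambda>s. g (unit_vector A n s)) \<in> {..<n} \<rightarrow> carrier P"
      using g u by (auto simp: is_rmod_hom_def)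
    show "(\<lambda>s. \<lambda>x\<in>carrier P. f x s) \<in> {..<n} \<rightarrow> dual A P"
    proof (intro Pi_I dualI)
      fix s x y assume s: "s \<in> {..<n}" and x: "x \<in> carrier P"
      then show "(\<lambda>x\<in>carrier P. f x s) x \<in> carrier A" using fx by simp
      show "(\<lambda>x\<in>carrier P. f x s) (x \<oplus>\<^bsub>P\<^esub> y) = (\<lambda>x\<in>carrier P. f x s) x \<oplus>\<^bsub>A\<^esub> (\<lambda>x\<in>carrier P. f x s) y"
        if "y \<in> carrier P"
        using s x that f by (simp add: is_rmod_hom_def) (simp add: free_rmod_def)
    next
      fix s x a assume "s \<in> {..<n}" "x \<in> carrier P" "a \<in> carrier A"
      then show "(\<lambda>x\<in>carrier P. f x s) (x \<triangleleft>\<^bsub>P\<^esub> a) = (\<lambda>x\<in>carrier P. f x s) x \<otimes>\<^bsub>A\<^esub> a"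
        using f by (simp add: is_rmod_hom_def P.ract_closed) (simp add: free_rmod_def)
    qed simp
    fix x assume x: "x \<in> carrier P"
    have fc: "f x \<in> carrier (free_rmod A n)" using f x by (auto simp: is_rmod_hom_def)
    have "x = g (\<Oplus>\<^bsub>free_rmod A n\<^esub>s\<in>{..<n}. unit_vector A n s \<triangleleft>\<^bsub>free_rmod A n\<^esub> f x s)"
      using free_rmod_expand[OF P.scal.ring_axioms fc] gf[OF x] by simp
    also have "\<dots> = (\<Oplus>\<^bsub>P\<^esub>s\<in>{..<n}. g (unit_vector A n s \<triangleleft>\<^bsub>free_rmod A n\<^esub> f x s))"
      using g u sm fx[OF x]
      by (intro additive_map_finsum[OF _ F P.ab.abelian_group_axioms])
        (auto simp: is_rmod_hom_iff right_linear_def)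
    also have "\<dots> = (\<Oplus>\<^bsub>P\<^esub>s\<in>{..<n}. g (unit_vector A n s) \<triangleleft>\<^bsub>P\<^esub> (\<lambda>x\<in>carrier P. f x s) x)"
      using g u x fx[OF x] P.ract_closed
      by (intro P.ab.finsum_cong') (auto simp: is_rmod_hom_def Pi_iff)
    finally show "x = (\<Oplus>\<^bsub>P\<^esub>s\<in>{..<n}. g (unit_vector A n s) \<triangleleft>\<^bsub>P\<^esub> (\<lambda>x\<in>carrier P. f x s) x)" .
  qed
  then show ?thesis by blast
qed


section \<open>Contraction with a linear form, and comodule homomorphisms\<close>

text \<open>The map \<open>x \<otimes> c \<mapsto> \<phi>(x) c\<close>. Applied to a coaction it yields \<open>\<phi>(m\<^sub>0) m\<^sub>1\<close>, the value prescribed for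
  the canonical map.\<close>

definition contract ::
  "('c, 'p, 'a, 'x) bimod_scheme \<Rightarrow> ('m \<Rightarrow> 'a) \<Rightarrow> ('m, 'c) tens \<Rightarrow> 'c" where
  "contract C \<phi> = tlift C (\<lambda>x c. \<phi> x \<triangleright>\<^bsub>C\<^esub> c)"

context
  fixes A :: "('a, 'w) ring_scheme" and N :: "('m, 'a, 'x) rmod_scheme"
    and C :: "('c, 'p, 'a, 'y) bimod_scheme"
  assumes N: "right_module A N" and C: "left_module A C"
begin

interpretation N: right_module A N by (rule N)
interpretation C: left_module A C by (rule C)
interpretation NC: tensor_pair "carrier A" N C by (rule module_tensor_pair[OF N C])

lemma contract_balanced:
  "\<phi> \<in> dual A N \<Longrightarrow> balanced_map (carrier A) N C C (\<lambda>x c. \<phi> x \<triangleright>\<^bsub>C\<^esub> c)"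
  by (intro balanced_mapI)
    (simp_all add: dualD C.lact_closed C.lact_add_left C.lact_add_right C.lact_mult)

lemma contract_additive:
  "\<phi> \<in> dual A N \<Longrightarrow> additive_map (tensor_ab (carrier A) N C) C (contract C \<phi>)"
  unfolding contract_def by (rule NC.tlift_additive[OF C.ab.abelian_group_axioms contract_balanced])

lemma contract_tens:
  "\<lbrakk>\<phi> \<in> dual A N; x \<in> carrier N; c \<in> carrier C\<rbrakk>
    \<Longrightarrow> contract C \<phi> (tens (carrier A) N C x c) = \<phi> x \<triangleright>\<^bsub>C\<^esub> c"
  unfolding contract_def by (rule NC.tlift_tens[OF C.ab.abelian_group_axioms contract_balanced])

lemma contract_closed:
  "\<lbrakk>\<phi> \<in> dual A N; t \<in> carrier (tensor_ab (carrier A) N C)\<rbrakk> \<Longrightarrow> contract C \<phi> t \<in> carrier C"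
  using additive_map_closed[OF contract_additive] .

lemma contract_add_form:
  assumes \<phi>: "\<phi> \<in> dual A N" and \<psi>: "\<psi> \<in> dual A N" and \<chi>: "\<chi> \<in> dual A N"
    and add: "\<And>x. x \<in> carrier N \<Longrightarrow> \<chi> x = \<phi> x \<oplus>\<^bsub>A\<^esub> \<psi> x"
    and t: "t \<in> carrier (tensor_ab (carrier A) N C)"
  shows "contract C \<chi> t = contract C \<phi> t \<oplus>\<^bsub>C\<^esub> contract C \<psi> t"
  using t
proof (induction t rule: NC.tensor_induct)
  case (tens x c)
  then show ?case
    using \<phi> \<psi> \<chi> by (simp add: contract_tens add C.lact_add_left dualD)
next
  case (add s t)
  then show ?case
    using \<phi> \<psi> \<chi>
    by (simp add: additive_map_add[OF contract_additive] contract_closed C.ab.a_ac)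
qed

lemma contract_smult_form:
  assumes \<phi>: "\<phi> \<in> dual A N" and \<chi>: "\<chi> \<in> dual A N" and a: "a \<in> carrier A"
    and smult: "\<And>x. x \<in> carrier N \<Longrightarrow> \<chi> x = a \<otimes>\<^bsub>A\<^esub> \<phi> x"
    and t: "t \<in> carrier (tensor_ab (carrier A) N C)"
  shows "contract C \<chi> t = a \<triangleright>\<^bsub>C\<^esub> contract C \<phi> t"
  using t
proof (induction t rule: NC.tensor_induct)
  case (tens x c)
  then show ?case
    using \<phi> \<chi> a by (simp add: contract_tens smult C.lact_mult dualD)
next
  case (add s t)
  then show ?case
    using \<phi> \<chi> a by (simp add: additive_map_add[OF contract_additive] contract_closed C.lact_add_right)
qed

end

text \<open>Naturality in the module: a linear form may be pulled back before contracting.\<close>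

lemma contract_tensor_map:
  assumes N: "right_module A N" and C: "left_module A C" and N': "right_module A N'"
    and f: "right_linear (carrier A) N N' f"
    and \<phi>: "\<phi> \<in> dual A N'" and \<psi>: "\<psi> \<in> dual A N"
    and comp: "\<And>x. x \<in> carrier N \<Longrightarrow> \<psi> x = \<phi> (f x)"
    and t: "t \<in> carrier (tensor_ab (carrier A) N C)"
  shows "contract C \<phi> (tensor_map (carrier A) N' C f id t) = contract C \<psi> t"
proof -
  have NC: "tensor_pair (carrier A) N C" and N'C: "tensor_pair (carrier A) N' C"
    by (rule module_tensor_pair; fact)+
  have "f x \<in> carrier N'" if "x \<in> carrier N" for x
    using f that by (auto simp: right_linear_def additive_map_def)
  then show ?thesis
    by (intro tensor_pair.additive_maps_eqI[OF NC
          additive_map_comp[OF tensor_map_additive[OF NC N'C f left_linear_id] contract_additive[OF N' C \<phi>]]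
          contract_additive[OF N C \<psi>] _ t])
      (simp add: tensor_map_tens[OF NC N'C f left_linear_id] contract_tens[OF N' C \<phi>]
        contract_tens[OF N C \<psi>] comp)
qed

lemma contract_right_linear:
  assumes N: "right_module A N" and C: "bimodule A C" and \<phi>: "\<phi> \<in> dual A N" and a: "a \<in> carrier A"
    and t: "t \<in> carrier (tensor_ab (carrier A) N C)"
  shows "contract C \<phi> (t \<triangleleft>\<^bsub>tensor (carrier A) N C\<^esub> a) = contract C \<phi> t \<triangleleft>\<^bsub>C\<^esub> a"
proof -
  interpret C: bimodule A C by (rule C)
  interpret NC: tensor_pair "carrier A" N C
    by (rule module_tensor_pair[OF N C.left_module_axioms])
  note R = NC.tensor_right_module[OF C.right_module_axioms C.ract_left_linear]
  interpret R: right_module A "tensor (carrier A) N C" by (rule R(1))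
  note contract_rules = contract_tens[OF N C.left_module_axioms \<phi>]
  have "additive_map (tensor_ab (carrier A) N C) (tensor_ab (carrier A) N C)
      (\<lambda>t. t \<triangleleft>\<^bsub>tensor (carrier A) N C\<^esub> a)"
    using R.ract_additive[OF a] by (simp add: additive_map_def)
  note l = additive_map_comp[OF this contract_additive[OF N C.left_module_axioms \<phi>]]
    and r = additive_map_comp[OF contract_additive[OF N C.left_module_axioms \<phi>] C.ract_additive[OF a]]
  show ?thesis
    by (rule NC.additive_maps_eqI[OF l r _ t])
      (simp add: R(2) contract_rules C.ract_closed C.lact_ract dualD(2)[OF \<phi>] a)
qed

lemma is_comod_hom_comp:
  assumes C: "left_module A C" and "comodule A C L" "comodule A C M" "comodule A C N"
    and f: "is_comod_hom A C L M f" and g: "is_comod_hom A C M N g"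
    and h: "\<And>x. x \<in> carrier L \<Longrightarrow> h x = g (f x)"
  shows "is_comod_hom A C L N h"
proof -
  interpret L: comodule A C L by fact
  interpret M: comodule A C M by fact
  interpret N: comodule A C N by fact
  note LC = module_tensor_pair[OF L.right_module_axioms C]
    and MC = module_tensor_pair[OF M.right_module_axioms C]
    and NC = module_tensor_pair[OF N.right_module_axioms C]
  have f': "right_linear (carrier A) L M f" and g': "right_linear (carrier A) M N g"
    using f g by (simp_all add: is_comod_hom_def is_rmod_hom_iff)
  have fc: "f x \<in> carrier M" if "x \<in> carrier L" for x
    using f' that by (auto simp: right_linear_def additive_map_def)
  have gc: "g x \<in> carrier N" if "x \<in> carrier M" for x
    using g' that by (auto simp: right_linear_def additive_map_def)
  have h': "right_linear (carrier A) L N h"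
    using f' g' by (auto simp: right_linear_def additive_map_def h L.ract_closed L.ab.a_closed Pi_iff)
  have "coact N (h x) = tensor_map (carrier A) N C h id (coact L x)" if x: "x \<in> carrier L" for x
  proof -
    have c: "coact L x \<in> carrier (tensor_ab (carrier A) L C)"
      using L.coact_hom x by (auto simp: is_rmod_hom_def)
    have "coact N (h x) = tensor_map (carrier A) N C g id (tensor_map (carrier A) M C f id (coact L x))"
      using f g x fc by (simp add: is_comod_hom_def h)
    also have "\<dots> = tensor_map (carrier A) N C h id (coact L x)"
      by (rule tensor_map_comp[OF LC MC NC f' left_linear_id g' left_linear_id h' left_linear_id _ _ c])
        (simp_all add: h)
    finally show ?thesis .
  qed
  with h' show ?thesis by (simp add: is_comod_hom_def is_rmod_hom_iff)
qed

text \<open>Contraction only involves the first tensor factor, hence it commutes with rebracketing. In this form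
  coassociativity of a coaction can be used after contracting.\<close>

lemma contract_tensor_assoc:
  assumes M: "right_module A M" and C: "bimodule A C" and \<phi>: "\<phi> \<in> dual A M"
    and s: "s \<in> carrier (tensor_ab (carrier A) (tensor (carrier A) M C) C)"
  shows "contract (bitensor (carrier A) C C) \<phi> (tensor_assoc (carrier A) (carrier A) M C C s)
    = tensor_map (carrier A) C C (contract C \<phi>) id s"
proof -
  interpret M: right_module A M by (rule M)
  interpret C: bimodule A C by (rule C)
  interpret MC: tensor_pair "carrier A" M C by (rule module_tensor_pair[OF M C.left_module_axioms])
  interpret CC: tensor_pair "carrier A" C C
    by (rule module_tensor_pair[OF C.right_module_axioms C.left_module_axioms])
  note R = MC.tensor_right_module[OF C.right_module_axioms C.ract_left_linear]
  note L = bitensor_left_module[OF CC.tensor_pair_axioms C.left_module_axioms C.lact_right_linear]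
  interpret MC_C: tensor_pair "carrier A" "tensor (carrier A) M C" C
    by (rule module_tensor_pair[OF R(1) C.left_module_axioms])
  have form: "contract (bitensor (carrier A) C C) \<phi> (assoc_form A M C C t c)
      = tens (carrier A) C C (contract C \<phi> t) c"
    if c: "c \<in> carrier C" and t: "t \<in> carrier (tensor_ab (carrier A) M C)" for t c
  proof (rule MC.additive_maps_eqI[OF _ _ _ t])
    show "additive_map (tensor_ab (carrier A) M C) (bitensor (carrier A) C C)
        (\<lambda>t. contract (bitensor (carrier A) C C) \<phi> (assoc_form A M C C t c))"
      by (rule additive_map_comp[OF assoc_form_additive[OF M C C.left_module_axioms c]
            contract_additive[OF M L(1) \<phi>]])
    show "additive_map (tensor_ab (carrier A) M C) (bitensor (carrier A) C C)
        (\<lambda>t. tens (carrier A) C C (contract C \<phi> t) c)"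
      using additive_map_comp[OF contract_additive[OF M C.left_module_axioms \<phi>] CC.additive_tens_left[OF c]]
      by (simp add: additive_map_def)
    fix m n assume "m \<in> carrier M" "n \<in> carrier C"
    then show "contract (bitensor (carrier A) C C) \<phi> (assoc_form A M C C (tens (carrier A) M C m n) c)
      = tens (carrier A) C C (contract C \<phi> (tens (carrier A) M C m n)) c"
      using c by (simp add: assoc_form_tens[OF M C C.left_module_axioms]
          contract_tens[OF M L(1) \<phi>] contract_tens[OF M C.left_module_axioms \<phi>]
          CC.tens_closed L(2) dualD(2)[OF \<phi>])
  qed
  have lin: "right_linear (carrier A) (tensor (carrier A) M C) C (contract C \<phi>)"
    using contract_additive[OF M C.left_module_axioms \<phi>] contract_right_linear[OF M C \<phi>]
    by (simp add: right_linear_def additive_map_def)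
  have r: "additive_map (tensor_ab (carrier A) (tensor (carrier A) M C) C) (bitensor (carrier A) C C)
      (tensor_map (carrier A) C C (contract C \<phi>) id)"
    using tensor_map_additive[OF MC_C.tensor_pair_axioms CC.tensor_pair_axioms lin left_linear_id]
    by (simp add: additive_map_def)
  show ?thesis
    by (rule MC_C.additive_maps_eqI[OF
          additive_map_comp[OF tensor_assoc_additive[OF M C C.left_module_axioms] contract_additive[OF M L(1) \<phi>]]
          r _ s])
      (simp_all add: tensor_assoc_tens[OF M C C.left_module_axioms] form
        tensor_map_tens[OF MC_C.tensor_pair_axioms CC.tensor_pair_axioms lin left_linear_id])
qed


section \<open>The comatrix bimodule\<close>

text \<open>The last two conditions say that the idempotents \<open>e\<^sub>i = \<mu>\<^sub>i \<circ> \<nu>\<^sub>i\<close> satisfy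
  \<open>e\<^sub>j \<circ> e\<^sub>i = e\<^sub>i = e\<^sub>i \<circ> e\<^sub>j\<close> for \<open>i \<le> j\<close>, which is how the transition maps of the system
  are reflected on the colimit itself.\<close>

locale split_colimit = C: coring K A C + M: comodule A C M
  for K :: "('k, 'kx) ring_scheme" and A :: "('k, 'a, 'ax) module_scheme"
    and C :: "('c, 'a, 'cx) coring_scheme" and M :: "('m, 'a, 'c) comod" +
  fixes Ms :: "'i::order \<Rightarrow> ('m, 'a, 'c) comod" and \<mu>M \<nu>M :: "'i \<Rightarrow> 'm \<Rightarrow> 'm"
  assumes directed: "\<exists>k. i \<le> k \<and> j \<le> (k :: 'i)"
    and Ms_comodule: "comodule A C (Ms i)"
    and Ms_fgp: "fgp A (Ms i)"
    and \<mu>M_hom: "is_comod_hom A C (Ms i) M (\<mu>M i)"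
    and \<nu>M_hom: "is_comod_hom A C M (Ms i) (\<nu>M i)"
    and \<nu>M_\<mu>M: "m \<in> carrier (Ms i) \<Longrightarrow> \<nu>M i (\<mu>M i m) = m"
    and absorb_left: "\<lbrakk>i \<le> j; m \<in> carrier M\<rbrakk> \<Longrightarrow> \<mu>M j (\<nu>M j (\<mu>M i (\<nu>M i m))) = \<mu>M i (\<nu>M i m)"
    and absorb_right: "\<lbrakk>i \<le> j; m \<in> carrier M\<rbrakk> \<Longrightarrow> \<mu>M i (\<nu>M i (\<mu>M j (\<nu>M j m))) = \<mu>M i (\<nu>M i m)"
begin

sublocale Cb: bimodule A C
  by (rule k_bimodule_bimodule[OF C.k_bimodule_axioms])

abbreviation "e i \<equiv> idem M \<mu>M \<nu>M i"
abbreviation "T \<equiv> T_dag A C M \<mu>M \<nu>M"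
abbreviation "Md \<equiv> M_dag A M \<mu>M \<nu>M"
abbreviation "E \<equiv> eval_bimod M"
abbreviation "G \<equiv> comatrix_bimod A C M \<mu>M \<nu>M"
abbreviation "el \<equiv> comatrix_elem A C M \<mu>M \<nu>M"
abbreviation "CC \<equiv> bitensor (carrier A) C C"
abbreviation "GG \<equiv> bitensor (carrier A) G G"

lemma \<mu>M_closed: "m \<in> carrier (Ms i) \<Longrightarrow> \<mu>M i m \<in> carrier M"
  and \<nu>M_closed: "m \<in> carrier M \<Longrightarrow> \<nu>M i m \<in> carrier (Ms i)"
  using \<mu>M_hom[of i] \<nu>M_hom[of i] by (auto simp: is_comod_hom_def is_rmod_hom_def)

lemma e_apply: "m \<in> carrier M \<Longrightarrow> e i m = \<mu>M i (\<nu>M i m)"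
  by (simp add: idem_def compose_def)

lemma e_closed: "m \<in> carrier M \<Longrightarrow> e i m \<in> carrier M"
  by (simp add: e_apply \<mu>M_closed \<nu>M_closed)

lemma e_absorb:
  assumes "i \<le> j" "m \<in> carrier M"
  shows "e j (e i m) = e i m" "e i (e j m) = e i m"
  using assms absorb_left absorb_right
  by (simp_all add: e_apply \<mu>M_closed \<nu>M_closed)

lemma e_comod_hom: "e i \<in> comod_hom A C M M"
proof -
  have "is_comod_hom A C M M (e i)"
    by (rule is_comod_hom_comp[OF Cb.left_module_axioms M.comodule_axioms Ms_comodule
          M.comodule_axioms \<nu>M_hom \<mu>M_hom e_apply])
  then show ?thesis
    by (simp add: comod_hom_def idem_def)
qed

text \<open>That is, \<open>f = f \<circ> e\<^sub>i\<close>. The condition becomes weaker as \<open>i\<close> grows, so that by directedness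
  finitely many maps have a common index.\<close>

definition supported :: "('m \<Rightarrow> 'b) \<Rightarrow> 'i \<Rightarrow> bool" where
  "supported f i \<longleftrightarrow> (\<forall>m\<in>carrier M. f (e i m) = f m)"

lemma supportedD: "\<lbrakk>supported f i; m \<in> carrier M\<rbrakk> \<Longrightarrow> f (e i m) = f m"
  by (simp add: supported_def)

lemma supported_mono:
  assumes "supported f i" "i \<le> j"
  shows "supported f j"
  unfolding supported_def
proof
  fix m assume m: "m \<in> carrier M"
  have "f (e j m) = f (e i (e j m))"
    using supportedD[OF assms(1) e_closed[OF m]] by simp
  then show "f (e j m) = f m"
    using e_absorb(2)[OF assms(2) m] supportedD[OF assms(1) m] by simp
qed

lemma compose_e_eq_iff:
  assumes "f \<in> extensional (carrier M)"
  shows "f = compose (carrier M) f (e i) \<longleftrightarrow> supported f i"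
proof
  assume f: "f = compose (carrier M) f (e i)"
  show "supported f i"
    unfolding supported_def
  proof
    fix m assume "m \<in> carrier M"
    then have "compose (carrier M) f (e i) m = f (e i m)" by (simp add: compose_eq)
    then show "f (e i m) = f m" using f by simp
  qed
next
  assume "supported f i"
  with assms show "f = compose (carrier M) f (e i)"
    by (intro extensionalityI[OF assms compose_extensional]) (simp add: compose_eq supported_def)
qed

lemma Md_simps [simp]:
  "ring.add Md \<phi> \<psi> = (\<lambda>m\<in>carrier M. \<phi> m \<oplus>\<^bsub>A\<^esub> \<psi> m)"
  "\<zero>\<^bsub>Md\<^esub> = (\<lambda>m\<in>carrier M. \<zero>\<^bsub>A\<^esub>)"
  "\<phi> \<triangleleft>\<^bsub>Md\<^esub> t = compose (carrier M) \<phi> t"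
  "a \<triangleright>\<^bsub>Md\<^esub> \<phi> = (\<lambda>m\<in>carrier M. a \<otimes>\<^bsub>A\<^esub> \<phi> m)"
  by (simp_all add: M_dag_def)

lemma Md_iff: "\<phi> \<in> carrier Md \<longleftrightarrow> \<phi> \<in> dual A M \<and> (\<exists>i. supported \<phi> i)"
  using compose_e_eq_iff[OF dualD(1)] by (auto simp: M_dag_def)

lemma Md_dual: "\<phi> \<in> carrier Md \<Longrightarrow> \<phi> \<in> dual A M"
  by (simp add: Md_iff)

lemma common_support:
  assumes "\<phi> \<in> carrier Md" "\<psi> \<in> carrier Md"
  obtains i where "supported \<phi> i" "supported \<psi> i"
proof -
  from assms obtain i j where "supported \<phi> i" "supported \<psi> j" by (auto simp: Md_iff)
  moreover obtain k where "i \<le> k" "j \<le> k" using directed by blast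
  ultimately show ?thesis using that supported_mono by blast
qed

text \<open>For colinear \<open>t\<close> this amounts to \<open>t = e\<^sub>i \<circ> t \<circ> e\<^sub>i\<close>.\<close>

definition local_endo :: "('m \<Rightarrow> 'm) \<Rightarrow> 'i \<Rightarrow> bool" where
  "local_endo t i \<longleftrightarrow> supported t i \<and> (\<forall>m\<in>carrier M. e i (t m) = t m)"

lemma comod_homD:
  assumes "t \<in> comod_hom A C M M"
  shows "t \<in> extensional (carrier M)"
    and "right_linear (carrier A) M M t"
    and "m \<in> carrier M \<Longrightarrow> t m \<in> carrier M"
    and "\<lbrakk>m \<in> carrier M; n \<in> carrier M\<rbrakk> \<Longrightarrow> t (m \<oplus>\<^bsub>M\<^esub> n) = t m \<oplus>\<^bsub>M\<^esub> t n"
    and "\<lbrakk>m \<in> carrier M; a \<in> carrier A\<rbrakk> \<Longrightarrow> t (m \<triangleleft>\<^bsub>M\<^esub> a) = t m \<triangleleft>\<^bsub>M\<^esub> a"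
    and "m \<in> carrier M \<Longrightarrow> coact M (t m) = tensor_map (carrier A) M C t id (coact M m)"
  using assms unfolding comod_hom_def is_comod_hom_def is_rmod_hom_iff
  by (auto simp: is_rmod_hom_def right_linear_def additive_map_def)

lemma local_endo_mono:
  assumes t: "t \<in> comod_hom A C M M" and i: "local_endo t i" and ij: "i \<le> j"
  shows "local_endo t j"
  unfolding local_endo_def
proof
  show "supported t j"
    using i ij supported_mono by (auto simp: local_endo_def)
  show "\<forall>m\<in>carrier M. e j (t m) = t m"
  proof
    fix m assume m: "m \<in> carrier M"
    have "e j (t m) = e j (e i (t m))" using i m by (simp add: local_endo_def)
    also have "\<dots> = e i (t m)" using e_absorb(1)[OF ij comod_homD(3)[OF t m]] .
    finally show "e j (t m) = t m" using i m by (simp add: local_endo_def)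
  qed
qed

lemma T_iff: "t \<in> T \<longleftrightarrow> t \<in> comod_hom A C M M \<and> (\<exists>i. local_endo t i)"
proof -
  have "t = compose (carrier M) (e i) (compose (carrier M) t (e i)) \<longleftrightarrow> local_endo t i"
    if t: "t \<in> comod_hom A C M M" for i
  proof -
    have "t = compose (carrier M) (e i) (compose (carrier M) t (e i))
        \<longleftrightarrow> (\<forall>m\<in>carrier M. t m = e i (t (e i m)))"
    proof
      assume "t = compose (carrier M) (e i) (compose (carrier M) t (e i))"
      then show "\<forall>m\<in>carrier M. t m = e i (t (e i m))"
        by (metis compose_eq)
    next
      assume "\<forall>m\<in>carrier M. t m = e i (t (e i m))"
      then show "t = compose (carrier M) (e i) (compose (carrier M) t (e i))"
        by (intro extensionalityI[OF comod_homD(1)[OF t] compose_extensional]) (simp add: compose_eq)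
    qed
    also have "\<dots> \<longleftrightarrow> local_endo t i"
    proof
      assume h: "\<forall>m\<in>carrier M. t m = e i (t (e i m))"
      have "t (e i m) = t m \<and> e i (t m) = t m" if m: "m \<in> carrier M" for m
        using h m e_closed[OF m] e_absorb(1)[OF order_refl m]
          e_absorb(1)[OF order_refl comod_homD(3)[OF t e_closed[OF m]]]
        by metis
      then show "local_endo t i" by (simp add: local_endo_def supported_def)
    next
      assume "local_endo t i"
      then show "\<forall>m\<in>carrier M. t m = e i (t (e i m))"
        by (simp add: local_endo_def supported_def)
    qed
    finally show ?thesis .
  qed
  then show ?thesis by (auto simp: T_dag_def)
qed

lemma T_comod_hom: "t \<in> T \<Longrightarrow> t \<in> comod_hom A C M M"
  by (simp add: T_iff)

lemma e_in_T: "e i \<in> T"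
proof -
  have "local_endo (e i) i"
    by (simp add: local_endo_def supported_def e_absorb)
  with e_comod_hom show ?thesis by (auto simp: T_iff)
qed

lemma E_simps [simp]:
  "carrier E = carrier M" "ring.add E = ring.add M" "\<zero>\<^bsub>E\<^esub> = \<zero>\<^bsub>M\<^esub>" "rsmult E = rsmult M"
  "t \<triangleright>\<^bsub>E\<^esub> m = t m"
  by (simp_all add: eval_bimod_def rmod.defs bimod.defs)

lemma Md_add_closed:
  assumes "\<phi> \<in> carrier Md" "\<psi> \<in> carrier Md"
  shows "\<phi> \<oplus>\<^bsub>Md\<^esub> \<psi> \<in> carrier Md"
proof -
  obtain i where i: "supported \<phi> i" "supported \<psi> i" by (rule common_support[OF assms])
  then have "supported (\<phi> \<oplus>\<^bsub>Md\<^esub> \<psi>) i"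
    by (simp add: supported_def e_closed)
  moreover have "\<phi> \<oplus>\<^bsub>Md\<^esub> \<psi> \<in> dual A M"
    using dualD[OF Md_dual[OF assms(1)]] dualD[OF Md_dual[OF assms(2)]]
    by (intro dualI) (simp_all add: M.ract_closed C.alg.M.a_ac C.scal.l_distr)
  ultimately show ?thesis by (auto simp: Md_iff)
qed

lemma Md_ract_closed:
  assumes "\<phi> \<in> carrier Md" "t \<in> T"
  shows "\<phi> \<triangleleft>\<^bsub>Md\<^esub> t \<in> carrier Md"
proof -
  note t = comod_homD[OF T_comod_hom[OF assms(2)]]
  from assms(2) obtain i where "supported t i" by (auto simp: T_iff local_endo_def)
  then have "supported (\<phi> \<triangleleft>\<^bsub>Md\<^esub> t) i"
    by (simp add: supported_def e_closed compose_eq)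
  moreover have "\<phi> \<triangleleft>\<^bsub>Md\<^esub> t \<in> dual A M"
    using dualD[OF Md_dual[OF assms(1)]]
    by (intro dualI) (simp_all add: compose_eq M.ract_closed t)
  ultimately show ?thesis by (auto simp: Md_iff)
qed

lemma Md_lact_closed:
  assumes "\<phi> \<in> carrier Md" "a \<in> carrier A"
  shows "a \<triangleright>\<^bsub>Md\<^esub> \<phi> \<in> carrier Md"
proof -
  from assms(1) obtain i where "supported \<phi> i" by (auto simp: Md_iff)
  then have "supported (a \<triangleright>\<^bsub>Md\<^esub> \<phi>) i"
    by (simp add: supported_def e_closed)
  moreover have "a \<triangleright>\<^bsub>Md\<^esub> \<phi> \<in> dual A M"
    using dualD[OF Md_dual[OF assms(1)]] assms(2)
    by (intro dualI) (simp_all add: M.ract_closed C.scal.r_distr C.scal.m_assoc)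
  ultimately show ?thesis by (auto simp: Md_iff)
qed

lemma Md_zero_closed: "\<zero>\<^bsub>Md\<^esub> \<in> carrier Md"
proof -
  have "supported \<zero>\<^bsub>Md\<^esub> i" for i
    by (simp add: supported_def e_closed)
  moreover have "\<zero>\<^bsub>Md\<^esub> \<in> dual A M"
    by (intro dualI) (simp_all add: M.ract_closed)
  ultimately show ?thesis by (auto simp: Md_iff)
qed

lemma Md_eqI:
  assumes "\<phi> \<in> carrier Md" "\<psi> \<in> carrier Md" and "\<And>m. m \<in> carrier M \<Longrightarrow> \<phi> m = \<psi> m"
  shows "\<phi> = \<psi>"
  using assms dualD(1)[OF Md_dual] by (intro extensionalityI[of \<phi> "carrier M"]) auto

lemma Md_apply_closed: "\<lbrakk>\<phi> \<in> carrier Md; m \<in> carrier M\<rbrakk> \<Longrightarrow> \<phi> m \<in> carrier A"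
  using dualD(2)[OF Md_dual] .

sublocale Md: left_module A Md
proof -
  have "abelian_group Md"
  proof (rule abelian_groupI)
    fix \<phi> assume \<phi>: "\<phi> \<in> carrier Md"
    \<comment> \<open>The additive inverse is taken as the multiple by \<open>-1\<close>, which is known to have local support.\<close>
    let ?\<psi> = "(\<ominus>\<^bsub>A\<^esub> \<one>\<^bsub>A\<^esub>) \<triangleright>\<^bsub>Md\<^esub> \<phi>"
    have "?\<psi> \<in> carrier Md"
      using \<phi> by (intro Md_lact_closed) simp_all
    moreover from this \<phi> have "?\<psi> \<oplus>\<^bsub>Md\<^esub> \<phi> = \<zero>\<^bsub>Md\<^esub>"
      by (intro Md_eqI Md_add_closed Md_zero_closed) (simp_all add: Md_apply_closed C.scal.l_minus C.alg.M.l_neg)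
    ultimately show "\<exists>\<psi>\<in>carrier Md. \<psi> \<oplus>\<^bsub>Md\<^esub> \<phi> = \<zero>\<^bsub>Md\<^esub>" by blast
  next
    fix \<phi> \<psi> assume c: "\<phi> \<in> carrier Md" "\<psi> \<in> carrier Md"
    then show "\<phi> \<oplus>\<^bsub>Md\<^esub> \<psi> = \<psi> \<oplus>\<^bsub>Md\<^esub> \<phi>"
      by (intro Md_eqI Md_add_closed) (simp_all add: Md_apply_closed C.alg.M.a_comm)
    fix \<chi> assume "\<chi> \<in> carrier Md"
    with c show "\<phi> \<oplus>\<^bsub>Md\<^esub> \<psi> \<oplus>\<^bsub>Md\<^esub> \<chi> = \<phi> \<oplus>\<^bsub>Md\<^esub> (\<psi> \<oplus>\<^bsub>Md\<^esub> \<chi>)"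
      by (intro Md_eqI Md_add_closed) (simp_all add: Md_apply_closed C.alg.M.a_assoc)
  next
    fix \<phi> assume "\<phi> \<in> carrier Md"
    then show "\<zero>\<^bsub>Md\<^esub> \<oplus>\<^bsub>Md\<^esub> \<phi> = \<phi>"
      by (intro Md_eqI Md_add_closed Md_zero_closed) (simp_all add: Md_apply_closed)
  qed (fact Md_add_closed Md_zero_closed)+
  then interpret Md: abelian_group Md .
  show "left_module A Md"
  proof
    fix a \<phi> \<psi>
    assume a: "a \<in> carrier A" and \<phi>: "\<phi> \<in> carrier Md" and \<psi>: "\<psi> \<in> carrier Md"
    show "a \<triangleright>\<^bsub>Md\<^esub> (\<phi> \<oplus>\<^bsub>Md\<^esub> \<psi>) = (a \<triangleright>\<^bsub>Md\<^esub> \<phi>) \<oplus>\<^bsub>Md\<^esub> (a \<triangleright>\<^bsub>Md\<^esub> \<psi>)"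
      using a \<phi> \<psi> by (intro Md_eqI Md_add_closed Md_lact_closed) (simp_all add: Md_apply_closed C.scal.r_distr)
  next
    fix a b \<phi>
    assume a: "a \<in> carrier A" and b: "b \<in> carrier A" and \<phi>: "\<phi> \<in> carrier Md"
    show "(a \<oplus>\<^bsub>A\<^esub> b) \<triangleright>\<^bsub>Md\<^esub> \<phi> = (a \<triangleright>\<^bsub>Md\<^esub> \<phi>) \<oplus>\<^bsub>Md\<^esub> (b \<triangleright>\<^bsub>Md\<^esub> \<phi>)"
      using a b \<phi> by (intro Md_eqI Md_add_closed Md_lact_closed) (simp_all add: Md_apply_closed C.scal.l_distr)
    show "(a \<otimes>\<^bsub>A\<^esub> b) \<triangleright>\<^bsub>Md\<^esub> \<phi> = a \<triangleright>\<^bsub>Md\<^esub> (b \<triangleright>\<^bsub>Md\<^esub> \<phi>)"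
      using a b \<phi> by (intro Md_eqI Md_lact_closed) (simp_all add: Md_apply_closed C.scal.m_assoc)
  next
    fix \<phi> assume "\<phi> \<in> carrier Md"
    then show "\<one>\<^bsub>A\<^esub> \<triangleright>\<^bsub>Md\<^esub> \<phi> = \<phi>"
      by (intro Md_eqI Md_lact_closed) (simp_all add: Md_apply_closed)
  qed (rule Md_lact_closed)
qed

lemma E_abelian_group: "abelian_group E"
  by (rule abelian_group_cong[OF M.ab.abelian_group_axioms]) simp_all

sublocale E: right_module A E
proof -
  interpret E: abelian_group E by (rule E_abelian_group)
  show "right_module A E"
    by unfold_locales
      (simp_all add: M.ract_closed M.ract_add_left M.ract_add_right M.ract_mult M.ract_one)
qed

sublocale ME: tensor_pair T Md E
  by unfold_locales (simp_all add: Md_ract_closed comod_homD(3)[OF T_comod_hom] del: Md_simps)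

lemma Md_lact_right_linear: "a \<in> carrier A \<Longrightarrow> right_linear T Md Md (\<lambda>\<phi>. a \<triangleright>\<^bsub>Md\<^esub> \<phi>)"
  unfolding right_linear_def
proof (intro conjI ballI Md.lact_additive Md_eqI)
  fix \<phi> t m assume "a \<in> carrier A" "\<phi> \<in> carrier Md" "t \<in> T"
  then show "a \<triangleright>\<^bsub>Md\<^esub> (\<phi> \<triangleleft>\<^bsub>Md\<^esub> t) \<in> carrier Md" "(a \<triangleright>\<^bsub>Md\<^esub> \<phi>) \<triangleleft>\<^bsub>Md\<^esub> t \<in> carrier Md"
    by (simp_all add: Md_lact_closed Md_ract_closed del: Md_simps)
  assume "m \<in> carrier M"
  then show "(a \<triangleright>\<^bsub>Md\<^esub> (\<phi> \<triangleleft>\<^bsub>Md\<^esub> t)) m = ((a \<triangleright>\<^bsub>Md\<^esub> \<phi>) \<triangleleft>\<^bsub>Md\<^esub> t) m"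
    using comod_homD(3)[OF T_comod_hom[OF \<open>t \<in> T\<close>]] by (simp add: compose_eq)
qed

lemma E_ract_left_linear: "a \<in> carrier A \<Longrightarrow> left_linear T E E (\<lambda>m. m \<triangleleft>\<^bsub>E\<^esub> a)"
  using E.ract_additive
  by (simp add: left_linear_def comod_homD(5)[OF T_comod_hom])

sublocale G: bimodule A G
  unfolding comatrix_bimod_def
  by (rule bitensor_bimodule[OF ME.tensor_pair_axioms Md.left_module_axioms E.right_module_axioms
        Md_lact_right_linear E_ract_left_linear])

sublocale GG_pair: tensor_pair "carrier A" G G
  by (rule module_tensor_pair[OF G.right_module_axioms G.left_module_axioms])

sublocale GG: bimodule A GG
  by (rule bitensor_bimodule[OF GG_pair.tensor_pair_axioms G.left_module_axioms G.right_module_axioms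
        G.lact_right_linear G.ract_left_linear])

sublocale CC_pair: tensor_pair "carrier A" C C
  by (rule module_tensor_pair[OF C.right_module_axioms Cb.left_module_axioms])

sublocale CC: bimodule A CC
  by (rule bitensor_bimodule[OF CC_pair.tensor_pair_axioms Cb.left_module_axioms C.right_module_axioms
        Cb.lact_right_linear Cb.ract_left_linear])

lemma G_simps:
  "carrier G = carrier (tensor_ab T Md E)"
  "ring.add G = ring.add (tensor_ab T Md E)"
  by (simp_all add: comatrix_bimod_def)

lemma el_eq_tens: "el = tens T Md E"
  by (simp add: comatrix_elem_def)

lemma el_closed: "\<lbrakk>\<phi> \<in> carrier Md; m \<in> carrier M\<rbrakk> \<Longrightarrow> el \<phi> m \<in> carrier G"
  using ME.tens_closed by (simp add: el_eq_tens G_simps)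

lemma el_additive_left: "m \<in> carrier M \<Longrightarrow> additive_map Md G (\<lambda>\<phi>. el \<phi> m)"
  and el_additive_right: "\<phi> \<in> carrier Md \<Longrightarrow> additive_map M G (el \<phi>)"
  using ME.additive_tens_left[of m] ME.additive_tens_right[of \<phi>]
  by (auto simp: el_eq_tens G_simps additive_map_def)

lemma el_balanced:
  "\<lbrakk>\<phi> \<in> carrier Md; t \<in> T; m \<in> carrier M\<rbrakk> \<Longrightarrow> el (\<phi> \<triangleleft>\<^bsub>Md\<^esub> t) m = el \<phi> (t m)"
  using ME.tens_balanced[of \<phi> t m] by (simp add: el_eq_tens del: Md_simps)

text \<open>The local unit \<open>e\<^sub>i\<close> lies in \<open>T\<^sup>\<dagger>\<close>, so it moves from \<open>\<phi> = \<phi> \<circ> e\<^sub>i\<close> to the other side of the tensor sign.\<close>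

lemma el_supported:
  assumes "\<phi> \<in> carrier Md" "supported \<phi> i" "m \<in> carrier M"
  shows "el \<phi> (e i m) = el \<phi> m"
proof -
  have "\<phi> \<triangleleft>\<^bsub>Md\<^esub> e i = \<phi>"
    using assms compose_e_eq_iff[of \<phi> i] dualD(1)[OF Md_dual[OF assms(1)]] by simp
  then show ?thesis
    using el_balanced[OF assms(1) e_in_T assms(3), of i] by (simp del: Md_simps)
qed

lemma el_ract:
  "\<lbrakk>\<phi> \<in> carrier Md; m \<in> carrier M; a \<in> carrier A\<rbrakk> \<Longrightarrow> el \<phi> m \<triangleleft>\<^bsub>G\<^esub> a = el \<phi> (m \<triangleleft>\<^bsub>M\<^esub> a)"
  using ME.tensor_right_module(2)[OF E.right_module_axioms E_ract_left_linear]
  by (simp add: el_eq_tens comatrix_bimod_def)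

lemma el_lact:
  "\<lbrakk>\<phi> \<in> carrier Md; m \<in> carrier M; a \<in> carrier A\<rbrakk> \<Longrightarrow> a \<triangleright>\<^bsub>G\<^esub> el \<phi> m = el (a \<triangleright>\<^bsub>Md\<^esub> \<phi>) m"
  using bitensor_left_module(2)[OF ME.tensor_pair_axioms Md.left_module_axioms Md_lact_right_linear]
  by (simp add: el_eq_tens comatrix_bimod_def del: Md_simps)

lemma G_induct [consumes 1, case_names el add]:
  assumes "x \<in> carrier G"
    and "\<And>\<phi> m. \<lbrakk>\<phi> \<in> carrier Md; m \<in> carrier M\<rbrakk> \<Longrightarrow> P (el \<phi> m)"
    and "\<And>x y. \<lbrakk>x \<in> carrier G; y \<in> carrier G; P x; P y\<rbrakk> \<Longrightarrow> P (x \<oplus>\<^bsub>G\<^esub> y)"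
  shows "P x"
  using ME.tensor_induct[of x P] assms by (simp add: el_eq_tens G_simps)

lemma additive_eq_on_G:
  assumes f: "additive_map G P f" and g: "additive_map G P g"
    and "\<And>\<phi> m. \<lbrakk>\<phi> \<in> carrier Md; m \<in> carrier M\<rbrakk> \<Longrightarrow> f (el \<phi> m) = g (el \<phi> m)" and x: "x \<in> carrier G"
  shows "f x = g x"
  using x
proof (induction x rule: G_induct)
  case (add x y)
  then show ?case by (simp only: additive_map_add[OF f] additive_map_add[OF g])
qed (rule assms(3))

lemma dual_pullback:
  assumes \<phi>: "\<phi> \<in> dual A (Ms i)"
  shows "compose (carrier M) \<phi> (\<nu>M i) \<in> carrier Md" "supported (compose (carrier M) \<phi> (\<nu>M i)) i"
proof -
  show s: "supported (compose (carrier M) \<phi> (\<nu>M i)) i"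
    by (simp add: supported_def compose_eq e_closed) (simp add: e_apply \<nu>M_\<mu>M \<nu>M_closed)
  have "compose (carrier M) \<phi> (\<nu>M i) \<in> dual A M"
    using dualD[OF \<phi>] \<nu>M_hom[of i] 
    by (intro dualI) (simp_all add: compose_eq is_comod_hom_def is_rmod_hom_def Pi_iff M.ract_closed)
  with s show "compose (carrier M) \<phi> (\<nu>M i) \<in> carrier Md" by (auto simp: Md_iff)
qed

text \<open>Every pure tensor already is one of the generators on which the structure maps of the coring are
  prescribed: factor \<open>\<phi> = (\<phi> \<circ> \<mu>\<^sub>i) \<circ> \<nu>\<^sub>i\<close> and replace \<open>m\<close> by \<open>e\<^sub>i(m) = \<mu>\<^sub>i(\<nu>\<^sub>i(m))\<close>.\<close>

lemma el_is_generator: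
  assumes \<phi>: "\<phi> \<in> carrier Md" and m: "m \<in> carrier M"
  obtains i \<psi> x where "\<psi> \<in> dual A (Ms i)" "x \<in> carrier (Ms i)"
    "el \<phi> m = el (compose (carrier M) \<psi> (\<nu>M i)) (\<mu>M i x)"
proof -
  from \<phi> obtain i where i: "supported \<phi> i" by (auto simp: Md_iff)
  interpret Mi: comodule A C "Ms i" by (rule Ms_comodule)
  define \<psi> where "\<psi> = (\<lambda>x\<in>carrier (Ms i). \<phi> (\<mu>M i x))"
  have \<psi>: "\<psi> \<in> dual A (Ms i)"
    using dualD[OF Md_dual[OF \<phi>]] \<mu>M_hom[of i] unfolding \<psi>_def
    by (intro dualI) (simp_all add: is_comod_hom_def is_rmod_hom_def Pi_iff Mi.ract_closed)
  have "compose (carrier M) \<psi> (\<nu>M i) = \<phi>"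
    using supportedD[OF i]
    by (intro Md_eqI[OF dual_pullback(1)[OF \<psi>] \<phi>]) (simp add: compose_eq \<psi>_def \<nu>M_closed e_apply)
  moreover have "el \<phi> m = el \<phi> (\<mu>M i (\<nu>M i m))"
    using el_supported[OF \<phi> i m] m by (simp add: e_apply)
  ultimately show ?thesis
    using that[OF \<psi> \<nu>M_closed[OF m]] by simp
qed

lemma additive_eq_on_generators:
  assumes f: "additive_map G P f" and g: "additive_map G P g"
    and "\<And>i \<phi> m. \<lbrakk>\<phi> \<in> dual A (Ms i); m \<in> carrier (Ms i)\<rbrakk>
      \<Longrightarrow> f (el (compose (carrier M) \<phi> (\<nu>M i)) (\<mu>M i m)) = g (el (compose (carrier M) \<phi> (\<nu>M i)) (\<mu>M i m))"
    and x: "x \<in> carrier G"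
  shows "f x = g x"
proof (rule additive_eq_on_G[OF f g _ x])
  fix \<phi> m assume "\<phi> \<in> carrier Md" "m \<in> carrier M"
  then show "f (el \<phi> m) = g (el \<phi> m)"
    by (rule el_is_generator) (simp add: assms(3))
qed


section \<open>The comultiplication of the comatrix coring\<close>

text \<open>The properties retained by a dual basis of \<open>M\<^sub>i\<close> when it is transported to \<open>M\<close> along \<open>\<mu>\<^sub>i\<close> and \<open>\<nu>\<^sub>i\<close>. Working inside \<open>M\<close> makes dual bases
  for different indices comparable.\<close>

definition local_dual_basis :: "'i \<Rightarrow> nat \<Rightarrow> (nat \<Rightarrow> 'm) \<Rightarrow> (nat \<Rightarrow> 'm \<Rightarrow> 'a) \<Rightarrow> bool" where
  "local_dual_basis i n u us \<longleftrightarrow> u \<in> {..<n} \<rightarrow> carrier M \<and> us \<in> {..<n} \<rightarrow> carrier Md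
     \<and> (\<forall>s<n. supported (us s) i)
     \<and> (\<forall>x\<in>carrier M. e i x = (\<Oplus>\<^bsub>M\<^esub>s\<in>{..<n}. u s \<triangleleft>\<^bsub>M\<^esub> us s x))"

lemma local_dual_basisD:
  assumes "local_dual_basis i n u us"
  shows "s < n \<Longrightarrow> u s \<in> carrier M" and "s < n \<Longrightarrow> us s \<in> carrier Md"
    and "s < n \<Longrightarrow> supported (us s) i"
    and "x \<in> carrier M \<Longrightarrow> e i x = (\<Oplus>\<^bsub>M\<^esub>s\<in>{..<n}. u s \<triangleleft>\<^bsub>M\<^esub> us s x)"
  using assms by (auto simp: local_dual_basis_def)

lemma local_dual_basis_of_dual_basis:
  assumes "dual_basis A (Ms i) n z zs"
  shows "local_dual_basis i n (\<lambda>s. \<mu>M i (z s)) (\<lambda>s. compose (carrier M) (zs s) (\<nu>M i))"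
  unfolding local_dual_basis_def
proof (intro conjI ballI allI impI Pi_I)
  interpret Mi: comodule A C "Ms i" by (rule Ms_comodule)
  have z: "z s \<in> carrier (Ms i)" "zs s \<in> dual A (Ms i)" if "s < n" for s
    using assms that by (auto simp: dual_basis_def)
  show "\<mu>M i (z s) \<in> carrier M" "compose (carrier M) (zs s) (\<nu>M i) \<in> carrier Md" if "s \<in> {..<n}" for s
    using z[of s] that \<mu>M_closed dual_pullback(1) by simp_all
  show "supported (compose (carrier M) (zs s) (\<nu>M i)) i" if "s < n" for s
    using z[of s] that by (simp add: dual_pullback)
  fix x assume x: "x \<in> carrier M"
  have c: "z s \<triangleleft>\<^bsub>Ms i\<^esub> zs s (\<nu>M i x) \<in> carrier (Ms i)" if "s < n" for s
    by (rule Mi.ract_closed[OF z(1)[OF that] dualD(2)[OF z(2)[OF that] \<nu>M_closed[OF x]]])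
  have \<mu>: "right_linear (carrier A) (Ms i) M (\<mu>M i)"
    using \<mu>M_hom by (simp add: is_comod_hom_def is_rmod_hom_iff)
  have "e i x = \<mu>M i (\<Oplus>\<^bsub>Ms i\<^esub>s\<in>{..<n}. z s \<triangleleft>\<^bsub>Ms i\<^esub> zs s (\<nu>M i x))"
    using assms \<nu>M_closed[OF x] by (simp add: e_apply x dual_basis_def)
  also have "\<dots> = (\<Oplus>\<^bsub>M\<^esub>s\<in>{..<n}. \<mu>M i (z s \<triangleleft>\<^bsub>Ms i\<^esub> zs s (\<nu>M i x)))"
    using \<mu> c by (intro additive_map_finsum[OF _ Mi.ab.abelian_group_axioms M.ab.abelian_group_axioms])
      (auto simp: right_linear_def)
  also have "\<dots> = (\<Oplus>\<^bsub>M\<^esub>s\<in>{..<n}. \<mu>M i (z s) \<triangleleft>\<^bsub>M\<^esub> compose (carrier M) (zs s) (\<nu>M i) x)"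
  proof (rule M.ab.finsum_cong'[OF refl])
    have zc: "zs s (\<nu>M i x) \<in> carrier A" if "s < n" for s
      by (rule dualD(2)[OF z(2)[OF that] \<nu>M_closed[OF x]])
    show "(\<lambda>s. \<mu>M i (z s) \<triangleleft>\<^bsub>M\<^esub> compose (carrier M) (zs s) (\<nu>M i) x) \<in> {..<n} \<rightarrow> carrier M"
      using z zc x by (auto simp: compose_eq intro!: M.ract_closed \<mu>M_closed)
    show "\<mu>M i (z s \<triangleleft>\<^bsub>Ms i\<^esub> zs s (\<nu>M i x)) = \<mu>M i (z s) \<triangleleft>\<^bsub>M\<^esub> compose (carrier M) (zs s) (\<nu>M i) x"
      if "s \<in> {..<n}" for s
      using \<mu> z zc x that by (simp add: right_linear_def compose_eq)
  qed
  finally show "e i x = (\<Oplus>\<^bsub>M\<^esub>s\<in>{..<n}. \<mu>M i (z s) \<triangleleft>\<^bsub>M\<^esub> compose (carrier M) (zs s) (\<nu>M i) x)" .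
qed

lemma local_dual_basis_exists: "\<exists>n u us. local_dual_basis i n u us"
  using fgp_dual_basis[OF Ms_fgp] local_dual_basis_of_dual_basis by blast

abbreviation tG (infixl "\<otimes>\<^sub>G" 70) where "x \<otimes>\<^sub>G y \<equiv> tens (carrier A) G G x y"

lemma tG_closed: "\<lbrakk>x \<in> carrier G; y \<in> carrier G\<rbrakk> \<Longrightarrow> x \<otimes>\<^sub>G y \<in> carrier GG"
  using GG_pair.tens_closed by simp

lemma tG_additive_left: "y \<in> carrier G \<Longrightarrow> additive_map G GG (\<lambda>x. x \<otimes>\<^sub>G y)"
  and tG_additive_right: "x \<in> carrier G \<Longrightarrow> additive_map G GG (\<lambda>y. x \<otimes>\<^sub>G y)"
  using GG_pair.additive_tens_left[of y] GG_pair.additive_tens_right[of x]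
  by (simp_all add: additive_map_def)

text \<open>Expand \<open>t(u\<^sub>s) = e\<^sub>l(t(u\<^sub>s))\<close> in the basis \<open>v\<close>, move the coefficients \<open>v\<^sub>r\<^sup>*(t(u\<^sub>s))\<close> across the tensor
  sign over \<open>A\<close>, and sum over \<open>s\<close> first: \<open>\<Sum>\<^sub>s v\<^sub>r\<^sup>*(t(u\<^sub>s)) u\<^sub>s\<^sup>* = v\<^sub>r\<^sup>* \<circ> t \<circ> e\<^sub>k = v\<^sub>r\<^sup>* \<circ> t\<close>.\<close>

lemma local_dual_basis_natural:
  assumes u: "local_dual_basis k n u us" and v: "local_dual_basis l p v vs" and t: "t \<in> T"
    and tk: "supported t k" and lt: "\<And>m. m \<in> carrier M \<Longrightarrow> e l (t m) = t m"
    and \<phi>: "\<phi> \<in> carrier Md" and m: "m \<in> carrier M"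
  shows "(\<Oplus>\<^bsub>GG\<^esub>s\<in>{..<n}. el \<phi> (t (u s)) \<otimes>\<^sub>G el (us s) m)
    = (\<Oplus>\<^bsub>GG\<^esub>r\<in>{..<p}. el \<phi> (v r) \<otimes>\<^sub>G el (vs r \<triangleleft>\<^bsub>Md\<^esub> t) m)"
proof -
  note th = comod_homD[OF T_comod_hom[OF t]]
  note ud = local_dual_basisD[OF u] and vd = local_dual_basisD[OF v]
  \<comment> \<open>The coefficient of \<open>t (u s)\<close> at \<open>v r\<close>.\<close>
  define a where "a r s = vs r (t (u s))" for r s
  have a: "a r s \<in> carrier A" if "r < p" "s < n" for r s
    using that by (simp add: a_def Md_apply_closed vd ud th)
  have x: "el \<phi> (v r) \<in> carrier G" if "r < p" for r
    using that by (simp add: el_closed \<phi> vd)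
  have y: "el (us s) m \<in> carrier G" if "s < n" for s
    using that by (simp add: el_closed m ud)
  have left: "el \<phi> (t (u s)) \<otimes>\<^sub>G el (us s) m
      = (\<Oplus>\<^bsub>GG\<^esub>r\<in>{..<p}. el \<phi> (v r) \<otimes>\<^sub>G (a r s \<triangleright>\<^bsub>G\<^esub> el (us s) m))" if s: "s < n" for s
  proof -
    note add = additive_map_comp[OF el_additive_right[OF \<phi>] tG_additive_left[OF y[OF s]]]
    have "t (u s) = (\<Oplus>\<^bsub>M\<^esub>r\<in>{..<p}. v r \<triangleleft>\<^bsub>M\<^esub> a r s)"
      using lt[OF ud(1)[OF s]] vd(4)[OF th(3)[OF ud(1)[OF s]]] by (simp add: a_def)
    then have "el \<phi> (t (u s)) \<otimes>\<^sub>G el (us s) m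
        = (\<Oplus>\<^bsub>GG\<^esub>r\<in>{..<p}. el \<phi> (v r \<triangleleft>\<^bsub>M\<^esub> a r s) \<otimes>\<^sub>G el (us s) m)"
      using additive_map_finsum[OF add M.ab.abelian_group_axioms GG.ab.abelian_group_axioms,
          of "{..<p}" "\<lambda>r. v r \<triangleleft>\<^bsub>M\<^esub> a r s"] s
      by (simp add: M.ract_closed vd a)
    also have "\<dots> = (\<Oplus>\<^bsub>GG\<^esub>r\<in>{..<p}. el \<phi> (v r) \<otimes>\<^sub>G (a r s \<triangleright>\<^bsub>G\<^esub> el (us s) m))"
    proof (rule GG.ab.finsum_cong'[OF refl])
      show "(\<lambda>r. el \<phi> (v r) \<otimes>\<^sub>G (a r s \<triangleright>\<^bsub>G\<^esub> el (us s) m)) \<in> {..<p} \<rightarrow> carrier GG"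
        using s by (auto intro!: tG_closed x y G.lact_closed a simp del: bitensor_simps)
      fix r assume "r \<in> {..<p}"
      then show "el \<phi> (v r \<triangleleft>\<^bsub>M\<^esub> a r s) \<otimes>\<^sub>G el (us s) m = el \<phi> (v r) \<otimes>\<^sub>G (a r s \<triangleright>\<^bsub>G\<^esub> el (us s) m)"
        using GG_pair.tens_balanced[of "el \<phi> (v r)" "a r s" "el (us s) m"] s
        by (simp add: x y a el_ract \<phi> vd)
    qed
    finally show ?thesis .
  qed
  have right: "(\<Oplus>\<^bsub>GG\<^esub>s\<in>{..<n}. el \<phi> (v r) \<otimes>\<^sub>G (a r s \<triangleright>\<^bsub>G\<^esub> el (us s) m))
      = el \<phi> (v r) \<otimes>\<^sub>G el (vs r \<triangleleft>\<^bsub>Md\<^esub> t) m" if r: "r < p" for r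
  proof -
    have c: "a r s \<triangleright>\<^bsub>Md\<^esub> us s \<in> carrier Md" if "s < n" for s
      using r that by (intro Md_lact_closed a ud)
    have sum: "(\<Oplus>\<^bsub>Md\<^esub>s\<in>{..<n}. a r s \<triangleright>\<^bsub>Md\<^esub> us s) = vs r \<triangleleft>\<^bsub>Md\<^esub> t"
    proof (rule Md_eqI)
      show "(\<Oplus>\<^bsub>Md\<^esub>s\<in>{..<n}. a r s \<triangleright>\<^bsub>Md\<^esub> us s) \<in> carrier Md"
        using c by (intro Md.ab.finsum_closed) auto
      show "vs r \<triangleleft>\<^bsub>Md\<^esub> t \<in> carrier Md"
        by (rule Md_ract_closed[OF vd(2)[OF r] t])
      fix x assume x: "x \<in> carrier M"
      have A: "abelian_group A" by (rule C.alg.M.abelian_group_axioms)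
      have ev: "additive_map Md A (\<lambda>\<psi>. \<psi> x)"
        using x by (intro additive_mapI) (simp_all add: Md_apply_closed)
      have vt: "additive_map M A (\<lambda>x. vs r (t x))"
        using dualD[OF Md_dual[OF vd(2)[OF r]]] by (intro additive_mapI) (simp_all add: th)
      have ux: "u s \<triangleleft>\<^bsub>M\<^esub> us s x \<in> carrier M" if "s < n" for s
        using that x by (simp add: M.ract_closed ud Md_apply_closed)
      have "(\<Oplus>\<^bsub>Md\<^esub>s\<in>{..<n}. a r s \<triangleright>\<^bsub>Md\<^esub> us s) x = (\<Oplus>\<^bsub>A\<^esub>s\<in>{..<n}. (a r s \<triangleright>\<^bsub>Md\<^esub> us s) x)"
        using c by (intro additive_map_finsum[OF ev Md.ab.abelian_group_axioms A]) auto
      also have "\<dots> = (\<Oplus>\<^bsub>A\<^esub>s\<in>{..<n}. vs r (t (u s \<triangleleft>\<^bsub>M\<^esub> us s x)))"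
        using x r dualD(4)[OF Md_dual[OF vd(2)[OF r]]]
        by (intro C.alg.M.finsum_cong') (auto simp: a_def th ud Md_apply_closed vd M.ract_closed)
      also have "\<dots> = vs r (t (\<Oplus>\<^bsub>M\<^esub>s\<in>{..<n}. u s \<triangleleft>\<^bsub>M\<^esub> us s x))"
        using ux by (intro additive_map_finsum[OF vt M.ab.abelian_group_axioms A, symmetric]) auto
      also have "\<dots> = (vs r \<triangleleft>\<^bsub>Md\<^esub> t) x"
        using ud(4)[OF x] supportedD[OF tk x] x by (simp add: compose_eq)
      finally show "(\<Oplus>\<^bsub>Md\<^esub>s\<in>{..<n}. a r s \<triangleright>\<^bsub>Md\<^esub> us s) x = (vs r \<triangleleft>\<^bsub>Md\<^esub> t) x" .
    qed
    note add = additive_map_comp[OF el_additive_left[OF m] tG_additive_right[OF x[OF r]]]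
    have "el \<phi> (v r) \<otimes>\<^sub>G el (vs r \<triangleleft>\<^bsub>Md\<^esub> t) m
        = (\<Oplus>\<^bsub>GG\<^esub>s\<in>{..<n}. el \<phi> (v r) \<otimes>\<^sub>G el (a r s \<triangleright>\<^bsub>Md\<^esub> us s) m)"
      unfolding sum[symmetric]
      using c by (intro additive_map_finsum[OF add Md.ab.abelian_group_axioms GG.ab.abelian_group_axioms]) auto
    also have "\<dots> = (\<Oplus>\<^bsub>GG\<^esub>s\<in>{..<n}. el \<phi> (v r) \<otimes>\<^sub>G (a r s \<triangleright>\<^bsub>G\<^esub> el (us s) m))"
    proof (rule GG.ab.finsum_cong'[OF refl])
      show "(\<lambda>s. el \<phi> (v r) \<otimes>\<^sub>G (a r s \<triangleright>\<^bsub>G\<^esub> el (us s) m)) \<in> {..<n} \<rightarrow> carrier GG"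
        using r by (auto intro!: tG_closed x y G.lact_closed a simp del: bitensor_simps)
      show "el \<phi> (v r) \<otimes>\<^sub>G el (a r s \<triangleright>\<^bsub>Md\<^esub> us s) m = el \<phi> (v r) \<otimes>\<^sub>G (a r s \<triangleright>\<^bsub>G\<^esub> el (us s) m)"
        if "s \<in> {..<n}" for s
        using that r by (simp add: el_lact ud m a del: Md_simps)
    qed
    finally show ?thesis by simp
  qed
  have c: "el \<phi> (v r) \<otimes>\<^sub>G (a r s \<triangleright>\<^bsub>G\<^esub> el (us s) m) \<in> carrier GG" if "r < p" "s < n" for r s
    using that by (intro tG_closed x y G.lact_closed a)
  have "(\<Oplus>\<^bsub>GG\<^esub>s\<in>{..<n}. el \<phi> (t (u s)) \<otimes>\<^sub>G el (us s) m)
      = (\<Oplus>\<^bsub>GG\<^esub>s\<in>{..<n}. \<Oplus>\<^bsub>GG\<^esub>r\<in>{..<p}. el \<phi> (v r) \<otimes>\<^sub>G (a r s \<triangleright>\<^bsub>G\<^esub> el (us s) m))"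
    using c left by (intro finsum_eqI[OF GG.ab.abelian_group_axioms])
      (auto intro!: GG.ab.finsum_closed simp del: bitensor_simps)
  also have "\<dots> = (\<Oplus>\<^bsub>GG\<^esub>r\<in>{..<p}. \<Oplus>\<^bsub>GG\<^esub>s\<in>{..<n}. el \<phi> (v r) \<otimes>\<^sub>G (a r s \<triangleright>\<^bsub>G\<^esub> el (us s) m))"
    using c by (intro finsum_swap[OF GG.ab.abelian_group_axioms]) (auto simp del: bitensor_simps)
  also have "\<dots> = (\<Oplus>\<^bsub>GG\<^esub>r\<in>{..<p}. el \<phi> (v r) \<otimes>\<^sub>G el (vs r \<triangleleft>\<^bsub>Md\<^esub> t) m)"
    using right Md_ract_closed[OF vd(2) t]
    by (intro finsum_eqI[OF GG.ab.abelian_group_axioms])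
      (simp_all add: tG_closed x el_closed m del: bitensor_simps Md_simps)
  finally show ?thesis .
qed

definition comult_sum ::
  "nat \<Rightarrow> (nat \<Rightarrow> 'm) \<Rightarrow> (nat \<Rightarrow> 'm \<Rightarrow> 'a) \<Rightarrow> ('m \<Rightarrow> 'a) \<Rightarrow> 'm
    \<Rightarrow> (('m, 'a) comatrix, ('m, 'a) comatrix) tens" where
  "comult_sum n u us \<phi> m = (\<Oplus>\<^bsub>GG\<^esub>s\<in>{..<n}. el \<phi> (u s) \<otimes>\<^sub>G el (us s) m)"

text \<open>For \<open>\<phi> \<in> M\<^sup>\<dagger>\<close> and \<open>m \<in> M\<close> all admissible choices give the same sum, by directedness and lemma
  \<open>comult_sum_enlarge\<close> below.\<close>

definition comult_form where
  "comult_form \<phi> m = (THE w. \<exists>i n u us. supported \<phi> i \<and> local_dual_basis i n u us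
     \<and> w = comult_sum n u us \<phi> m)"

text \<open>Naturality for \<open>t = e\<^sub>i\<close>, from the basis at \<open>j\<close> to the basis at \<open>i\<close>: on one side \<open>e\<^sub>i\<close> is absorbed by
  \<open>\<phi>\<close>, on the other side by the forms \<open>u\<^sub>r\<^sup>*\<close>.\<close>

lemma comult_sum_enlarge:
  assumes \<phi>: "\<phi> \<in> carrier Md" and m: "m \<in> carrier M" and i: "supported \<phi> i" and ij: "i \<le> j"
    and u: "local_dual_basis i n u us" and v: "local_dual_basis j p v vs"
  shows "comult_sum n u us \<phi> m = comult_sum p v vs \<phi> m"
proof -
  note ud = local_dual_basisD[OF u] and vd = local_dual_basisD[OF v]
  have ei: "supported (e i) j"
    by (simp add: supported_def e_absorb[OF ij])
  have "comult_sum p v vs \<phi> m = (\<Oplus>\<^bsub>GG\<^esub>s\<in>{..<p}. el \<phi> (e i (v s)) \<otimes>\<^sub>G el (vs s) m)"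
    unfolding comult_sum_def
    by (rule finsum_eqI[OF GG.ab.abelian_group_axioms])
      (simp_all add: tG_closed el_closed \<phi> m vd(1-3) e_closed el_supported[OF \<phi> i] del: bitensor_simps)
  also have "\<dots> = (\<Oplus>\<^bsub>GG\<^esub>r\<in>{..<n}. el \<phi> (u r) \<otimes>\<^sub>G el (us r \<triangleleft>\<^bsub>Md\<^esub> e i) m)"
    by (rule local_dual_basis_natural[OF v u e_in_T ei _ \<phi> m]) (simp add: e_absorb)
  also have "\<dots> = comult_sum n u us \<phi> m"
    unfolding comult_sum_def
    by (rule finsum_eqI[OF GG.ab.abelian_group_axioms])
      (simp_all add: tG_closed el_closed \<phi> m ud(1-3) el_balanced[OF _ e_in_T m] el_supported[OF _ _ m]
        del: bitensor_simps Md_simps)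
  finally show ?thesis by simp
qed

lemma comult_form_eq:
  assumes \<phi>: "\<phi> \<in> carrier Md" and m: "m \<in> carrier M" and i: "supported \<phi> i"
    and u: "local_dual_basis i n u us"
  shows "comult_form \<phi> m = comult_sum n u us \<phi> m"
  unfolding comult_form_def
proof (rule the_equality)
  show "\<exists>i n' u' us'. supported \<phi> i \<and> local_dual_basis i n' u' us'
      \<and> comult_sum n u us \<phi> m = comult_sum n' u' us' \<phi> m"
    using i u by blast
next
  fix w assume "\<exists>i n u us. supported \<phi> i \<and> local_dual_basis i n u us \<and> w = comult_sum n u us \<phi> m"
  then obtain j p v vs where j: "supported \<phi> j" and v: "local_dual_basis j p v vs"
    and w: "w = comult_sum p v vs \<phi> m" by blast
  obtain k where k: "i \<le> k" "j \<le> k" using directed by blast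
  obtain q z zs where z: "local_dual_basis k q z zs" using local_dual_basis_exists by blast
  show "w = comult_sum n u us \<phi> m"
    unfolding w comult_sum_enlarge[OF \<phi> m i k(1) u z] comult_sum_enlarge[OF \<phi> m j k(2) v z] ..
qed

lemma comult_sum_additive_left:
  assumes u: "local_dual_basis i n u us" and m: "m \<in> carrier M"
  shows "additive_map Md GG (\<lambda>\<phi>. comult_sum n u us \<phi> m)"
  unfolding comult_sum_def
proof (rule additive_map_sum[OF GG.ab.abelian_group_axioms Md.ab.abelian_group_axioms])
  fix s assume "s \<in> {..<n}"
  then show "additive_map Md GG (\<lambda>\<phi>. el \<phi> (u s) \<otimes>\<^sub>G el (us s) m)"
    using local_dual_basisD[OF u] m
    by (intro additive_map_comp[OF el_additive_left tG_additive_left] el_closed) auto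
qed simp

lemma comult_sum_additive_right:
  assumes u: "local_dual_basis i n u us" and \<phi>: "\<phi> \<in> carrier Md"
  shows "additive_map M GG (comult_sum n u us \<phi>)"
  unfolding comult_sum_def
proof (rule additive_map_sum[OF GG.ab.abelian_group_axioms M.ab.abelian_group_axioms])
  fix s assume "s \<in> {..<n}"
  then show "additive_map M GG (\<lambda>m. el \<phi> (u s) \<otimes>\<^sub>G el (us s) m)"
    using local_dual_basisD[OF u] \<phi>
    by (intro additive_map_comp[OF el_additive_right tG_additive_right] el_closed) auto
qed simp

lemma common_local_dual_basis:
  assumes "\<phi> \<in> carrier Md" "\<psi> \<in> carrier Md"
  obtains i n u us where "supported \<phi> i" "supported \<psi> i" "local_dual_basis i n u us"
  using common_support[OF assms] local_dual_basis_exists by metis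

text \<open>At an index that serves for \<open>\<phi>\<close>, \<open>\<phi> \<circ> t\<close> and \<open>t\<close> at once, being balanced is naturality for \<open>t\<close> with
  the same basis on both sides.\<close>

lemma comult_form_balanced: "balanced_map T Md E GG comult_form"
proof (rule balanced_mapI; (unfold E_simps)?)
  fix \<phi> m assume c: "\<phi> \<in> carrier Md" "m \<in> carrier M"
  obtain i n u us where i: "supported \<phi> i" "local_dual_basis i n u us"
    using common_local_dual_basis[OF c(1) c(1)] .
  show "comult_form \<phi> m \<in> carrier GG"
    unfolding comult_form_eq[OF c i] by (rule additive_map_closed[OF comult_sum_additive_left[OF i(2) c(2)] c(1)])
  show "comult_form \<phi> (m \<oplus>\<^bsub>M\<^esub> m') = comult_form \<phi> m \<oplus>\<^bsub>GG\<^esub> comult_form \<phi> m'" if m': "m' \<in> carrier M" for m'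
    unfolding comult_form_eq[OF c i] comult_form_eq[OF c(1) m' i]
      comult_form_eq[OF c(1) M.ab.a_closed[OF c(2) m'] i]
    by (rule additive_map_add[OF comult_sum_additive_right[OF i(2) c(1)] c(2) m'])
  fix t assume t: "t \<in> T"
  note th = comod_homD[OF T_comod_hom[OF t]]
  from t obtain j where j: "local_endo t j" by (auto simp: T_iff)
  obtain k where k: "i \<le> k" "j \<le> k" using directed by blast
  obtain p v vs where v: "local_dual_basis k p v vs" using local_dual_basis_exists by blast
  note vd = local_dual_basisD[OF v]
  have tk: "local_endo t k" by (rule local_endo_mono[OF T_comod_hom[OF t] j k(2)])
  have \<phi>t: "\<phi> \<triangleleft>\<^bsub>Md\<^esub> t \<in> carrier Md" "supported (\<phi> \<triangleleft>\<^bsub>Md\<^esub> t) k"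
    using Md_ract_closed[OF c(1) t] tk
    by (simp_all add: supported_def compose_eq e_closed local_endo_def)
  have "comult_form (\<phi> \<triangleleft>\<^bsub>Md\<^esub> t) m = (\<Oplus>\<^bsub>GG\<^esub>s\<in>{..<p}. el (\<phi> \<triangleleft>\<^bsub>Md\<^esub> t) (v s) \<otimes>\<^sub>G el (vs s) m)"
    unfolding comult_form_eq[OF \<phi>t(1) c(2) \<phi>t(2) v] comult_sum_def ..
  also have "\<dots> = (\<Oplus>\<^bsub>GG\<^esub>s\<in>{..<p}. el \<phi> (t (v s)) \<otimes>\<^sub>G el (vs s) m)"
    by (rule finsum_eqI[OF GG.ab.abelian_group_axioms])
      (simp_all add: tG_closed el_closed c vd(1-3) th el_balanced[OF c(1) t] del: bitensor_simps Md_simps)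
  also have "\<dots> = (\<Oplus>\<^bsub>GG\<^esub>r\<in>{..<p}. el \<phi> (v r) \<otimes>\<^sub>G el (vs r \<triangleleft>\<^bsub>Md\<^esub> t) m)"
    using tk by (intro local_dual_basis_natural[OF v v t _ _ c]) (simp_all add: local_endo_def)
  also have "\<dots> = comult_sum p v vs \<phi> (t m)"
    unfolding comult_sum_def
    by (rule finsum_eqI[OF GG.ab.abelian_group_axioms])
      (simp_all add: tG_closed el_closed c vd(1-3) th el_balanced[OF _ t c(2)] del: bitensor_simps Md_simps)
  also have "\<dots> = comult_form \<phi> (t m)"
    using comult_form_eq[OF c(1) th(3)[OF c(2)] supported_mono[OF i(1) k(1)] v] by simp
  finally show "comult_form (\<phi> \<triangleleft>\<^bsub>Md\<^esub> t) m = comult_form \<phi> (t m)" .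
next
  fix \<phi> \<psi> m assume c: "\<phi> \<in> carrier Md" "\<psi> \<in> carrier Md" "m \<in> carrier M"
  obtain i n u us where i: "supported \<phi> i" "supported \<psi> i" and u: "local_dual_basis i n u us"
    using common_local_dual_basis[OF c(1,2)] .
  have "supported (\<phi> \<oplus>\<^bsub>Md\<^esub> \<psi>) i" using i by (simp add: supported_def e_closed)
  from comult_form_eq[OF Md_add_closed[OF c(1,2)] c(3) this u]
  show "comult_form (\<phi> \<oplus>\<^bsub>Md\<^esub> \<psi>) m = comult_form \<phi> m \<oplus>\<^bsub>GG\<^esub> comult_form \<psi> m"
    unfolding comult_form_eq[OF c(1,3) i(1) u] comult_form_eq[OF c(2,3) i(2) u]
    using additive_map_add[OF comult_sum_additive_left[OF u c(3)] c(1,2)] by simp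
qed

lemma comult_lift_tens:
  "\<lbrakk>\<phi> \<in> carrier Md; m \<in> carrier M\<rbrakk> \<Longrightarrow> tlift GG comult_form (el \<phi> m) = comult_form \<phi> m"
  unfolding el_eq_tens
  by (rule ME.tlift_tens[OF GG.ab.abelian_group_axioms comult_form_balanced]) simp_all

lemma comult_lift_additive: "additive_map G GG (tlift GG comult_form)"
  using ME.tlift_additive[OF GG.ab.abelian_group_axioms comult_form_balanced]
  by (simp add: additive_map_def G_simps)

lemma comult_form_ract:
  assumes c: "\<phi> \<in> carrier Md" "m \<in> carrier M" and a: "a \<in> carrier A"
  shows "comult_form \<phi> (m \<triangleleft>\<^bsub>M\<^esub> a) = comult_form \<phi> m \<triangleleft>\<^bsub>GG\<^esub> a"
proof -
  obtain i n u us where i: "supported \<phi> i" "local_dual_basis i n u us"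
    using common_local_dual_basis[OF c(1) c(1)] .
  note ud = local_dual_basisD(1-3)[OF i(2)]
  have x: "el \<phi> (u s) \<in> carrier G" "el (us s) m \<in> carrier G" if "s < n" for s
    using that by (simp_all add: el_closed c ud)
  have R: "(el \<phi> (u s) \<otimes>\<^sub>G el (us s) m) \<triangleleft>\<^bsub>GG\<^esub> a = el \<phi> (u s) \<otimes>\<^sub>G el (us s) (m \<triangleleft>\<^bsub>M\<^esub> a)"
    if "s < n" for s
    using GG_pair.tensor_right_module(2)[OF G.right_module_axioms G.ract_left_linear x(1) x(2) a] that
    by (simp add: el_ract c ud a)
  have "comult_form \<phi> m \<triangleleft>\<^bsub>GG\<^esub> a = (\<Oplus>\<^bsub>GG\<^esub>s\<in>{..<n}. (el \<phi> (u s) \<otimes>\<^sub>G el (us s) m) \<triangleleft>\<^bsub>GG\<^esub> a)"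
    unfolding comult_form_eq[OF c i] comult_sum_def using x
    by (intro additive_map_finsum[OF GG.ract_additive[OF a] GG.ab.abelian_group_axioms
          GG.ab.abelian_group_axioms]) (simp_all add: tG_closed del: bitensor_simps)
  also have "\<dots> = comult_sum n u us \<phi> (m \<triangleleft>\<^bsub>M\<^esub> a)"
    unfolding comult_sum_def using c ud a
    by (intro finsum_eqI[OF GG.ab.abelian_group_axioms])
      (simp_all add: R tG_closed el_closed M.ract_closed del: bitensor_simps)
  also have "\<dots> = comult_form \<phi> (m \<triangleleft>\<^bsub>M\<^esub> a)"
    using comult_form_eq[OF c(1) M.ract_closed[OF c(2) a] i] by simp
  finally show ?thesis by simp
qed

lemma comult_form_lact:
  assumes c: "\<phi> \<in> carrier Md" "m \<in> carrier M" and a: "a \<in> carrier A"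
  shows "comult_form (a \<triangleright>\<^bsub>Md\<^esub> \<phi>) m = a \<triangleright>\<^bsub>GG\<^esub> comult_form \<phi> m"
proof -
  obtain i n u us where i: "supported \<phi> i" "local_dual_basis i n u us"
    using common_local_dual_basis[OF c(1) c(1)] .
  note ud = local_dual_basisD(1-3)[OF i(2)]
  have a\<phi>: "a \<triangleright>\<^bsub>Md\<^esub> \<phi> \<in> carrier Md" "supported (a \<triangleright>\<^bsub>Md\<^esub> \<phi>) i"
    using Md_lact_closed[OF c(1) a] i(1) by (simp_all add: supported_def e_closed)
  have x: "el \<phi> (u s) \<in> carrier G" "el (us s) m \<in> carrier G" if "s < n" for s
    using that by (simp_all add: el_closed c ud)
  have L: "a \<triangleright>\<^bsub>GG\<^esub> (el \<phi> (u s) \<otimes>\<^sub>G el (us s) m) = el (a \<triangleright>\<^bsub>Md\<^esub> \<phi>) (u s) \<otimes>\<^sub>G el (us s) m"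
    if "s < n" for s
    using bitensor_left_module(2)[OF GG_pair.tensor_pair_axioms G.left_module_axioms G.lact_right_linear x(1) x(2) a] that
    by (simp add: el_lact c ud a del: Md_simps)
  have "a \<triangleright>\<^bsub>GG\<^esub> comult_form \<phi> m = (\<Oplus>\<^bsub>GG\<^esub>s\<in>{..<n}. a \<triangleright>\<^bsub>GG\<^esub> (el \<phi> (u s) \<otimes>\<^sub>G el (us s) m))"
    unfolding comult_form_eq[OF c i] comult_sum_def using x
    by (intro additive_map_finsum[OF GG.lact_additive[OF a] GG.ab.abelian_group_axioms
          GG.ab.abelian_group_axioms]) (simp_all add: tG_closed del: bitensor_simps)
  also have "\<dots> = comult_sum n u us (a \<triangleright>\<^bsub>Md\<^esub> \<phi>) m"
    unfolding comult_sum_def using c ud a a\<phi>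
    by (intro finsum_eqI[OF GG.ab.abelian_group_axioms])
      (simp_all add: L tG_closed el_closed del: bitensor_simps Md_simps)
  also have "\<dots> = comult_form (a \<triangleright>\<^bsub>Md\<^esub> \<phi>) m"
    using comult_form_eq[OF a\<phi>(1) c(2) a\<phi>(2) i(2)] by simp
  finally show ?thesis by simp
qed

text \<open>Both sides of each linearity condition are additive on \<open>G\<close>, so pure tensors suffice to test it.\<close>

lemma linear_on_G:
  assumes f: "additive_map G P f" and P: "bimodule A P"
    and ract: "\<And>\<phi> m a. \<lbrakk>\<phi> \<in> carrier Md; m \<in> carrier M; a \<in> carrier A\<rbrakk>
      \<Longrightarrow> f (el \<phi> (m \<triangleleft>\<^bsub>M\<^esub> a)) = f (el \<phi> m) \<triangleleft>\<^bsub>P\<^esub> a"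
    and lact: "\<And>\<phi> m a. \<lbrakk>\<phi> \<in> carrier Md; m \<in> carrier M; a \<in> carrier A\<rbrakk>
      \<Longrightarrow> f (el (a \<triangleright>\<^bsub>Md\<^esub> \<phi>) m) = a \<triangleright>\<^bsub>P\<^esub> f (el \<phi> m)"
  shows "restrict f (carrier G) \<in> bimod_hom A G P"
proof (rule G.restrict_bimod_hom[OF f])
  interpret P: bimodule A P by (rule P)
  fix x a assume x: "x \<in> carrier G" and a: "a \<in> carrier A"
  show "f (x \<triangleleft>\<^bsub>G\<^esub> a) = f x \<triangleleft>\<^bsub>P\<^esub> a"
    by (rule additive_eq_on_G[OF additive_map_comp[OF G.ract_additive[OF a] f]
          additive_map_comp[OF f P.ract_additive[OF a]] _ x]) (simp add: el_ract a ract)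
  show "f (a \<triangleright>\<^bsub>G\<^esub> x) = a \<triangleright>\<^bsub>P\<^esub> f x"
    by (rule additive_eq_on_G[OF additive_map_comp[OF G.lact_additive[OF a] f]
          additive_map_comp[OF f P.lact_additive[OF a]] _ x]) (simp add: el_lact a lact del: Md_simps)
qed

lemma bimod_hom_eq_on_generators:
  assumes "f \<in> bimod_hom A G P" "g \<in> bimod_hom A G P"
    and "\<And>i \<phi> m. \<lbrakk>\<phi> \<in> dual A (Ms i); m \<in> carrier (Ms i)\<rbrakk>
      \<Longrightarrow> f (el (compose (carrier M) \<phi> (\<nu>M i)) (\<mu>M i m)) = g (el (compose (carrier M) \<phi> (\<nu>M i)) (\<mu>M i m))"
  shows "f = g"
  by (rule bimod_hom_eqI[OF assms(1,2)])
    (rule additive_eq_on_generators[OF bimod_hom_additive[OF assms(1)] bimod_hom_additive[OF assms(2)] assms(3)])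

lemma comult_restrict_hom: "restrict (tlift GG comult_form) (carrier G) \<in> bimod_hom A G GG"
  by (rule linear_on_G[OF comult_lift_additive GG.bimodule_axioms])
    (simp_all add: comult_lift_tens comult_form_ract comult_form_lact M.ract_closed Md_lact_closed del: Md_simps bitensor_simps)

text \<open>The lift has the prescribed values for every dual basis at once, because \<open>comult_form\<close> may be computed
  with any of them; no other bimodule map has these values, because the generators span \<open>G\<close>.\<close>

lemma comatrix_comult_eq:
  "comatrix_comult A C Ms M \<mu>M \<nu>M = restrict (tlift GG comult_form) (carrier G)"
  unfolding comatrix_comult_def Let_def
proof (rule the_equality; (elim conjE)?)
  let ?D = "restrict (tlift GG comult_form) (carrier G)"
  have val: "?D (el (compose (carrier M) \<phi> (\<nu>M i)) (\<mu>M i m))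
      = (\<Oplus>\<^bsub>GG\<^esub>s\<in>{..<n}. el (compose (carrier M) \<phi> (\<nu>M i)) (\<mu>M i (z s))
          \<otimes>\<^sub>G el (compose (carrier M) (zs s) (\<nu>M i)) (\<mu>M i m))"
    if "\<phi> \<in> dual A (Ms i)" "m \<in> carrier (Ms i)" "dual_basis A (Ms i) n z zs" for i \<phi> m n z zs
    using dual_pullback[OF that(1)] \<mu>M_closed[OF that(2)] local_dual_basis_of_dual_basis[OF that(3)]
    by (simp add: el_closed comult_lift_tens comult_form_eq comult_sum_def)
  then show "?D \<in> bimod_hom A G GG \<and>
      (\<forall>i. \<forall>\<phi>\<in>dual A (Ms i). \<forall>m\<in>carrier (Ms i). \<forall>n z zs. dual_basis A (Ms i) n z zs \<longrightarrow>
        ?D (el (compose (carrier M) \<phi> (\<nu>M i)) (\<mu>M i m))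
        = (\<Oplus>\<^bsub>GG\<^esub>s\<in>{..<n}. el (compose (carrier M) \<phi> (\<nu>M i)) (\<mu>M i (z s))
            \<otimes>\<^sub>G el (compose (carrier M) (zs s) (\<nu>M i)) (\<mu>M i m)))"
    using comult_restrict_hom by (intro conjI allI ballI impI)
  fix D
  assume D: "D \<in> bimod_hom A G GG"
    and vD: "\<forall>i. \<forall>\<phi>\<in>dual A (Ms i). \<forall>m\<in>carrier (Ms i). \<forall>n z zs. dual_basis A (Ms i) n z zs \<longrightarrow>
        D (el (compose (carrier M) \<phi> (\<nu>M i)) (\<mu>M i m))
        = (\<Oplus>\<^bsub>GG\<^esub>s\<in>{..<n}. el (compose (carrier M) \<phi> (\<nu>M i)) (\<mu>M i (z s))
            \<otimes>\<^sub>G el (compose (carrier M) (zs s) (\<nu>M i)) (\<mu>M i m))"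
  show "D = ?D"
  proof (rule bimod_hom_eq_on_generators[OF D comult_restrict_hom])
    fix i \<phi> m assume c: "\<phi> \<in> dual A (Ms i)" "m \<in> carrier (Ms i)"
    obtain n z zs where z: "dual_basis A (Ms i) n z zs" using fgp_dual_basis[OF Ms_fgp] by blast
    show "D (el (compose (carrier M) \<phi> (\<nu>M i)) (\<mu>M i m)) = ?D (el (compose (carrier M) \<phi> (\<nu>M i)) (\<mu>M i m))"
      unfolding vD[rule_format, OF c z] val[OF c z] ..
  qed
qed

lemma comatrix_comult_el:
  assumes "\<phi> \<in> carrier Md" "m \<in> carrier M" "supported \<phi> i" "local_dual_basis i n u us"
  shows "comatrix_comult A C Ms M \<mu>M \<nu>M (el \<phi> m)
    = (\<Oplus>\<^bsub>GG\<^esub>s\<in>{..<n}. el \<phi> (u s) \<otimes>\<^sub>G el (us s) m)"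
  using assms by (simp add: comatrix_comult_eq el_closed comult_lift_tens comult_form_eq comult_sum_def)


section \<open>The counit of the comatrix coring\<close>

lemma regular_bimodule: "bimodule A (regular_bimod A)"
proof -
  interpret R: abelian_group "regular_bimod A"
    by (rule regular_bimod_abelian_group[OF C.scal.ring_axioms])
  show ?thesis
    by unfold_locales (simp_all add: C.scal.l_distr C.scal.r_distr C.scal.m_assoc)
qed

interpretation reg: bimodule A "regular_bimod A" by (rule regular_bimodule)

lemma evaluation_balanced: "balanced_map T Md E (regular_bimod A) (\<lambda>\<phi> m. \<phi> m)"
  by (rule balanced_mapI)
    (simp_all add: Md_apply_closed dualD(3)[OF Md_dual] compose_eq)

abbreviation "evaluation \<equiv> tlift (regular_bimod A) (\<lambda>\<phi> m. \<phi> m)"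

lemma evaluation_el: "\<lbrakk>\<phi> \<in> carrier Md; m \<in> carrier M\<rbrakk> \<Longrightarrow> evaluation (el \<phi> m) = \<phi> m"
  unfolding el_eq_tens
  by (rule ME.tlift_tens[OF reg.ab.abelian_group_axioms evaluation_balanced]) simp_all

lemma evaluation_additive: "additive_map G (regular_bimod A) evaluation"
  using ME.tlift_additive[OF reg.ab.abelian_group_axioms evaluation_balanced]
  by (simp add: additive_map_def G_simps)

lemma evaluation_hom: "restrict evaluation (carrier G) \<in> bimod_hom A G (regular_bimod A)"
proof (rule linear_on_G[OF evaluation_additive regular_bimodule])
  fix \<phi> m a assume c: "\<phi> \<in> carrier Md" "m \<in> carrier M" and a: "a \<in> carrier A"
  show "evaluation (el \<phi> (m \<triangleleft>\<^bsub>M\<^esub> a)) = evaluation (el \<phi> m) \<triangleleft>\<^bsub>regular_bimod A\<^esub> a"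
    using c a by (simp add: evaluation_el M.ract_closed dualD(4)[OF Md_dual])
  show "evaluation (el (a \<triangleright>\<^bsub>Md\<^esub> \<phi>) m) = a \<triangleright>\<^bsub>regular_bimod A\<^esub> evaluation (el \<phi> m)"
    using evaluation_el[OF Md_lact_closed[OF c(1) a] c(2)] c by (simp add: evaluation_el)
qed

lemma comatrix_counit_eq:
  "comatrix_counit A C Ms M \<mu>M \<nu>M = restrict evaluation (carrier G)"
  unfolding comatrix_counit_def
proof (rule the_equality; (elim conjE)?)
  have val: "restrict evaluation (carrier G) (el (compose (carrier M) \<phi> (\<nu>M i)) (\<mu>M i m)) = \<phi> m"
    if "\<phi> \<in> dual A (Ms i)" "m \<in> carrier (Ms i)" for i \<phi> m
    using dual_pullback[OF that(1)] \<mu>M_closed[OF that(2)] that(2)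
    by (simp add: el_closed evaluation_el compose_eq \<nu>M_\<mu>M)
  then show "restrict evaluation (carrier G) \<in> bimod_hom A G (regular_bimod A) \<and>
      (\<forall>i. \<forall>\<phi>\<in>dual A (Ms i). \<forall>m\<in>carrier (Ms i).
        restrict evaluation (carrier G) (el (compose (carrier M) \<phi> (\<nu>M i)) (\<mu>M i m)) = \<phi> m)"
    using evaluation_hom by (intro conjI allI ballI)
  fix \<epsilon>
  assume \<epsilon>: "\<epsilon> \<in> bimod_hom A G (regular_bimod A)"
    and "\<forall>i. \<forall>\<phi>\<in>dual A (Ms i). \<forall>m\<in>carrier (Ms i).
        \<epsilon> (el (compose (carrier M) \<phi> (\<nu>M i)) (\<mu>M i m)) = \<phi> m"
  with val show "\<epsilon> = restrict evaluation (carrier G)"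
    by (intro bimod_hom_eq_on_generators[OF \<epsilon> evaluation_hom]) simp
qed

lemma comatrix_counit_el:
  "\<lbrakk>\<phi> \<in> carrier Md; m \<in> carrier M\<rbrakk> \<Longrightarrow> comatrix_counit A C Ms M \<mu>M \<nu>M (el \<phi> m) = \<phi> m"
  by (simp add: comatrix_counit_eq el_closed evaluation_el)


section \<open>The canonical map\<close>

lemma MC_pair: "tensor_pair (carrier A) M C"
  by (rule module_tensor_pair[OF M.right_module_axioms Cb.left_module_axioms])

lemma MC_right_module: "right_module A (tensor (carrier A) M C)"
  by (rule tensor_pair.tensor_right_module(1)[OF MC_pair C.right_module_axioms Cb.ract_left_linear])

lemma MCC_pair: "tensor_pair (carrier A) (tensor (carrier A) M C) C"
  by (rule module_tensor_pair[OF MC_right_module Cb.left_module_axioms])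

lemma M_CC_pair: "tensor_pair (carrier A) M CC"
  by (rule module_tensor_pair[OF M.right_module_axioms CC.left_module_axioms])

lemma coact_right_linear: "right_linear (carrier A) M (tensor (carrier A) M C) (coact M)"
  using M.coact_hom by (simp add: is_rmod_hom_iff)

lemma coact_additive: "additive_map M (tensor_ab (carrier A) M C) (coact M)"
  and coact_ract: "\<lbrakk>m \<in> carrier M; a \<in> carrier A\<rbrakk>
    \<Longrightarrow> coact M (m \<triangleleft>\<^bsub>M\<^esub> a) = coact M m \<triangleleft>\<^bsub>tensor (carrier A) M C\<^esub> a"
  using coact_right_linear by (simp_all add: right_linear_def additive_map_def)

lemmas coact_closed = additive_map_closed[OF coact_additive]

lemmas contract_M_additive = contract_additive[OF M.right_module_axioms Cb.left_module_axioms]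
lemmas contract_M_tens = contract_tens[OF M.right_module_axioms Cb.left_module_axioms]

text \<open>This is \<open>\<phi>(m\<^sub>0) m\<^sub>1\<close>.\<close>

definition can_form :: "('m \<Rightarrow> 'a) \<Rightarrow> 'm \<Rightarrow> 'c" where
  "can_form \<phi> m = contract C \<phi> (coact M m)"

lemma can_form_additive: "\<phi> \<in> dual A M \<Longrightarrow> additive_map M C (can_form \<phi>)"
  unfolding can_form_def using additive_map_comp[OF coact_additive contract_M_additive] .

lemma can_form_ract:
  "\<lbrakk>\<phi> \<in> dual A M; m \<in> carrier M; a \<in> carrier A\<rbrakk> \<Longrightarrow> can_form \<phi> (m \<triangleleft>\<^bsub>M\<^esub> a) = can_form \<phi> m \<triangleleft>\<^bsub>C\<^esub> a"
  by (simp add: can_form_def coact_ract coact_closed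
      contract_right_linear[OF M.right_module_axioms Cb.bimodule_axioms])

lemma can_form_lact:
  "\<lbrakk>\<phi> \<in> carrier Md; m \<in> carrier M; a \<in> carrier A\<rbrakk>
    \<Longrightarrow> can_form (a \<triangleright>\<^bsub>Md\<^esub> \<phi>) m = a \<triangleright>\<^bsub>C\<^esub> can_form \<phi> m"
  unfolding can_form_def
  by (rule contract_smult_form[OF M.right_module_axioms Cb.left_module_axioms Md_dual Md_dual[OF Md_lact_closed]])
    (simp_all add: coact_closed)

text \<open>Colinearity of \<open>t\<close> says \<open>t(m)\<^sub>0 \<otimes> t(m)\<^sub>1 = t(m\<^sub>0) \<otimes> m\<^sub>1\<close>.\<close>

lemma can_form_endo:
  assumes "\<phi> \<in> carrier Md" "t \<in> T" "m \<in> carrier M"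
  shows "can_form (\<phi> \<triangleleft>\<^bsub>Md\<^esub> t) m = can_form \<phi> (t m)"
proof -
  note th = comod_homD[OF T_comod_hom[OF assms(2)]]
  show ?thesis
    unfolding can_form_def th(6)[OF assms(3)]
    by (rule contract_tensor_map[OF M.right_module_axioms Cb.left_module_axioms M.right_module_axioms
          th(2) Md_dual[OF assms(1)] Md_dual[OF Md_ract_closed[OF assms(1,2)]] _ coact_closed[OF assms(3)],
          symmetric]) (simp add: compose_eq)
qed

lemma can_form_balanced: "balanced_map T Md E C can_form"
proof (rule balanced_mapI; (unfold E_simps)?)
  fix \<phi> m assume c: "\<phi> \<in> carrier Md" "m \<in> carrier M"
  show "can_form \<phi> m \<in> carrier C"
    by (rule additive_map_closed[OF can_form_additive[OF Md_dual[OF c(1)]] c(2)])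
  show "can_form \<phi> (m \<oplus>\<^bsub>M\<^esub> m') = can_form \<phi> m \<oplus>\<^bsub>C\<^esub> can_form \<phi> m'" if "m' \<in> carrier M" for m'
    by (rule additive_map_add[OF can_form_additive[OF Md_dual[OF c(1)]] c(2) that])
  show "can_form (\<phi> \<triangleleft>\<^bsub>Md\<^esub> t) m = can_form \<phi> (t m)" if "t \<in> T" for t
    by (rule can_form_endo[OF c(1) that c(2)])
next
  fix \<phi> \<psi> m assume c: "\<phi> \<in> carrier Md" "\<psi> \<in> carrier Md" "m \<in> carrier M"
  show "can_form (\<phi> \<oplus>\<^bsub>Md\<^esub> \<psi>) m = can_form \<phi> m \<oplus>\<^bsub>C\<^esub> can_form \<psi> m"
    unfolding can_form_def
    by (rule contract_add_form[OF M.right_module_axioms Cb.left_module_axioms Md_dual[OF c(1)]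
          Md_dual[OF c(2)] Md_dual[OF Md_add_closed[OF c(1,2)]]]) (simp_all add: coact_closed c(3))
qed

abbreviation "can_map \<equiv> restrict (tlift C can_form) (carrier G)"

lemma can_map_el: "\<lbrakk>\<phi> \<in> carrier Md; m \<in> carrier M\<rbrakk> \<Longrightarrow> can_map (el \<phi> m) = can_form \<phi> m"
  using ME.tlift_tens[OF C.ab.abelian_group_axioms can_form_balanced, of \<phi> m] el_closed[of \<phi> m]
  by (simp add: el_eq_tens)

lemma can_map_hom: "can_map \<in> bimod_hom A G C"
proof (rule linear_on_G[OF _ Cb.bimodule_axioms])
  show "additive_map G C (tlift C can_form)"
    using ME.tlift_additive[OF C.ab.abelian_group_axioms can_form_balanced]
    by (simp add: additive_map_def G_simps)
  have v: "tlift C can_form (el \<phi> m) = can_form \<phi> m" if "\<phi> \<in> carrier Md" "m \<in> carrier M" for \<phi> m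
    using can_map_el[OF that] el_closed[OF that] by simp
  fix \<phi> m a assume c: "\<phi> \<in> carrier Md" "m \<in> carrier M" and a: "a \<in> carrier A"
  show "tlift C can_form (el \<phi> (m \<triangleleft>\<^bsub>M\<^esub> a)) = tlift C can_form (el \<phi> m) \<triangleleft>\<^bsub>C\<^esub> a"
    using c a by (simp add: v M.ract_closed can_form_ract Md_dual)
  show "tlift C can_form (el (a \<triangleright>\<^bsub>Md\<^esub> \<phi>) m) = a \<triangleright>\<^bsub>C\<^esub> tlift C can_form (el \<phi> m)"
    using c a by (simp add: v Md_lact_closed can_form_lact del: Md_simps)
qed

text \<open>By linearity \<open>\<epsilon>(\<phi>(m\<^sub>0) m\<^sub>1) = \<phi>(m\<^sub>0) \<epsilon>(m\<^sub>1) = \<phi>(m\<^sub>0 \<epsilon>(m\<^sub>1))\<close>, and \<open>m\<^sub>0 \<epsilon>(m\<^sub>1) = m\<close> is the counit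
  axiom of the comodule.\<close>

lemma counit_can_form:
  assumes \<phi>: "\<phi> \<in> dual A M" and m: "m \<in> carrier M"
  shows "counit C (can_form \<phi> m) = \<phi> m"
proof -
  have \<epsilon>: "additive_map C (regular_bimod A) (counit C)"
    and \<epsilon>l: "\<And>a c. \<lbrakk>a \<in> carrier A; c \<in> carrier C\<rbrakk> \<Longrightarrow> counit C (a \<triangleright>\<^bsub>C\<^esub> c) = a \<otimes>\<^bsub>A\<^esub> counit C c"
    and \<epsilon>c: "\<And>c. c \<in> carrier C \<Longrightarrow> counit C c \<in> carrier A"
    using C.counit_hom by (auto simp: is_bimod_hom_iff left_linear_def additive_map_def)
  have b: "balanced_map (carrier A) M C M (\<lambda>x c. x \<triangleleft>\<^bsub>M\<^esub> counit C c)"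
    using additive_map_add[OF \<epsilon>]
    by (intro balanced_mapI) (simp_all add: \<epsilon>c \<epsilon>l M.ract_closed M.ract_add_left M.ract_add_right M.ract_mult)
  have \<phi>a: "additive_map M (regular_bimod A) \<phi>"
    using \<phi> by (simp add: dual_iff right_linear_def)
  note l = additive_map_comp[OF contract_M_additive[OF \<phi>] \<epsilon>]
    and r = additive_map_comp[OF tensor_pair.tlift_additive[OF MC_pair M.ab.abelian_group_axioms b] \<phi>a]
  have "counit C (can_form \<phi> m) = \<phi> (tlift M (\<lambda>x c. x \<triangleleft>\<^bsub>M\<^esub> counit C c) (coact M m))"
    unfolding can_form_def
    by (rule tensor_pair.additive_maps_eqI[OF MC_pair l r _ coact_closed[OF m]])
      (simp add: contract_M_tens[OF \<phi>] tensor_pair.tlift_tens[OF MC_pair M.ab.abelian_group_axioms b]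
        \<epsilon>l \<epsilon>c dualD[OF \<phi>])
  then show ?thesis
    using M.coact_counit[OF m] by simp
qed

lemma comult_contract:
  assumes \<phi>: "\<phi> \<in> dual A M" and t: "t \<in> carrier (tensor_ab (carrier A) M C)"
  shows "comult C (contract C \<phi> t) = contract CC \<phi> (tensor_map (carrier A) M CC id (comult C) t)"
proof -
  have \<Delta>: "left_linear (carrier A) C CC (comult C)"
    using C.comult_hom by (simp add: is_bimod_hom_iff)
  then have \<Delta>': "additive_map C CC (comult C)" by (simp add: left_linear_def)
  note CC_tens = contract_tens[OF M.right_module_axioms CC.left_module_axioms \<phi>]
  show ?thesis
    by (rule tensor_pair.additive_maps_eqI[OF MC_pair additive_map_comp[OF contract_M_additive[OF \<phi>] \<Delta>']
          additive_map_comp[OF tensor_map_additive[OF MC_pair M_CC_pair right_linear_id \<Delta>]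
            contract_additive[OF M.right_module_axioms CC.left_module_axioms \<phi>]] _ t])
      (simp add: contract_M_tens[OF \<phi>] tensor_map_tens[OF MC_pair M_CC_pair right_linear_id \<Delta>]
        CC_tens additive_map_closed[OF \<Delta>'] dualD(2)[OF \<phi>] \<Delta>[unfolded left_linear_def] del: bitensor_simps)
qed

lemma can_form_right_linear: "\<phi> \<in> dual A M \<Longrightarrow> right_linear (carrier A) M C (can_form \<phi>)"
  by (simp add: right_linear_def can_form_additive can_form_ract)

text \<open>By coassociativity \<open>\<phi>(m\<^sub>0) \<Delta>(m\<^sub>1) = \<phi>(m\<^sub>0\<^sub>0) m\<^sub>0\<^sub>1 \<otimes> m\<^sub>1\<close>.\<close>

lemma comult_can_form:
  assumes \<phi>: "\<phi> \<in> dual A M" and m: "m \<in> carrier M"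
  shows "comult C (can_form \<phi> m) = tensor_map (carrier A) C C (can_form \<phi>) id (coact M m)"
proof -
  note rm = M.right_module_axioms
  have lin: "right_linear (carrier A) (tensor (carrier A) M C) C (contract C \<phi>)"
    using contract_M_additive[OF \<phi>] contract_right_linear[OF rm Cb.bimodule_axioms \<phi>]
    by (simp add: right_linear_def additive_map_def)
  note coact_map = tensor_map_additive[OF MC_pair MCC_pair coact_right_linear left_linear_id]
  have "comult C (can_form \<phi> m)
      = contract CC \<phi> (tensor_assoc (carrier A) (carrier A) M C C
          (tensor_map (carrier A) (tensor (carrier A) M C) C (coact M) id (coact M m)))"
    unfolding can_form_def comult_contract[OF \<phi> coact_closed[OF m]] M.coact_coassoc[OF m] ..
  also have "\<dots> = tensor_map (carrier A) C C (contract C \<phi>) id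
      (tensor_map (carrier A) (tensor (carrier A) M C) C (coact M) id (coact M m))"
    by (rule contract_tensor_assoc[OF rm Cb.bimodule_axioms \<phi>
          additive_map_closed[OF coact_map coact_closed[OF m]]])
  also have "\<dots> = tensor_map (carrier A) C C (can_form \<phi>) id (coact M m)"
    by (rule tensor_map_comp[OF MC_pair MCC_pair CC_pair.tensor_pair_axioms coact_right_linear
          left_linear_id lin left_linear_id can_form_right_linear[OF \<phi>] left_linear_id _ _ coact_closed[OF m]])
      (simp_all add: can_form_def)
  finally show ?thesis .
qed

text \<open>For a pure tensor \<open>x \<otimes> c\<close> replace \<open>x\<close> by \<open>e\<^sub>i(x) = \<Sum> u\<^sub>s u\<^sub>s\<^sup>*(x)\<close>, which does not change
  \<open>can(\<phi> \<otimes> x)\<close> as \<open>\<phi> = \<phi> \<circ> e\<^sub>i\<close>, and move the scalars \<open>u\<^sub>s\<^sup>*(x)\<close> to \<open>c\<close>.\<close>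

lemma can_form_expand:
  assumes \<phi>: "\<phi> \<in> carrier Md" and i: "supported \<phi> i" and u: "local_dual_basis i n u us"
    and t: "t \<in> carrier (tensor_ab (carrier A) M C)"
  shows "tensor_map (carrier A) C C (can_form \<phi>) id t
    = (\<Oplus>\<^bsub>CC\<^esub>s\<in>{..<n}. tens (carrier A) C C (can_form \<phi> (u s)) (contract C (us s) t))"
proof (rule tensor_pair.additive_maps_eqI[OF MC_pair _ _ _ t, where P = CC])
  note ud = local_dual_basisD[OF u]
  note lin = can_form_right_linear[OF Md_dual[OF \<phi>]]
  note cl = additive_map_closed[OF can_form_additive[OF Md_dual[OF \<phi>]]]
  interpret MC: tensor_pair "carrier A" M C by (rule MC_pair)
  have tl: "additive_map C CC (\<lambda>x. tens (carrier A) C C x y)" if "y \<in> carrier C" for y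
    using CC_pair.additive_tens_left[OF that] by (simp add: additive_map_def)
  have tr: "additive_map C CC (tens (carrier A) C C x)" if "x \<in> carrier C" for x
    using CC_pair.additive_tens_right[OF that] by (simp add: additive_map_def)
  show "additive_map (tensor_ab (carrier A) M C) CC (tensor_map (carrier A) C C (can_form \<phi>) id)"
    using tensor_map_additive[OF MC_pair CC_pair.tensor_pair_axioms lin left_linear_id]
    by (simp add: additive_map_def)
  show "additive_map (tensor_ab (carrier A) M C) CC
      (\<lambda>t. \<Oplus>\<^bsub>CC\<^esub>s\<in>{..<n}. tens (carrier A) C C (can_form \<phi> (u s)) (contract C (us s) t))"
  proof (rule additive_map_sum[OF CC.ab.abelian_group_axioms MC.tensor_ab_abelian_group])
    fix s assume "s \<in> {..<n}"
    then have s: "s < n" by simp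
    show "additive_map (tensor_ab (carrier A) M C) CC
        (\<lambda>t. tens (carrier A) C C (can_form \<phi> (u s)) (contract C (us s) t))"
      by (rule additive_map_comp[OF contract_M_additive[OF Md_dual[OF ud(2)[OF s]]] tr[OF cl[OF ud(1)[OF s]]]])
  qed simp
  fix x c assume x: "x \<in> carrier M" and c: "c \<in> carrier C"
  \<comment> \<open>Everything is additive in the left factor, so the sum for \<open>e i x\<close> can be taken outside.\<close>
  note add = additive_map_comp[OF can_form_additive[OF Md_dual[OF \<phi>]] tl[OF c]]
  have ux: "u s \<triangleleft>\<^bsub>M\<^esub> us s x \<in> carrier M" if "s < n" for s
    using that x by (simp add: M.ract_closed ud Md_apply_closed)
  have "can_form \<phi> x = can_form \<phi> (e i x)"
  proof -
    have "\<phi> \<triangleleft>\<^bsub>Md\<^esub> e i = \<phi>"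
      using compose_e_eq_iff[OF dualD(1)[OF Md_dual[OF \<phi>]], of i] i by simp
    then show ?thesis
      using can_form_endo[OF \<phi> e_in_T x, of i] by simp
  qed
  then have "tensor_map (carrier A) C C (can_form \<phi>) id (tens (carrier A) M C x c)
      = tens (carrier A) C C (can_form \<phi> (\<Oplus>\<^bsub>M\<^esub>s\<in>{..<n}. u s \<triangleleft>\<^bsub>M\<^esub> us s x)) c"
    using x c ud(4)[OF x]
    by (simp add: tensor_map_tens[OF MC_pair CC_pair.tensor_pair_axioms lin left_linear_id])
  also have "\<dots> = (\<Oplus>\<^bsub>CC\<^esub>s\<in>{..<n}. tens (carrier A) C C (can_form \<phi> (u s \<triangleleft>\<^bsub>M\<^esub> us s x)) c)"
    using ux by (intro additive_map_finsum[OF add M.ab.abelian_group_axioms CC.ab.abelian_group_axioms]) auto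
  also have "\<dots> = (\<Oplus>\<^bsub>CC\<^esub>s\<in>{..<n}. tens (carrier A) C C (can_form \<phi> (u s))
      (contract C (us s) (tens (carrier A) M C x c)))"
  proof (rule finsum_eqI[OF CC.ab.abelian_group_axioms])
    fix s assume "s \<in> {..<n}"
    then have s: "s < n" by simp
    have a: "us s x \<in> carrier A" by (rule Md_apply_closed[OF ud(2)[OF s] x])
    have ct: "contract C (us s) (tens (carrier A) M C x c) = us s x \<triangleright>\<^bsub>C\<^esub> c"
      by (rule contract_M_tens[OF Md_dual[OF ud(2)[OF s]] x c])
    show "tens (carrier A) C C (can_form \<phi> (u s \<triangleleft>\<^bsub>M\<^esub> us s x)) c
        = tens (carrier A) C C (can_form \<phi> (u s)) (contract C (us s) (tens (carrier A) M C x c))"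
      unfolding ct can_form_ract[OF Md_dual[OF \<phi>] ud(1)[OF s] a]
      by (rule CC_pair.tens_balanced[OF cl[OF ud(1)[OF s]] a c])
    show "tens (carrier A) C C (can_form \<phi> (u s)) (contract C (us s) (tens (carrier A) M C x c)) \<in> carrier CC"
      unfolding ct using CC_pair.tens_closed[OF cl[OF ud(1)[OF s]] Cb.lact_closed[OF a c]] by simp
  qed
  finally show "tensor_map (carrier A) C C (can_form \<phi>) id (tens (carrier A) M C x c)
      = (\<Oplus>\<^bsub>CC\<^esub>s\<in>{..<n}. tens (carrier A) C C (can_form \<phi> (u s))
          (contract C (us s) (tens (carrier A) M C x c)))" .
qed

text \<open>On \<open>\<phi> \<otimes> m\<close> both sides equal \<open>\<Sum> can(\<phi> \<otimes> u\<^sub>s) \<otimes> can(u\<^sub>s\<^sup>* \<otimes> m)\<close>: the right side by the formula for the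
  comultiplication of \<open>G\<close>, the left side by lemmas \<open>comult_can_form\<close> and \<open>can_form_expand\<close>.\<close>

lemma comult_can_map:
  assumes x: "x \<in> carrier G"
  shows "comult C (can_map x)
    = tensor_map (carrier A) C C can_map can_map (comatrix_comult A C Ms M \<mu>M \<nu>M x)"
proof (rule additive_eq_on_G[OF _ _ _ x])
  have \<Delta>: "additive_map C CC (comult C)"
    using C.comult_hom by (simp add: is_bimod_hom_iff left_linear_def)
  have can: "right_linear (carrier A) G C can_map" "left_linear (carrier A) G C can_map"
    using can_map_hom by (simp_all add: bimod_hom_def is_bimod_hom_iff)
  note cc = tensor_map_tens[OF GG_pair.tensor_pair_axioms CC_pair.tensor_pair_axioms can]
  have cca: "additive_map GG CC (tensor_map (carrier A) C C can_map can_map)"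
    using tensor_map_additive[OF GG_pair.tensor_pair_axioms CC_pair.tensor_pair_axioms can]
    by (simp add: additive_map_def)
  have \<Delta>G: "additive_map G GG (comatrix_comult A C Ms M \<mu>M \<nu>M)"
    unfolding comatrix_comult_eq by (rule bimod_hom_additive[OF comult_restrict_hom])
  show "additive_map G CC (\<lambda>x. comult C (can_map x))"
    by (rule additive_map_comp[OF bimod_hom_additive[OF can_map_hom] \<Delta>])
  show "additive_map G CC (\<lambda>x. tensor_map (carrier A) C C can_map can_map (comatrix_comult A C Ms M \<mu>M \<nu>M x))"
    by (rule additive_map_comp[OF \<Delta>G cca])
  fix \<phi> m assume c: "\<phi> \<in> carrier Md" "m \<in> carrier M"
  obtain i n u us where i: "supported \<phi> i" and u: "local_dual_basis i n u us"
    using common_local_dual_basis[OF c(1) c(1)] .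
  note ud = local_dual_basisD(1-3)[OF u]
  note cl = additive_map_closed[OF can_form_additive[OF Md_dual]]
  have "tensor_map (carrier A) C C can_map can_map (comatrix_comult A C Ms M \<mu>M \<nu>M (el \<phi> m))
      = (\<Oplus>\<^bsub>CC\<^esub>s\<in>{..<n}. tensor_map (carrier A) C C can_map can_map (el \<phi> (u s) \<otimes>\<^sub>G el (us s) m))"
    unfolding comatrix_comult_el[OF c i u]
    by (rule additive_map_finsum[OF cca GG.ab.abelian_group_axioms CC.ab.abelian_group_axioms])
      (simp_all add: tG_closed el_closed c ud del: bitensor_simps)
  also have "\<dots> = (\<Oplus>\<^bsub>CC\<^esub>s\<in>{..<n}. tens (carrier A) C C (can_form \<phi> (u s)) (can_form (us s) m))"
  proof (rule finsum_eqI[OF CC.ab.abelian_group_axioms])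
    fix s assume "s \<in> {..<n}"
    then have s: "s < n" by simp
    show "tensor_map (carrier A) C C can_map can_map (el \<phi> (u s) \<otimes>\<^sub>G el (us s) m)
        = tens (carrier A) C C (can_form \<phi> (u s)) (can_form (us s) m)"
      using cc[OF el_closed[OF c(1) ud(1)[OF s]] el_closed[OF ud(2)[OF s] c(2)]]
        can_map_el[OF c(1) ud(1)[OF s]] can_map_el[OF ud(2)[OF s] c(2)] by simp
    show "tens (carrier A) C C (can_form \<phi> (u s)) (can_form (us s) m) \<in> carrier CC"
      using CC_pair.tens_closed[OF cl[OF c(1) ud(1)[OF s]] cl[OF ud(2)[OF s] c(2)]] by simp
  qed
  also have "\<dots> = comult C (can_map (el \<phi> m))"
    unfolding can_map_el[OF c] comult_can_form[OF Md_dual[OF c(1)] c(2)]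
      can_form_expand[OF c(1) i u coact_closed[OF c(2)]] by (simp add: can_form_def)
  finally show "comult C (can_map (el \<phi> m))
      = tensor_map (carrier A) C C can_map can_map (comatrix_comult A C Ms M \<mu>M \<nu>M (el \<phi> m))" by simp
qed

lemma counit_can_map:
  assumes x: "x \<in> carrier G"
  shows "counit C (can_map x) = comatrix_counit A C Ms M \<mu>M \<nu>M x"
proof (rule additive_eq_on_G[OF _ _ _ x])
  have \<epsilon>: "additive_map C (regular_bimod A) (counit C)"
    using C.counit_hom by (simp add: is_bimod_hom_iff left_linear_def)
  show "additive_map G (regular_bimod A) (\<lambda>x. counit C (can_map x))"
    by (rule additive_map_comp[OF bimod_hom_additive[OF can_map_hom] \<epsilon>])
  show "additive_map G (regular_bimod A) (comatrix_counit A C Ms M \<mu>M \<nu>M)"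
    unfolding comatrix_counit_eq by (rule bimod_hom_additive[OF evaluation_hom])
  fix \<phi> m assume "\<phi> \<in> carrier Md" "m \<in> carrier M"
  then show "counit C (can_map (el \<phi> m)) = comatrix_counit A C Ms M \<mu>M \<nu>M (el \<phi> m)"
    by (simp only: can_map_el counit_can_form[OF Md_dual] comatrix_counit_el)
qed

lemma comatrix_coring_simps:
  "carrier (comatrix_coring A C Ms M \<mu>M \<nu>M) = carrier G"
  "bimod_hom A (comatrix_coring A C Ms M \<mu>M \<nu>M) C = bimod_hom A G C"
  "comult (comatrix_coring A C Ms M \<mu>M \<nu>M) = comatrix_comult A C Ms M \<mu>M \<nu>M"
  "counit (comatrix_coring A C Ms M \<mu>M \<nu>M) = comatrix_counit A C Ms M \<mu>M \<nu>M"
  by (simp_all add: comatrix_coring_def bimod.defs coring.defs bimod_hom_def is_bimod_hom_def is_rmod_hom_def)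

lemma can_map_coring_hom: "can_map \<in> coring_hom A (comatrix_coring A C Ms M \<mu>M \<nu>M) C"
  unfolding coring_hom_def comatrix_coring_simps
  using can_map_hom comult_can_map counit_can_map by blast

lemma can_map_generator:
  assumes m: "m \<in> carrier (Ms i)" and \<phi>: "\<phi> \<in> dual A (Ms i)"
  shows "can_map (el (compose (carrier M) \<phi> (\<nu>M i)) (\<mu>M i m))
    = tlift C (\<lambda>x c. \<phi> x \<triangleright>\<^bsub>C\<^esub> c) (coact (Ms i) m)"
proof -
  interpret Mi: comodule A C "Ms i" by (rule Ms_comodule)
  have \<mu>: "right_linear (carrier A) (Ms i) M (\<mu>M i)"
    and co: "coact M (\<mu>M i m) = tensor_map (carrier A) M C (\<mu>M i) id (coact (Ms i) m)"
    using \<mu>M_hom[of i] m by (simp_all add: is_comod_hom_def is_rmod_hom_iff)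
  have cm: "coact (Ms i) m \<in> carrier (tensor_ab (carrier A) (Ms i) C)"
    using Mi.coact_hom m by (auto simp: is_rmod_hom_def)
  have "can_map (el (compose (carrier M) \<phi> (\<nu>M i)) (\<mu>M i m))
      = contract C (compose (carrier M) \<phi> (\<nu>M i)) (tensor_map (carrier A) M C (\<mu>M i) id (coact (Ms i) m))"
    unfolding can_map_el[OF dual_pullback(1)[OF \<phi>] \<mu>M_closed[OF m]] can_form_def co ..
  also have "\<dots> = contract C \<phi> (coact (Ms i) m)"
    by (rule contract_tensor_map[OF Mi.right_module_axioms Cb.left_module_axioms M.right_module_axioms \<mu>
          Md_dual[OF dual_pullback(1)[OF \<phi>]] \<phi> _ cm])
      (simp add: compose_eq \<mu>M_closed \<nu>M_\<mu>M)
  finally show ?thesis by (simp add: contract_def)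
qed

theorem canonical_coring_hom:
  "\<exists>!can. can \<in> coring_hom A (comatrix_coring A C Ms M \<mu>M \<nu>M) C
    \<and> (\<forall>i. \<forall>m\<in>carrier (Ms i). \<forall>\<phi>\<in>dual A (Ms i).
         can (el (compose (carrier M) \<phi> (\<nu>M i)) (\<mu>M i m))
         = tlift C (\<lambda>x c. \<phi> x \<triangleright>\<^bsub>C\<^esub> c) (coact (Ms i) m))"
proof (rule ex1I[of _ can_map])
  show "can_map \<in> coring_hom A (comatrix_coring A C Ms M \<mu>M \<nu>M) C
    \<and> (\<forall>i. \<forall>m\<in>carrier (Ms i). \<forall>\<phi>\<in>dual A (Ms i).
         can_map (el (compose (carrier M) \<phi> (\<nu>M i)) (\<mu>M i m))
         = tlift C (\<lambda>x c. \<phi> x \<triangleright>\<^bsub>C\<^esub> c) (coact (Ms i) m))"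
    using can_map_coring_hom can_map_generator by blast
next
  fix f
  assume f: "f \<in> coring_hom A (comatrix_coring A C Ms M \<mu>M \<nu>M) C
    \<and> (\<forall>i. \<forall>m\<in>carrier (Ms i). \<forall>\<phi>\<in>dual A (Ms i).
         f (el (compose (carrier M) \<phi> (\<nu>M i)) (\<mu>M i m))
         = tlift C (\<lambda>x c. \<phi> x \<triangleright>\<^bsub>C\<^esub> c) (coact (Ms i) m))"
  then have "f \<in> bimod_hom A G C"
    by (simp add: coring_hom_def comatrix_coring_simps)
  then show "f = can_map"
    using f by (intro bimod_hom_eq_on_generators[OF _ can_map_hom]) (simp_all only: can_map_generator)
qed

end

theorem proposition6p2:
  fixes K :: "('k, 'kx) ring_scheme"
    and A :: "('k, 'a, 'ax) module_scheme"
    and C :: "('c, 'a, 'cx) coring_scheme"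
    and Ms :: "'i::order \<Rightarrow> ('m, 'a, 'c) comod"
    and M :: "('m, 'a, 'c) comod"
    and \<mu> \<nu> :: "'i \<Rightarrow> 'i \<Rightarrow> 'm \<Rightarrow> 'm"
    and \<mu>M \<nu>M :: "'i \<Rightarrow> 'm \<Rightarrow> 'm"
  assumes "coring K A C"
    and "split_direct_system A C Ms \<mu> \<nu>"
    and "is_colimit A C Ms \<mu> M \<mu>M"
    and "\<And>i. is_comod_hom A C M (Ms i) (\<nu>M i)"
    and "\<And>i m. m \<in> carrier (Ms i) \<Longrightarrow> \<nu>M i (\<mu>M i m) = m"
    and "\<And>i j m. i \<le> j \<Longrightarrow> m \<in> carrier M \<Longrightarrow> \<nu>M i m = \<nu> i j (\<nu>M j m)"
  shows "\<exists>!can. can \<in> coring_hom A (comatrix_coring A C Ms M \<mu>M \<nu>M) C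
    \<and> (\<forall>i. \<forall>m\<in>carrier (Ms i). \<forall>\<phi>\<in>dual A (Ms i).
         can (comatrix_elem A C M \<mu>M \<nu>M (compose (carrier M) \<phi> (\<nu>M i)) (\<mu>M i m))
         = tlift C (\<lambda>x c. \<phi> x \<triangleright>\<^bsub>C\<^esub> c) (coact (Ms i) m))"
proof -
  have cocone: "is_cocone A C Ms \<mu> M \<mu>M"
    using assms(3) by (simp add: is_colimit_def)
  interpret C: coring K A C by fact
  interpret M: comodule A C M
    using cocone by (simp add: is_cocone_def)
  have \<mu>\<mu>: "\<mu>M j (\<mu> j i m) = \<mu>M i m" if "i \<le> j" "m \<in> carrier (Ms i)" for i j m
    using cocone that by (simp add: is_cocone_def)
  have \<mu>c: "\<mu> j i m \<in> carrier (Ms j)" if "i \<le> j" "m \<in> carrier (Ms i)" for i j m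
  proof -
    have "is_comod_hom A C (Ms i) (Ms j) (\<mu> j i)"
      using assms(2) that(1) by (simp add: split_direct_system_def)
    then show ?thesis using that(2) by (auto simp: is_comod_hom_def is_rmod_hom_def)
  qed
  have \<nu>c: "\<nu>M i m \<in> carrier (Ms i)" if "m \<in> carrier M" for i m
    using assms(4)[of i] that by (auto simp: is_comod_hom_def is_rmod_hom_def)
  have \<mu>Mc: "\<mu>M i m \<in> carrier M" if "m \<in> carrier (Ms i)" for i m
    using cocone that by (auto simp: is_cocone_def is_comod_hom_def is_rmod_hom_def)
  interpret split_colimit K A C M Ms \<mu>M \<nu>M
  proof (intro split_colimit.intro split_colimit_axioms.intro)
    show "\<exists>k. i \<le> k \<and> j \<le> k" for i j :: 'i
      using assms(2) by (simp add: split_direct_system_def)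
    show "comodule A C (Ms i)" "fgp A (Ms i)" for i
      using assms(2) by (simp_all add: split_direct_system_def)
    show "is_comod_hom A C (Ms i) M (\<mu>M i)" for i
      using cocone by (simp add: is_cocone_def)
    fix i j :: 'i and m assume ij: "i \<le> j" and m: "m \<in> carrier M"
    have "\<nu>M j (\<mu>M i (\<nu>M i m)) = \<mu> j i (\<nu>M i m)"
      using \<mu>\<mu>[OF ij \<nu>c[OF m]] assms(5)[OF \<mu>c[OF ij \<nu>c[OF m]]] by simp
    then show "\<mu>M j (\<nu>M j (\<mu>M i (\<nu>M i m))) = \<mu>M i (\<nu>M i m)"
      using \<mu>\<mu>[OF ij \<nu>c[OF m]] by simp
    have "\<nu>M i (\<mu>M j (\<nu>M j m)) = \<nu> i j (\<nu>M j m)"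
      using assms(6)[OF ij \<mu>Mc[OF \<nu>c[OF m]]] assms(5)[OF \<nu>c[OF m]] by simp
    then show "\<mu>M i (\<nu>M i (\<mu>M j (\<nu>M j m))) = \<mu>M i (\<nu>M i m)"
      using assms(6)[OF ij m] by simp
  qed (fact C.coring_axioms M.comodule_axioms assms(4,5))+
  show ?thesis by (rule canonical_coring_hom)
qed

end
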